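(* Let $P$ be a Delzant lattice polytope in the Euclidean space $(\mathbb{R}^m,\mathbb{Z}^m)$ with the standard inner product $Q$, and let $\varphi\in C^\infty(P)$. Then the coefficient $A_2(P;\varphi)$ of $N^{-2}$ in the asymptotic expansion $R_N(P;\varphi)\sim\sum_{n\ge0}A_n(P;\varphi)N^{-n}$ $(N\to\infty)$ is $$A_2(P;\varphi)=-\frac1{12}\sum_{g\in\mathcal{F}(P)_{m-1}}\frac1{Q(\alpha_g,\alpha_g)}\int_g\nabla_{\alpha_g}\varphi+\sum_{g\in\mathcal{F}(P)_{m-2}}\left[\frac14-\frac1{12}\left(\frac{Q(\alpha_1(g),\alpha_2(g))}{Q(\alpha_1(g),\alpha_1(g))}+\frac{Q(\alpha_1(g),\alpha_2(g))}{Q(\alpha_2(g),\alpha_2(g))}\right)\right]\int_g\varphi,$$ where for $g\in\mathcal{F}(P)_{m-1}$ the vector $\alpha_g$ is the inward primitive normal to $g$, and for $g\in\mathcal{F}(P)_{m-2}$ the vectors $\alpha_1(g),\alpha_2(g)$ are the inward primitive normals to the facets $g_1,g_2\in\mathcal{F}(P)_{m-1}$ such that $g=g_1\cap g_2$.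
   Context: A lattice polytope in $\mathbb{R}^m$ is a convex polytope with all vertices in $\mathbb{Z}^m$. It is Delzant if at each vertex $v$ there are exactly $m$ incident edges and there is a $\mathbb{Z}$-basis $E$ of $\mathbb{Z}^m$ such that each edge incident to $v$ lies on a half line $\{v+te:t\ge0\}$ with $e\in E$. $\mathcal{F}(P)_k$ is the set of $k$-dimensional faces. An inward primitive normal to a facet is the primitive vector of $\mathbb{Z}^m$ orthogonal to the facet and pointing into $P$. For a face $g$, $L(g)$ is the linear subspace parallel to its affine hull; integrals over $g$ are with respect to the translate to the affine hull of $g$ of the Lebesgue measure on $L(g)$ for which a fundamental domain of $L(g)\cap\mathbb{Z}^m$ has measure $1$ (evaluation, for a vertex). $\nabla_\alpha$ is the derivative in direction $\alpha$. $R_N(P;\varphi)=N^{-\dim(P)}\sum_{\gamma\in(NP)\cap\mathbb{Z}^m}\varphi(\gamma/N)$ for positive integers $N$; $C^\infty(P)$ is the set of restrictions to $P$ of smooth functions on $\mathbb{R}^m$. $R_N\sim\sum_{n\ge0}a_nN^{-n}$ means $R_N-\sum_{n<M}a_nN^{-n}=O(N^{-M})$ for every $M\ge1$; this determines the coefficients $a_n$ uniquely. *)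

theory Defs
  imports "HOL-Analysis.Analysis" "HOL-Library.Landau_Symbols"
begin

definition int_lattice :: "(real ^ 'n) set" where
  "int_lattice = {x. \<forall>i. x $ i \<in> \<int>}"

text \<open>\<open>E\<close> is a basis of the additive group \<open>L\<close> as a \<open>\<int>\<close>-module.\<close>

definition int_basis :: "'a::real_vector set \<Rightarrow> 'a set \<Rightarrow> bool" where
  "int_basis E L \<longleftrightarrow> finite E
     \<and> (\<forall>c :: 'a \<Rightarrow> int. (\<Sum>e\<in>E. of_int (c e) *\<^sub>R e) = 0 \<longrightarrow> (\<forall>e\<in>E. c e = 0))
     \<and> range (\<lambda>c :: 'a \<Rightarrow> int. \<Sum>e\<in>E. of_int (c e) *\<^sub>R e) = L"

definition lattice_polytope :: "(real ^ 'n) set \<Rightarrow> bool" where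
  "lattice_polytope P \<longleftrightarrow> polytope P \<and> (\<forall>v. v extreme_point_of P \<longrightarrow> v \<in> int_lattice)"

definition delzant :: "(real ^ 'n) set \<Rightarrow> bool" where
  "delzant P \<longleftrightarrow> (\<forall>v. v extreme_point_of P \<longrightarrow>
     card {s. s edge_of P \<and> v \<in> s} = CARD('n) \<and>
     (\<exists>E. int_basis E int_lattice \<and>
        (\<forall>s. s edge_of P \<and> v \<in> s \<longrightarrow> (\<exists>e\<in>E. s \<subseteq> {v + t *\<^sub>R e |t. 0 \<le> t}))))"

text \<open>The dimension is an integer, so that \<open>m - 2\<close> is not truncated for \<open>m = 1\<close>; the empty
  face, to which the library assigns the dimension \<open>-1\<close>, is not counted.\<close>

definition faces_of_dim :: "'a::euclidean_space set \<Rightarrow> int \<Rightarrow> 'a set set" where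
  "faces_of_dim P k = {g. g face_of P \<and> g \<noteq> {} \<and> aff_dim g = k}"

definition primitive_vector :: "real ^ 'n \<Rightarrow> bool" where
  "primitive_vector \<alpha> \<longleftrightarrow> \<alpha> \<in> int_lattice \<and> \<alpha> \<noteq> 0 \<and>
     (\<forall>(k :: int) \<beta>. \<beta> \<in> int_lattice \<and> \<alpha> = of_int k *\<^sub>R \<beta> \<longrightarrow> \<bar>k\<bar> = 1)"

definition inward_primitive_normal :: "(real ^ 'n) set \<Rightarrow> (real ^ 'n) set \<Rightarrow> real ^ 'n" where
  "inward_primitive_normal P g = (THE \<alpha>. primitive_vector \<alpha>
     \<and> (\<forall>x\<in>g. \<forall>y\<in>g. \<alpha> \<bullet> (y - x) = 0)
     \<and> (\<forall>x\<in>g. \<forall>y\<in>P. 0 \<le> \<alpha> \<bullet> (y - x)))"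

text \<open>A face of codimension two lies in exactly two facets, so only their order is a choice
  here; the coefficient \<open>ridge_coeff\<close> below is symmetric in the two.\<close>

definition ridge_facets :: "(real ^ 'n) set \<Rightarrow> (real ^ 'n) set \<Rightarrow> (real ^ 'n) set \<times> (real ^ 'n) set" where
  "ridge_facets P g = (SOME (g1, g2).
     g1 \<in> faces_of_dim P (int CARD('n) - 1) \<and> g2 \<in> faces_of_dim P (int CARD('n) - 1) \<and> g = g1 \<inter> g2)"

definition ridge_coeff :: "(real ^ 'n) set \<Rightarrow> (real ^ 'n) set \<Rightarrow> real" where
  "ridge_coeff P g =
     (let (g1, g2) = ridge_facets P g;
          \<alpha>1 = inward_primitive_normal P g1;
          \<alpha>2 = inward_primitive_normal P g2
      in 1/4 - 1/12 * ((\<alpha>1 \<bullet> \<alpha>2) / (\<alpha>1 \<bullet> \<alpha>1) + (\<alpha>1 \<bullet> \<alpha>2) / (\<alpha>2 \<bullet> \<alpha>2)))"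

definition parallel_subspace :: "'a::real_vector set \<Rightarrow> 'a set" where
  "parallel_subspace g = {x - y |x y. x \<in> affine hull g \<and> y \<in> affine hull g}"

text \<open>Lebesgue measure on the affine hull of \<open>g\<close>, in the coordinates given by a
  \<open>\<int>\<close>-basis \<open>B\<close> of the lattice points of the parallel subspace: a fundamental parallelepiped
  has measure \<open>1\<close>. The measure depends neither on \<open>B\<close> (a change of basis has determinant
  \<open>1\<close> or \<open>-1\<close>) nor on the base point \<open>p\<close>. If \<open>g\<close> is a point, then \<open>B = {}\<close>, the product
  measure is a unit mass, and the result is the unit mass at that point.\<close>

definition lattice_measure :: "(real ^ 'n) set \<Rightarrow> (real ^ 'n) measure" where
  "lattice_measure g =
     (let B = (SOME B. int_basis B (parallel_subspace g \<inter> int_lattice));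
          p = (SOME p. p \<in> affine hull g)
      in distr (\<Pi>\<^sub>M b\<in>B. lborel) borel (\<lambda>c. p + (\<Sum>b\<in>B. c b *\<^sub>R b)))"

definition face_integral :: "(real ^ 'n) set \<Rightarrow> (real ^ 'n \<Rightarrow> real) \<Rightarrow> real" where
  "face_integral g f = set_lebesgue_integral (lattice_measure g) g f"

text \<open>\<open>C_diff k f\<close>: \<open>f\<close> is \<open>k\<close> times continuously differentiable on the whole space.\<close>

primrec C_diff :: "nat \<Rightarrow> ('a::euclidean_space \<Rightarrow> real) \<Rightarrow> bool" where
  "C_diff 0 f \<longleftrightarrow> continuous_on UNIV f"
| "C_diff (Suc k) f \<longleftrightarrow> (\<forall>x. f differentiable (at x))
     \<and> (\<forall>v. C_diff k (\<lambda>x. frechet_derivative f (at x) v))"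

definition smooth :: "('a::euclidean_space \<Rightarrow> real) \<Rightarrow> bool" where
  "smooth f \<longleftrightarrow> (\<forall>k. C_diff k f)"

definition C_infinity :: "'a::euclidean_space set \<Rightarrow> ('a \<Rightarrow> real) set" where
  "C_infinity P = {\<phi>. \<exists>\<psi>. smooth \<psi> \<and> (\<forall>x\<in>P. \<phi> x = \<psi> x)}"

text \<open>Only the values of \<open>\<phi>\<close> on \<open>P\<close> matter. For a convex \<open>P\<close> with nonempty interior the derivative
  within \<open>P\<close> is unique also at boundary points, and it is the derivative of every smooth
  extension of \<open>\<phi>\<close>.\<close>

definition dir_deriv :: "'a::euclidean_space set \<Rightarrow> 'a \<Rightarrow> ('a \<Rightarrow> real) \<Rightarrow> 'a \<Rightarrow> real" where
  "dir_deriv P \<alpha> \<phi> x = frechet_derivative \<phi> (at x within P) \<alpha>"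

definition riemann_sum :: "(real ^ 'n) set \<Rightarrow> (real ^ 'n \<Rightarrow> real) \<Rightarrow> nat \<Rightarrow> real" where
  "riemann_sum P \<phi> N = real N powi (- aff_dim P) *
     (\<Sum>\<gamma> \<in> (\<lambda>x. real N *\<^sub>R x) ` P \<inter> int_lattice. \<phi> (\<gamma> /\<^sub>R real N))"

definition has_asymptotic_expansion :: "(nat \<Rightarrow> real) \<Rightarrow> (nat \<Rightarrow> real) \<Rightarrow> bool" where
  "has_asymptotic_expansion R a \<longleftrightarrow>
     (\<forall>M\<ge>1. (\<lambda>N. R N - (\<Sum>n<M. a n * real N powi (- int n))) \<in> O(\<lambda>N. real N powi (- int M)))"

definition riemann_coeff :: "(real ^ 'n) set \<Rightarrow> (real ^ 'n \<Rightarrow> real) \<Rightarrow> nat \<Rightarrow> real" where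
  "riemann_coeff P \<phi> = (THE a. has_asymptotic_expansion (riemann_sum P \<phi>) a)"

end

theory Submission imports Defs begin

text \<open>
  Near a vertex the polytope is an orthant in unimodular coordinates. Partitioning the orthant into
  cubes of side \<open>1 / N\<close> and expanding a function \<open>f\<close> in each cube at the lower corner expresses
  \<open>\<integral> f\<close> by Riemann sums of \<open>f\<close> and of its derivatives; solving recursively for the Riemann sum
  of \<open>f\<close> gives its full expansion, with second coefficient
  \<open>\<integral> (1/12 \<Sum>\<^sub>i \<partial>\<^sub>i\<partial>\<^sub>i f + 1/8 \<Sum>\<^sub>i\<^sub>\<noteq>\<^sub>j \<partial>\<^sub>i\<partial>\<^sub>j f)\<close>, which Fubini turns into integrals over the
  coordinate faces. In these coordinates \<open>\<partial>\<^sub>i\<close> is the derivative along the edge vector \<open>e i\<close>, and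
  \<open>e i - \<alpha> i / (\<alpha> i \<bullet> \<alpha> i)\<close> is tangent to the \<open>i\<close>-th facet, so that replacing \<open>e i\<close> by the normal
  \<open>\<alpha> i\<close> costs only ridge integrals. A partition of unity indexed by the vertices glues the local
  formulas. For the expansion up to order \<open>M\<close> it need only be of class \<open>C\<^sup>M\<close>, since the
  coefficients are determined by the Riemann sums.
\<close>

section \<open>Continuously differentiable functions\<close>

text \<open>The recursion inverts averaging over the unit cube, an operator with symbol the product
  of the (exp d_i - 1)/d_i. Hence the second coefficient is the degree-two part of the product of
  the d_i/(exp d_i - 1); this is the origin of 1/12, and of 1/4 = 1/8 + 1/8 for the two orders of a
  pair. Two obstacles shape the rest. The measure of a face is defined by an arbitrary lattice
  basis, whereas Fubini at a vertex needs the edge basis; both are compared through integrals over a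
  strip in the whole space. And a local formula sees only the faces through its own vertex
  \<open>v\<close>. The cutoff at \<open>v\<close> therefore vanishes on an open set that contains
  every face missing \<open>v\<close>, as well as every point of the cone at \<open>v\<close> that
  is not in the polytope. The first property lets the local sums run over all faces, so that they
  can be added; the second makes the orthant formula blind to the remaining facets. This open set is
  cut out by the half-spaces defining the polytope that are not tight at \<open>v\<close>.\<close>

definition Dv :: "'a::euclidean_space \<Rightarrow> ('a \<Rightarrow> real) \<Rightarrow> 'a \<Rightarrow> real" where
  "Dv v f = (\<lambda>x. frechet_derivative f (at x) v)"

lemma C_diff_Suc: "C_diff (Suc k) f \<longleftrightarrow> (\<forall>x. f differentiable (at x)) \<and> (\<forall>v. C_diff k (Dv v f))"
  by (simp add: Dv_def)

lemma Dv_eqI: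
  assumes "(f has_derivative f') (at x)"
  shows "Dv v f x = f' v"
  using frechet_derivative_at[OF assms] by (simp add: Dv_def)

lemma has_derivative_Dv:
  assumes "f differentiable (at x)"
  shows "(f has_derivative (\<lambda>v. Dv v f x)) (at x)"
  using assms by (simp add: Dv_def frechet_derivative_works)

lemma C_diff_SucI:
  assumes "\<And>x. (f has_derivative f' x) (at x)" "\<And>v. C_diff k (\<lambda>x. f' x v)"
  shows "C_diff (Suc k) f"
proof -
  have "Dv v f = (\<lambda>x. f' x v)" for v
    using Dv_eqI[OF assms(1)] by blast
  then show ?thesis
    using assms unfolding C_diff_Suc differentiable_def by metis
qed

lemma C_diff_has_derivative:
  "C_diff (Suc k) f \<Longrightarrow> (f has_derivative (\<lambda>v. Dv v f x)) (at x)"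
  by (rule has_derivative_Dv) simp

lemma C_diff_Dv: "C_diff (Suc k) f \<Longrightarrow> C_diff k (Dv v f)"
  unfolding C_diff_Suc by simp

lemma C_diff_continuous: "C_diff k f \<Longrightarrow> continuous_on UNIV f"
proof (cases k)
  case (Suc j)
  then show "C_diff k f \<Longrightarrow> continuous_on UNIV f"
    by (simp add: continuous_at_imp_continuous_on differentiable_imp_continuous_within)
qed auto

lemma C_diff_SucD: "C_diff (Suc k) f \<Longrightarrow> C_diff k f"
proof (induction k arbitrary: f)
  case 0
  then show ?case using C_diff_continuous C_diff.simps(1) by blast
next
  case (Suc k)
  then show ?case unfolding C_diff_Suc[of "Suc k"] C_diff_Suc[of k] by blast
qed

lemma C_diff_mono: "C_diff k f \<Longrightarrow> j \<le> k \<Longrightarrow> C_diff j f"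
  by (induction k rule: nat.induct) (auto simp: le_Suc_eq dest: C_diff_SucD simp del: C_diff.simps(2))

lemma C_diff_const [intro]: "C_diff k (\<lambda>x. c)"
proof (induction k arbitrary: c)
  case (Suc k)
  show ?case by (rule C_diff_SucI[where f' = "\<lambda>x v. 0"]) (auto intro: Suc)
qed simp

lemma C_diff_add [intro]: "C_diff k f \<Longrightarrow> C_diff k g \<Longrightarrow> C_diff k (\<lambda>x. f x + g x)"
proof (induction k arbitrary: f g)
  case 0
  then show ?case by (auto intro: continuous_intros)
next
  case (Suc k)
  note f = C_diff_has_derivative[OF Suc.prems(1)] and g = C_diff_has_derivative[OF Suc.prems(2)]
  show ?case
    by (rule C_diff_SucI[OF has_derivative_add[OF f g]]) (intro Suc C_diff_Dv)
qed

lemma C_diff_mult [intro]: "C_diff k f \<Longrightarrow> C_diff k g \<Longrightarrow> C_diff k (\<lambda>x. f x * g x)"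
proof (induction k arbitrary: f g)
  case 0
  then show ?case by (auto intro: continuous_intros)
next
  case (Suc k)
  note f = C_diff_has_derivative[OF Suc.prems(1)] and g = C_diff_has_derivative[OF Suc.prems(2)]
  show ?case
    by (rule C_diff_SucI[OF has_derivative_mult[OF f g]])
      (intro C_diff_add Suc.IH[OF C_diff_SucD[OF Suc.prems(1)] C_diff_Dv[OF Suc.prems(2)]]
        Suc.IH[OF C_diff_Dv[OF Suc.prems(1)] C_diff_SucD[OF Suc.prems(2)]])
qed

lemma C_diff_diff [intro]: "C_diff k f \<Longrightarrow> C_diff k g \<Longrightarrow> C_diff k (\<lambda>x. f x - g x)"
proof -
  assume f: "C_diff k f" and g: "C_diff k g"
  have "C_diff k (\<lambda>x. f x + (- 1) * g x)"
    by (rule C_diff_add[OF f C_diff_mult[OF C_diff_const g]])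
  then show ?thesis by simp
qed

lemma C_diff_sum [intro]: "(\<And>i. i \<in> I \<Longrightarrow> C_diff k (f i)) \<Longrightarrow> C_diff k (\<lambda>x. \<Sum>i\<in>I. f i x)"
  by (induction I rule: infinite_finite_induct) auto

lemma C_diff_prod [intro]: "(\<And>i. i \<in> I \<Longrightarrow> C_diff k (f i)) \<Longrightarrow> C_diff k (\<lambda>x. \<Prod>i\<in>I. f i x)"
  by (induction I rule: infinite_finite_induct) auto

lemma Dv_compose_affine:
  assumes "bounded_linear T" "f differentiable (at (c + T x))"
  shows "Dv v (\<lambda>x. f (c + T x)) x = Dv (T v) f (c + T x)"
proof (rule Dv_eqI)
  have "((\<lambda>x. c + T x) has_derivative T) (at x)"
    using has_derivative_add[OF has_derivative_const bounded_linear_imp_has_derivative[OF assms(1)]]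
    by simp
  from has_derivative_compose[OF this has_derivative_Dv[OF assms(2)]]
  show "((\<lambda>x. f (c + T x)) has_derivative (\<lambda>v. Dv (T v) f (c + T x))) (at x)" .
qed

lemma C_diff_compose_affine:
  assumes "bounded_linear T"
  shows "C_diff k f \<Longrightarrow> C_diff k (\<lambda>x. f (c + T x))"
proof (induction k arbitrary: f)
  case 0
  then show ?case
    using continuous_on_compose2[of UNIV f UNIV "\<lambda>x. c + T x"]
      continuous_on_add[OF continuous_on_const linear_continuous_on[OF assms]]
    by auto
next
  case (Suc k)
  have "((\<lambda>x. c + T x) has_derivative T) (at x)" for x
    using has_derivative_add[OF has_derivative_const bounded_linear_imp_has_derivative[OF assms(1)]]
    by simp
  from has_derivative_compose[OF this C_diff_has_derivative[OF Suc.prems]]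
  show ?case
    by (rule C_diff_SucI) (intro Suc.IH C_diff_Dv Suc.prems)
qed

lemma C_diff_inner: "C_diff k (\<lambda>x. a \<bullet> x)"
proof (cases k)
  case (Suc j)
  show ?thesis unfolding Suc
    by (rule C_diff_SucI[where f' = "\<lambda>x v. a \<bullet> v"]) (auto intro!: derivative_eq_intros)
qed (auto intro!: continuous_intros)

lemma C_diff_compose_real:
  fixes h :: "real \<Rightarrow> real"
  shows "C_diff k h \<Longrightarrow> C_diff k f \<Longrightarrow> C_diff k (\<lambda>x. h (f x))"
proof (induction k arbitrary: h f)
  case 0
  then show ?case using continuous_on_compose2[of UNIV h UNIV f] by auto
next
  case (Suc k)
  note f = C_diff_has_derivative[OF Suc.prems(2)] and h = C_diff_has_derivative[OF Suc.prems(1)]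
  \<comment> \<open>The inner derivative is a real number, hence a multiple of the direction 1, and
    the derivative of \<open>h\<close> is linear in the direction.\<close>
  have "Dv (Dv v f x) h y = Dv v f x * Dv 1 h y" for v x y
    using linear_scale[OF has_derivative_linear[OF h[of y]], of "Dv v f x" 1] by simp
  then have "((\<lambda>x. h (f x)) has_derivative (\<lambda>v. Dv v f x * Dv 1 h (f x))) (at x)" for x
    using has_derivative_compose[OF f h] by simp
  then show ?case
    by (rule C_diff_SucI)
      (intro C_diff_mult[OF C_diff_Dv[OF Suc.prems(2)]]
        Suc.IH[OF C_diff_Dv[OF Suc.prems(1)] C_diff_SucD[OF Suc.prems(2)]])
qed

section \<open>Cutoff functions of finite smoothness\<close>

lemma C_diff_max_power: "C_diff k (\<lambda>t::real. max 0 t ^ Suc k)"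
proof (induction k)
  case 0
  show ?case by (auto intro!: continuous_intros)
next
  case (Suc k)
  have D: "((\<lambda>t::real. max 0 t ^ Suc (Suc k)) has_field_derivative
      real (Suc (Suc k)) * max 0 t ^ Suc k) (at t)" for t
  proof (cases t "0::real" rule: linorder_cases)
    case less
    have "((\<lambda>t::real. 0) has_field_derivative real (Suc (Suc k)) * max 0 t ^ Suc k) (at t)"
      using less by (auto simp: max_def)
    then show ?thesis
      by (rule has_field_derivative_transform_within_open[of _ _ _ "{..<0}"]) (use less in \<open>auto simp: max_def\<close>)
  next
    case greater
    have "((\<lambda>t::real. t ^ Suc (Suc k)) has_field_derivative real (Suc (Suc k)) * max 0 t ^ Suc k) (at t)"
      using greater DERIV_power[OF DERIV_ident, of "Suc (Suc k)" t UNIV] by (simp add: max_def)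
    then show ?thesis
      by (rule has_field_derivative_transform_within_open[of _ _ _ "{0<..}"]) (use greater in \<open>auto simp: max_def\<close>)
  next
    case equal
    \<comment> \<open>At 0 the difference quotient of the power is the next lower power itself,
      which tends to 0.\<close>
    have "((\<lambda>h::real. max 0 h ^ Suc k) \<longlongrightarrow> max 0 0 ^ Suc k) (at 0)"
      by (intro tendsto_intros)
    moreover have "eventually (\<lambda>h::real. max 0 h ^ Suc k
        = (max 0 (0 + h) ^ Suc (Suc k) - max 0 0 ^ Suc (Suc k)) / h) (at 0)"
      by (auto simp: eventually_at_filter max_def field_simps)
    ultimately show ?thesis
      unfolding equal DERIV_def by (auto intro: Lim_transform_eventually)
  qed
  show ?case
  proof (rule C_diff_SucI)
    show "((\<lambda>t::real. max 0 t ^ Suc (Suc k)) has_derivative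
        (\<lambda>v. (real (Suc (Suc k)) * max 0 t ^ Suc k) * v)) (at t)" for t
      using D[of t] by (simp add: has_field_derivative_def)
    show "C_diff k (\<lambda>t. real (Suc (Suc k)) * max 0 t ^ Suc k * v)" for v :: real
      by (intro C_diff_mult C_diff_const Suc.IH)
  qed
qed

text \<open>A step of class C^k that rises from 0 to 1 on the interval [1, 2]. The inner power is 0
  up to 1 and at least 1 from 2 on; the outer positive part cuts off what then becomes negative, and
  its power keeps the cut of class C^k.\<close>

definition plateau :: "nat \<Rightarrow> real \<Rightarrow> real" where
  "plateau k t = 1 - max 0 (1 - max 0 (t - 1) ^ Suc k) ^ Suc k"

lemma C_diff_plateau: "C_diff k (plateau k)"
proof -
  have 1: "C_diff k (\<lambda>t::real. max 0 (- 1 + t) ^ Suc k)"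
    by (rule C_diff_compose_affine[OF bounded_linear_ident C_diff_max_power])
  show ?thesis unfolding plateau_def[abs_def]
    using C_diff_compose_real[OF C_diff_max_power C_diff_diff[OF C_diff_const[of k 1] 1]] by auto
qed

lemma plateau_eq_0: "t \<le> 1 \<Longrightarrow> plateau k t = 0"
  by (simp add: plateau_def max_def)

lemma plateau_eq_1: "2 \<le> t \<Longrightarrow> plateau k t = 1"
  using one_le_power[of "t - 1" "Suc k"] by (simp add: plateau_def max_def)

section \<open>Linearity of the directional derivative and restriction to lines\<close>

lemma Dv_eq_0:
  assumes "open U" "x \<in> U" "\<And>y. y \<in> U \<Longrightarrow> f y = 0"
  shows "Dv v f x = 0"
proof -
  have "((\<lambda>x. 0) has_derivative (\<lambda>v. 0)) (at x)" by simp
  then have "(f has_derivative (\<lambda>v. 0)) (at x)"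
    by (rule has_derivative_transform_within_open) (use assms in auto)
  from Dv_eqI[OF this] show ?thesis .
qed

lemma Dv_add_dir: "f differentiable (at x) \<Longrightarrow> Dv (v + w) f x = Dv v f x + Dv w f x"
  using linear_add[OF has_derivative_linear[OF has_derivative_Dv]] by blast

lemma Dv_scaleR_dir: "f differentiable (at x) \<Longrightarrow> Dv (c *\<^sub>R v) f x = c * Dv v f x"
  using linear_scale[OF has_derivative_linear[OF has_derivative_Dv]] by fastforce

lemma Dv_sum_dir: "f differentiable (at x) \<Longrightarrow> Dv (\<Sum>i\<in>I. c i *\<^sub>R v i) f x = (\<Sum>i\<in>I. c i * Dv (v i) f x)"
  using linear_sum[OF has_derivative_linear[OF has_derivative_Dv[of f x]], of "\<lambda>i. c i *\<^sub>R v i" I]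
  by (simp add: Dv_scaleR_dir)

lemma Dv_sum:
  assumes "\<And>i. i \<in> I \<Longrightarrow> f i differentiable (at x)"
  shows "Dv v (\<lambda>x. \<Sum>i\<in>I. c i * f i x) x = (\<Sum>i\<in>I. c i * Dv v (f i) x)"
  by (rule Dv_eqI) (intro has_derivative_sum has_derivative_mult_right has_derivative_Dv assms)

lemma DERIV_along_line:
  assumes "f differentiable (at (x + t *\<^sub>R s))"
  shows "((\<lambda>t. f (x + t *\<^sub>R s)) has_real_derivative Dv s f (x + t *\<^sub>R s)) (at t)"
proof -
  have 1: "((\<lambda>t. x + t *\<^sub>R s) has_derivative (\<lambda>h. h *\<^sub>R s)) (at t)"
    by (auto intro!: derivative_eq_intros)
  have 2: "(\<lambda>h. h * Dv s f (x + t *\<^sub>R s)) = (*) (Dv s f (x + t *\<^sub>R s))"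
    by (auto simp: mult.commute)
  show ?thesis
    using has_derivative_compose[OF 1 has_derivative_Dv[OF assms]]
    unfolding has_field_derivative_def Dv_scaleR_dir[OF assms] 2 .
qed

section \<open>Unimodular maps and the lattice measure of a face\<close>

abbreviation lborel_PiM :: "'i set \<Rightarrow> ('i \<Rightarrow> real) measure" where
  "lborel_PiM I \<equiv> \<Pi>\<^sub>M i\<in>I. lborel"

interpretation lborel_prod: product_sigma_finite "\<lambda>_::'i. lborel :: real measure"
  by standard

lemma measurable_vec_lambda [measurable]:
  "vec_lambda \<in> lborel_PiM (UNIV :: 'n::finite set) \<rightarrow>\<^sub>M borel"
proof -
  have "(\<lambda>f::'n \<Rightarrow> real. \<Sum>i\<in>UNIV. f i *\<^sub>R axis i 1) \<in> lborel_PiM UNIV \<rightarrow>\<^sub>M (borel :: (real^'n) measure)"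
    by measurable
  moreover have "(\<lambda>f::'n \<Rightarrow> real. \<Sum>i\<in>UNIV. f i *\<^sub>R axis i 1) = vec_lambda"
    by (auto simp: vec_eq_iff axis_def if_distrib cong: if_cong)
  ultimately show ?thesis by simp
qed

lemma sum_Basis_vec: "(\<Sum>b\<in>Basis. h b) = (\<Sum>i\<in>UNIV. h (axis i 1 :: real^'n))"
  by (simp add: Basis_vec_def UNION_singleton_eq_range sum.reindex axis_eq_axis inj_on_def)

lemma prod_Basis_vec: "(\<Prod>b\<in>Basis. h b) = (\<Prod>i\<in>UNIV. h (axis i 1 :: real^'n))"
  by (simp add: Basis_vec_def UNION_singleton_eq_range prod.reindex axis_eq_axis inj_on_def)

lemma lborel_vec: "lborel = distr (lborel_PiM (UNIV :: 'n::finite set)) borel vec_lambda"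
proof (rule lborel_eqI)
  fix l u :: "real^'n" assume le: "\<And>b. b \<in> Basis \<Longrightarrow> l \<bullet> b \<le> u \<bullet> b"
  have le': "l $ i \<le> u $ i" for i
    using le[of "axis i 1"] by (simp add: inner_axis axis_in_Basis_iff)
  have "vec_lambda -` box l u \<inter> space (lborel_PiM UNIV) = (\<Pi>\<^sub>E i\<in>UNIV. {l $ i <..< u $ i})"
    by (auto simp: space_PiM mem_box_cart PiE_iff)
  then have "emeasure (distr (lborel_PiM (UNIV :: 'n set)) borel vec_lambda) (box l u)
      = (\<Prod>i\<in>UNIV. ennreal (u $ i - l $ i))"
    using le' by (simp add: emeasure_distr lborel_prod.emeasure_PiM)
  also have "\<dots> = (\<Prod>i\<in>UNIV. ennreal ((u - l) \<bullet> axis i 1))"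
    by (simp add: inner_axis)
  also have "\<dots> = (\<Prod>b\<in>Basis. ennreal ((u - l) \<bullet> b))"
    by (simp add: prod_Basis_vec)
  also have "\<dots> = ennreal (\<Prod>b\<in>Basis. (u - l) \<bullet> b)"
    using le by (intro prod_ennreal) (auto simp: inner_diff_left)
  finally show "emeasure (distr (lborel_PiM (UNIV :: 'n set)) borel vec_lambda) (box l u)
      = ennreal (\<Prod>b\<in>Basis. (u - l) \<bullet> b)" .
qed simp

lemma nn_integral_lborel_vec:
  assumes [measurable]: "g \<in> borel_measurable borel"
  shows "(\<integral>\<^sup>+x. g x \<partial>lborel) = (\<integral>\<^sup>+c. g (vec_lambda c) \<partial>lborel_PiM (UNIV :: 'n::finite set))"
  by (subst lborel_vec, subst nn_integral_distr) auto

lemma integral_lborel_vec: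
  fixes g :: "real^'n \<Rightarrow> real"
  assumes [measurable]: "g \<in> borel_measurable borel"
  shows "(\<integral>x. g x \<partial>lborel) = (\<integral>c. g (vec_lambda c) \<partial>lborel_PiM UNIV)"
  by (subst lborel_vec, subst integral_distr) auto

lemma linear_borel: "linear f \<Longrightarrow> f \<in> borel \<rightarrow>\<^sub>M borel" for f :: "real^'n \<Rightarrow> real^'n"
  by (intro borel_measurable_continuous_onI linear_continuous_on) (simp add: linear_linear)

lemma nn_integral_vec_Fubini:
  fixes g :: "real^'n \<Rightarrow> ennreal"
  assumes [measurable]: "g \<in> borel_measurable borel"
  shows "(\<integral>\<^sup>+x. g x \<partial>lborel)
    = (\<integral>\<^sup>+c. (\<integral>\<^sup>+y. g (vec_lambda (c(m := y))) \<partial>lborel) \<partial>lborel_PiM (UNIV - {m}))"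
proof -
  have U: "insert m (UNIV - {m}) = (UNIV :: 'n set)" by auto
  show ?thesis
    using lborel_prod.product_nn_integral_insert[of "UNIV - {m}" m "\<lambda>c. g (vec_lambda c)"]
    unfolding U by (simp add: nn_integral_lborel_vec)
qed

text \<open>In the variable \<open>x $ m\<close> alone the shear is a translation by
  \<open>x $ n\<close>, which is constant there because \<open>m \<noteq> n\<close>. Fubini reduces
  the claim to translation invariance on the line.\<close>

lemma nn_integral_shear:
  fixes g :: "real^'n \<Rightarrow> ennreal"
  assumes [measurable]: "g \<in> borel_measurable borel" and "m \<noteq> n"
  shows "(\<integral>\<^sup>+x. g (\<chi> i. if i = m then x $ m + x $ n else x $ i) \<partial>lborel) = (\<integral>\<^sup>+x. g x \<partial>lborel)"
proof -
  have "linear (\<lambda>x::real^'n. \<chi> i. if i = m then x $ m + x $ n else x $ i)"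
    by (rule linearI) (auto simp: vec_eq_iff algebra_simps)
  then have [measurable]: "(\<lambda>x::real^'n. \<chi> i. if i = m then x $ m + x $ n else x $ i) \<in> borel \<rightarrow>\<^sub>M borel"
    by (rule linear_borel)
  have "(\<integral>\<^sup>+x. g (\<chi> i. if i = m then x $ m + x $ n else x $ i) \<partial>lborel)
    = (\<integral>\<^sup>+c. (\<integral>\<^sup>+y. g (vec_lambda (c(m := c n + 1 * y))) \<partial>lborel) \<partial>lborel_PiM (UNIV - {m}))"
    using \<open>m \<noteq> n\<close>
    by (subst nn_integral_vec_Fubini[of _ m])
      (auto intro!: nn_integral_cong arg_cong[of _ _ g] simp: vec_eq_iff)
  also have "\<dots> = (\<integral>\<^sup>+c. (\<integral>\<^sup>+y. g (vec_lambda (c(m := y))) \<partial>lborel) \<partial>lborel_PiM (UNIV - {m}))"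
  proof (rule nn_integral_cong)
    fix c assume c: "c \<in> space (lborel_PiM (UNIV - {m}))"
    have "(\<lambda>y. c(m := y)) \<in> lborel \<rightarrow>\<^sub>M lborel_PiM UNIV"
      using measurable_component_update[OF c, of m] by (simp add: insert_absorb insert_Diff_single)
    then have "(\<lambda>y. g (vec_lambda (c(m := y)))) \<in> borel_measurable borel"
      using measurable_compose[OF measurable_compose[OF _ measurable_vec_lambda] assms(1)] by simp
    from nn_integral_real_affine[OF this, of 1 "c n"]
    show "(\<integral>\<^sup>+y. g (vec_lambda (c(m := c n + 1 * y))) \<partial>lborel) = (\<integral>\<^sup>+y. g (vec_lambda (c(m := y))) \<partial>lborel)"
      by simp
  qed
  also have "\<dots> = (\<integral>\<^sup>+x. g x \<partial>lborel)"
    by (rule nn_integral_vec_Fubini[symmetric]) simp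
  finally show ?thesis .
qed

text \<open>Serves both for permutations of the coordinates and for passing from indices to the
  basis vectors they name. Both sides are compared on boxes, which determine a product
  measure.\<close>

lemma reindex_PiM:
  assumes "inj_on e I" "finite I"
  shows "distr (lborel_PiM I) (lborel_PiM (e ` I)) (\<lambda>c. \<lambda>b\<in>e ` I. c (inv_into I e b)) = lborel_PiM (e ` I)"
proof (rule lborel_prod.PiM_eqI)
  fix A :: "'b \<Rightarrow> real set" assume A: "\<And>i. i \<in> e ` I \<Longrightarrow> A i \<in> sets lborel"
  have m: "(\<lambda>c. \<lambda>b\<in>e ` I. c (inv_into I e b)) \<in> lborel_PiM I \<rightarrow>\<^sub>M lborel_PiM (e ` I)"
    by (intro measurable_restrict measurable_component_singleton) (auto simp: inv_into_into)
  have "(\<lambda>c. \<lambda>b\<in>e ` I. c (inv_into I e b)) -` Pi\<^sub>E (e ` I) A \<inter> space (lborel_PiM I) = (\<Pi>\<^sub>E i\<in>I. A (e i))"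
    using assms(1) by (auto simp: space_PiM PiE_iff)
  then show "emeasure (distr (lborel_PiM I) (lborel_PiM (e ` I)) (\<lambda>c. \<lambda>b\<in>e ` I. c (inv_into I e b))) (Pi\<^sub>E (e ` I) A)
      = (\<Prod>i\<in>e ` I. emeasure lborel (A i))"
    using A assms by (subst emeasure_distr[OF m]) (auto simp: lborel_prod.emeasure_PiM prod.reindex)
qed (use assms in auto)

lemma nn_integral_permute_coordinates:
  fixes g :: "real^'n \<Rightarrow> ennreal" and p :: "'n \<Rightarrow> 'n"
  assumes [measurable]: "g \<in> borel_measurable borel" and p: "bij p"
  shows "(\<integral>\<^sup>+x. g (\<chi> i. x $ p i) \<partial>lborel) = (\<integral>\<^sup>+x. g x \<partial>lborel)"
proof -
  have "linear (\<lambda>x::real^'n. \<chi> i. x $ p i)"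
    by (rule linearI) (auto simp: vec_eq_iff)
  then have [measurable]: "(\<lambda>x::real^'n. \<chi> i. x $ p i) \<in> borel \<rightarrow>\<^sub>M borel"
    by (rule linear_borel)
  note [measurable] = measurable_compose[OF measurable_vec_lambda assms(1)]
  have D: "lborel_PiM UNIV = distr (lborel_PiM UNIV) (lborel_PiM UNIV) (\<lambda>c b. c (inv p b))"
    using reindex_PiM[of p UNIV] p by (simp add: bij_is_surj bij_is_inj restrict_UNIV)
  have m: "(\<lambda>c b. c (inv p b)) \<in> lborel_PiM UNIV \<rightarrow>\<^sub>M lborel_PiM UNIV"
    by (rule measurable_PiM_single') (auto simp: space_PiM)
  have "(\<integral>\<^sup>+x. g (\<chi> i. x $ p i) \<partial>lborel) = (\<integral>\<^sup>+c. g (\<chi> i. c (p i)) \<partial>lborel_PiM UNIV)"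
    by (subst nn_integral_lborel_vec) auto
  also have "\<dots> = (\<integral>\<^sup>+c. g (vec_lambda c) \<partial>lborel_PiM UNIV)"
  proof -
    have "(\<lambda>c. \<chi> i. c (p i)) \<in> lborel_PiM UNIV \<rightarrow>\<^sub>M borel"
      by (rule measurable_compose[OF _ measurable_vec_lambda], rule measurable_PiM_single') (auto simp: space_PiM)
    then have "(\<lambda>c. g (\<chi> i. c (p i))) \<in> borel_measurable (lborel_PiM UNIV)"
      by (rule measurable_compose) (rule assms(1))
    then show ?thesis
      using nn_integral_distr[OF m, of "\<lambda>c. g (\<chi> i. c (p i))"] p by (simp add: D[symmetric] bij_is_inj)
  qed
  also have "\<dots> = (\<integral>\<^sup>+x. g x \<partial>lborel)" by (simp add: nn_integral_lborel_vec)
  finally show ?thesis .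
qed

lemma nn_integral_stretch:
  fixes g :: "real^'n \<Rightarrow> ennreal"
  assumes [measurable]: "g \<in> borel_measurable borel" and c: "\<And>i. c i \<noteq> 0"
  shows "(\<integral>\<^sup>+x. g x \<partial>lborel) = ennreal \<bar>\<Prod>i\<in>UNIV. c i\<bar> * (\<integral>\<^sup>+x. g (\<chi> i. c i * x $ i) \<partial>lborel)"
proof -
  define T where "T = (\<lambda>x::real^'n. \<chi> i. c i * x $ i)"
  \<comment> \<open>The scaling law for Lebesgue measure takes one factor per basis vector; this
    expression recovers \<open>c i\<close> from \<open>axis i 1\<close>.\<close>
  let ?c = "\<lambda>b. \<Sum>i\<in>UNIV. c i * b $ i"
  have cb: "?c (axis i 1) = c i" for i
    by (simp add: axis_def if_distrib cong: if_cong)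
  have T: "T x = 0 + (\<Sum>j\<in>Basis. (?c j * (x \<bullet> j)) *\<^sub>R j)" for x
    unfolding sum_Basis_vec cb by (simp add: T_def inner_axis vec_eq_iff)
      (simp add: axis_def if_distrib cong: if_cong)
  have "linear T" unfolding T_def
    by (rule linearI) (auto simp: vec_eq_iff algebra_simps)
  then have [measurable]: "T \<in> borel \<rightarrow>\<^sub>M borel"
    by (rule linear_borel)
  have "lborel = density (distr lborel borel T) (\<lambda>_. (\<Prod>j\<in>Basis. \<bar>?c j\<bar>))"
    unfolding T[abs_def] by (rule lborel_affine_euclidean) (auto simp: Basis_vec_def cb c)
  also have "(\<Prod>j\<in>Basis. \<bar>?c j\<bar>) = \<bar>\<Prod>i\<in>UNIV. c i\<bar>"
    by (simp add: prod_Basis_vec cb abs_prod)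
  finally have *: "lborel = density (distr lborel borel T) (\<lambda>_. ennreal \<bar>\<Prod>i\<in>UNIV. c i\<bar>)" .
  have Tx: "(\<chi> i. c i * x $ i) = T x" for x by (simp add: T_def)
  show ?thesis
    unfolding Tx by (subst *) (simp add: nn_integral_density nn_integral_distr nn_integral_cmult)
qed

definition scales_lborel :: "(real^'n \<Rightarrow> real^'n) \<Rightarrow> bool" where
  "scales_lborel f \<longleftrightarrow> (\<forall>g \<in> borel_measurable borel.
    (\<integral>\<^sup>+x. g x \<partial>lborel) = ennreal \<bar>det (matrix f)\<bar> * (\<integral>\<^sup>+x. g (f x) \<partial>lborel))"

text \<open>Induction over elementary maps. The determinant condition sits inside the induction
  predicate because the induction also visits singular maps; in a composition, multiplicativity
  passes it on to both factors.\<close>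

lemma linear_scales_lborel:
  fixes f :: "real^'n \<Rightarrow> real^'n"
  assumes "linear f" shows "det (matrix f) \<noteq> 0 \<longrightarrow> scales_lborel f"
proof (rule induct_linear_elementary[OF assms]; (intro impI)?)
  fix f g :: "real^'n \<Rightarrow> real^'n"
  assume lin: "linear f" "linear g" and "det (matrix f) \<noteq> 0 \<longrightarrow> scales_lborel f"
    "det (matrix g) \<noteq> 0 \<longrightarrow> scales_lborel g" and nz: "det (matrix (f \<circ> g)) \<noteq> 0"
  moreover have d: "det (matrix (f \<circ> g)) = det (matrix f) * det (matrix g)"
    using lin by (simp add: matrix_compose det_mul)
  ultimately have f: "scales_lborel f" and g: "scales_lborel g" by auto
  have [measurable]: "f \<in> borel \<rightarrow>\<^sub>M borel"
    by (rule linear_borel[OF lin(1)])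
  show "scales_lborel (f \<circ> g)"
    unfolding scales_lborel_def
  proof
    fix h :: "real^'n \<Rightarrow> ennreal" assume [measurable]: "h \<in> borel_measurable borel"
    have "(\<integral>\<^sup>+x. h x \<partial>lborel) = ennreal \<bar>det (matrix f)\<bar> * (\<integral>\<^sup>+x. h (f x) \<partial>lborel)"
      using f unfolding scales_lborel_def by (rule bspec) simp
    also have "(\<integral>\<^sup>+x. h (f x) \<partial>lborel) = ennreal \<bar>det (matrix g)\<bar> * (\<integral>\<^sup>+x. h (f (g x)) \<partial>lborel)"
      using g unfolding scales_lborel_def by (rule bspec) simp
    finally show "(\<integral>\<^sup>+x. h x \<partial>lborel) = ennreal \<bar>det (matrix (f \<circ> g))\<bar> * (\<integral>\<^sup>+x. h ((f \<circ> g) x) \<partial>lborel)"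
      unfolding d by (simp add: abs_mult ennreal_mult mult.assoc)
  qed
next
  fix f :: "real^'n \<Rightarrow> real^'n" and i
  assume "linear f" and "\<And>x. f x $ i = 0" and "det (matrix f) \<noteq> 0"
  \<comment> \<open>A nonsingular map is onto, which a vanishing coordinate forbids, so this case is
    contradictory.\<close>
  then have "surj f" "\<And>x. f x $ i = 0"
    by (auto simp: det_nz_iff_inj linear_injective_imp_surjective)
  then have "(axis i 1 :: real^'n) $ i = 0" by (metis surjD)
  then show "scales_lborel f" by simp
next
  fix c :: "'n \<Rightarrow> real"
  have d: "det (matrix (\<lambda>x. \<chi> i. c i * x $ i)) = (\<Prod>i\<in>UNIV. c i)"
    by (simp add: axis_def matrix_def det_diagonal)
  assume "det (matrix (\<lambda>x. \<chi> i. c i * x $ i)) \<noteq> 0"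
  then show "scales_lborel (\<lambda>x. \<chi> i. c i * x $ i)"
    unfolding scales_lborel_def d by (intro ballI nn_integral_stretch) auto
next
  fix m n :: 'n
  let ?t = "Transposition.transpose m n"
  have "matrix (\<lambda>x::real^'n. \<chi> i. x $ ?t i)
      = (\<chi> i. mat 1 $ ?t i)"
    by (auto simp: matrix_def mat_def axis_def vec_eq_iff)
  then have "\<bar>det (matrix (\<lambda>x::real^'n. \<chi> i. x $ ?t i))\<bar> = 1"
    by (simp add: det_permute_rows permutes_swap_id sign_swap_id abs_mult)
  then show "scales_lborel (\<lambda>x. \<chi> i. x $ ?t i)"
    by (simp add: scales_lborel_def nn_integral_permute_coordinates)
next
  fix m n :: 'n
  assume mn: "m \<noteq> n"
  let ?h = "\<lambda>x::real^'n. \<chi> i. if i = m then x $ m + x $ n else x $ i"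
  have "matrix ?h
      = (\<chi> i. if i = m then row m (mat 1) + 1 *s row n (mat 1) else row i (mat 1))"
    by (auto simp: matrix_def mat_def axis_def row_def vec_eq_iff)
  then have "det (matrix ?h) = 1"
    using det_row_operation[OF mn, of "mat 1" 1] by simp
  then show "scales_lborel ?h"
    using mn by (simp add: scales_lborel_def nn_integral_shear)
qed

section \<open>Dual lattice frames and the measures they induce on subspaces\<close>

lemma distr_PiM_image:
  fixes e :: "'i \<Rightarrow> real^'n"
  assumes "inj_on e I" "finite I"
  shows "distr (lborel_PiM (e ` I)) borel (\<lambda>c. p + (\<Sum>b\<in>e ` I. c b *\<^sub>R b))
    = distr (lborel_PiM I) borel (\<lambda>c. p + (\<Sum>i\<in>I. c i *\<^sub>R e i))"
proof -
  have m: "(\<lambda>c. \<lambda>b\<in>e ` I. c (inv_into I e b)) \<in> lborel_PiM I \<rightarrow>\<^sub>M lborel_PiM (e ` I)"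
    by (intro measurable_restrict measurable_component_singleton) (auto simp: inv_into_into)
  have m2: "(\<lambda>c. p + (\<Sum>b\<in>e ` I. c b *\<^sub>R b)) \<in> lborel_PiM (e ` I) \<rightarrow>\<^sub>M borel"
    by measurable
  show ?thesis
    by (subst reindex_PiM[OF assms, symmetric], subst distr_distr[OF m2 m])
      (use assms in \<open>auto simp: comp_def sum.reindex intro!: distr_cong sum.cong\<close>)
qed

text \<open>Unimodularity is encoded by an integral dual family. At a vertex, \<open>e\<close> will
  consist of the edge vectors and \<open>\<alpha>\<close> of the inward normals of the facets, so
  both data of the final formula are carried by one object.\<close>

definition lattice_frame :: "('n \<Rightarrow> real^'n) \<Rightarrow> ('n \<Rightarrow> real^'n) \<Rightarrow> bool" where
  "lattice_frame e \<alpha> \<longleftrightarrow> range e \<subseteq> int_lattice \<and> range \<alpha> \<subseteq> int_lattice \<and>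
    (\<forall>i j. \<alpha> i \<bullet> e j = (if i = j then 1 else 0))"

lemma det_Ints:
  assumes "\<And>i j. A $ i $ j \<in> \<int>"
  shows "det (A :: real^'n^'n) \<in> \<int>"
  unfolding det_def by (intro Ints_sum Ints_mult Ints_prod assms) auto

lemma Ints_inner_lattice: "x \<in> int_lattice \<Longrightarrow> y \<in> int_lattice \<Longrightarrow> x \<bullet> y \<in> \<int>"
  unfolding inner_vec_def by (intro Ints_sum) (auto simp: int_lattice_def)

lemma int_lattice_add: "x \<in> int_lattice \<Longrightarrow> y \<in> int_lattice \<Longrightarrow> x + y \<in> int_lattice"
  by (simp add: int_lattice_def)

lemma int_lattice_scaleR: "c \<in> \<int> \<Longrightarrow> x \<in> int_lattice \<Longrightarrow> c *\<^sub>R x \<in> int_lattice"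
  by (simp add: int_lattice_def)

lemma int_lattice_diff: "x \<in> int_lattice \<Longrightarrow> y \<in> int_lattice \<Longrightarrow> x - y \<in> int_lattice"
  by (simp add: int_lattice_def)

lemma int_lattice_sum: "(\<And>i. i \<in> I \<Longrightarrow> f i \<in> int_lattice) \<Longrightarrow> sum f I \<in> int_lattice"
  by (auto simp: int_lattice_def intro!: Ints_sum)

lemma axis_int_lattice: "axis i 1 \<in> int_lattice"
  by (simp add: int_lattice_def axis_def)

lemma frame_inner: "lattice_frame e \<alpha> \<Longrightarrow> \<alpha> i \<bullet> e j = (if i = j then 1 else 0)"
  by (simp add: lattice_frame_def)

lemma frame_inner_sum:
  "lattice_frame e \<alpha> \<Longrightarrow> \<alpha> i \<bullet> (\<Sum>k\<in>K. c k *\<^sub>R e k) = (if i \<in> K then c i else 0)" for K :: "'n::finite set"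
  by (simp add: inner_sum_right frame_inner if_distrib cong: if_cong)

lemma frame_inj: "lattice_frame e \<alpha> \<Longrightarrow> inj e"
  by (rule injI) (metis frame_inner zero_neq_one)

abbreviation frame_map :: "('n::finite \<Rightarrow> 'a::real_vector) \<Rightarrow> real^'n \<Rightarrow> 'a" where
  "frame_map e x \<equiv> \<Sum>i\<in>UNIV. x $ i *\<^sub>R e i"

abbreviation slice :: "'a::real_vector \<Rightarrow> ('n::finite \<Rightarrow> 'a) \<Rightarrow> 'n set \<Rightarrow> ('n \<Rightarrow> real) \<Rightarrow> 'a" where
  "slice p e J c \<equiv> p + (\<Sum>k\<in>- J. c k *\<^sub>R e k)"

lemma linear_frame: "linear (frame_map e)" for e :: "'n::finite \<Rightarrow> 'a::real_vector"
  by (rule linearI) (simp_all add: scaleR_left_distrib sum.distrib scaleR_sum_right)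

text \<open>The matrices of \<open>e\<close> and \<open>\<alpha>\<close> have integer determinants
  with product 1, so each is a unit of the integers.\<close>

lemma frame_det:
  assumes "lattice_frame e \<alpha>"
  shows "\<bar>det (matrix (frame_map e))\<bar> = 1"
proof -
  let ?T = "frame_map e" and ?A = "\<lambda>x. \<chi> i. \<alpha> i \<bullet> x"
  have lin: "linear ?A" by (rule linearI) (auto simp: vec_eq_iff inner_add_right)
  have "?A \<circ> ?T = id"
    using assms by (auto simp: vec_eq_iff frame_inner_sum)
  then have "matrix ?A ** matrix ?T = mat 1"
    using matrix_compose[OF linear_frame lin, symmetric, of e] by (simp add: matrix_id_mat_1)
  then have d: "det (matrix ?A) * det (matrix ?T) = 1"
    using det_mul[of "matrix ?A" "matrix ?T"] by simp
  have eL: "e j $ i \<in> \<int>" "\<alpha> j $ i \<in> \<int>" for i j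
    using assms unfolding lattice_frame_def int_lattice_def by blast+
  have "matrix ?A $ i $ j = \<alpha> i $ j" for i j
    by (simp add: matrix_def inner_axis)
  moreover have "matrix ?T $ i $ j = e j $ i" for i j
    by (simp add: matrix_def axis_def if_distrib[of "\<lambda>c. c * _"] cong: if_cong)
  ultimately have "det (matrix ?A) \<in> \<int>" "det (matrix ?T) \<in> \<int>"
    using eL by (auto intro!: det_Ints)
  then obtain a b :: int where "det (matrix ?A) = of_int a" and b: "det (matrix ?T) = of_int b"
    by (auto elim!: Ints_cases)
  with d have "a * b = 1" by (metis of_int_1 of_int_eq_iff of_int_mult)
  then have "\<bar>b\<bar> = 1" using zmult_eq_1_iff by (auto simp: zmult_eq_1_iff)
  then show ?thesis unfolding b by linarith
qed

lemma frame_expand: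
  assumes "lattice_frame e \<alpha>"
  shows "(\<Sum>i\<in>UNIV. (\<alpha> i \<bullet> x) *\<^sub>R e i) = x"
proof -
  have "det (matrix (frame_map e)) \<noteq> 0"
    using frame_det[OF assms] by linarith
  then have "inj (frame_map e)"
    using det_nz_iff_inj[OF linear_frame[of e]] by blast
  then have "surj (frame_map e)"
    by (intro linear_injective_imp_surjective[OF linear_frame]) simp_all
  then obtain y where "x = (\<Sum>i\<in>UNIV. y $ i *\<^sub>R e i)" unfolding surj_def by blast
  then show ?thesis using frame_inner_sum[OF assms] by simp
qed

lemma nn_integral_frame:
  assumes "lattice_frame e \<alpha>" and [measurable]: "g \<in> borel_measurable borel"
  shows "(\<integral>\<^sup>+x. g (frame_map e x) \<partial>lborel) = (\<integral>\<^sup>+x. g x \<partial>lborel)"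
proof -
  have "det (matrix (frame_map e)) \<noteq> 0"
    using frame_det[OF assms(1)] by auto
  then have "scales_lborel (frame_map e)"
    using linear_scales_lborel[OF linear_frame] by blast
  from bspec[OF this[unfolded scales_lborel_def] assms(2)]
  show ?thesis using frame_det[OF assms(1)] by simp
qed

text \<open>Thickening the subspace by a unit cube in the directions \<open>e j\<close>,
  \<open>j \<in> J\<close>, does not change the measure, since the cube has volume 1 in frame
  coordinates. On the right the frame occurs only through the vectors indexed by \<open>J\<close>,
  so two frames that agree there induce the same measure.\<close>

lemma emeasure_coordinate_subspace:
  fixes e \<alpha> :: "'n \<Rightarrow> real^'n"
  assumes f: "lattice_frame e \<alpha>" and A[measurable]: "A \<in> sets borel"
  shows "emeasure (distr (lborel_PiM (- J)) borel (slice p e J)) A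
    = (\<integral>\<^sup>+x. (\<Prod>j\<in>J. indicator {0..<1} (\<alpha> j \<bullet> x)) * indicator A (p + x - (\<Sum>j\<in>J. (\<alpha> j \<bullet> x) *\<^sub>R e j)) \<partial>lborel)"
proof -
  let ?h = "\<lambda>c. indicator A (slice p e J c) :: ennreal"
  have [measurable]: "(slice p e J) \<in> lborel_PiM (- J) \<rightarrow>\<^sub>M borel"
    by measurable
  have U: "- J \<union> J = UNIV" by auto
  have [measurable]: "(slice p e J) \<in> lborel_PiM UNIV \<rightarrow>\<^sub>M borel"
    by measurable
  have [measurable]: "(\<lambda>c. (\<Prod>j\<in>J. indicator {0..<1} (c j)) * ?h c) \<in> borel_measurable (lborel_PiM UNIV)"
    by measurable
  have "(\<integral>\<^sup>+x. (\<Prod>j\<in>J. indicator {0..<1} (\<alpha> j \<bullet> x)) * indicator A (p + x - (\<Sum>j\<in>J. (\<alpha> j \<bullet> x) *\<^sub>R e j)) \<partial>lborel)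
    = (\<integral>\<^sup>+x. (\<Prod>j\<in>J. indicator {0..<1} (x $ j)) * ?h (($) x) \<partial>lborel)"
  proof (subst nn_integral_frame[OF f, symmetric], measurable, rule nn_integral_cong)
    fix x :: "real^'n"
    have "(frame_map e x) = (\<Sum>k\<in>- J. x $ k *\<^sub>R e k) + (\<Sum>j\<in>J. x $ j *\<^sub>R e j)"
      using sum.union_disjoint[of "- J" J "\<lambda>k. x $ k *\<^sub>R e k"] U by simp
    then show "(\<Prod>j\<in>J. indicator {0..<1} (\<alpha> j \<bullet> (frame_map e x))) *
        indicator A (p + (frame_map e x) - (\<Sum>j\<in>J. (\<alpha> j \<bullet> (frame_map e x)) *\<^sub>R e j))
      = (\<Prod>j\<in>J. indicator {0..<1} (x $ j)) * ?h (($) x)"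
      by (simp add: frame_inner_sum[OF f] algebra_simps)
  qed
  also have "\<dots> = (\<integral>\<^sup>+c. (\<Prod>j\<in>J. indicator {0..<1} (c j)) * ?h c \<partial>lborel_PiM (- J \<union> J))"
    unfolding U by (subst nn_integral_lborel_vec) auto
  also have "\<dots> = (\<integral>\<^sup>+c. (\<integral>\<^sup>+y. (\<Prod>j\<in>J. indicator {0..<1} (y j)) * ?h c \<partial>lborel_PiM J) \<partial>lborel_PiM (- J))"
    by (subst lborel_prod.product_nn_integral_fold)
      (auto simp: U intro!: nn_integral_cong arg_cong2[of _ _ _ _ "(*)"] prod.cong
        arg_cong[of _ _ "indicator A"] sum.cong)
  also have "\<dots> = (\<integral>\<^sup>+c. ?h c \<partial>lborel_PiM (- J))"
    using lborel_prod.product_nn_integral_prod[of J "\<lambda>_. indicator {0..<1}"]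
    by (simp add: nn_integral_multc)
  also have "\<dots> = emeasure (distr (lborel_PiM (- J)) borel (slice p e J)) A"
    by (simp add: nn_integral_indicator[symmetric] nn_integral_distr del: nn_integral_indicator)
  finally show ?thesis ..
qed

lemma int_basis_subset:
  assumes "int_basis B L" shows "B \<subseteq> L"
proof
  fix b assume b: "b \<in> B"
  have fin: "finite B" using assms by (simp add: int_basis_def)
  have "b = (\<Sum>e\<in>B. real_of_int (if e = b then 1 else 0) *\<^sub>R e)"
    using b fin by (simp add: if_distrib[of real_of_int] if_distrib[of "\<lambda>r. r *\<^sub>R _"] cong: if_cong)
  also have "\<dots> \<in> range (\<lambda>c. \<Sum>e\<in>B. real_of_int (c e) *\<^sub>R e)" by (rule rangeI)
  also have "\<dots> = L" using assms by (simp add: int_basis_def)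
  finally show "b \<in> L" .
qed

text \<open>The coefficient functionals of an integral basis are given by integer vectors, because
  they take integer values on the standard basis. Duality then upgrades independence over the
  integers to independence over the reals, which yields the cardinality.\<close>

lemma int_basis_dual:
  fixes E :: "(real^'n) set"
  assumes "int_basis E int_lattice"
  obtains \<alpha> where "\<And>b. b \<in> E \<Longrightarrow> \<alpha> b \<in> int_lattice"
    "\<And>a b. a \<in> E \<Longrightarrow> b \<in> E \<Longrightarrow> \<alpha> a \<bullet> b = (if a = b then 1 else 0)"
    "E \<subseteq> int_lattice" "card E = CARD('n)"
proof -
  have fin: "finite E"
    and ind: "\<And>c :: real^'n \<Rightarrow> int. (\<Sum>e\<in>E. of_int (c e) *\<^sub>R e) = 0 \<Longrightarrow> (\<forall>e\<in>E. c e = 0)"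
    and ran: "range (\<lambda>c :: real^'n \<Rightarrow> int. \<Sum>e\<in>E. of_int (c e) *\<^sub>R e) = int_lattice"
    using assms unfolding int_basis_def by auto
  have "\<exists>c :: real^'n \<Rightarrow> int. axis k 1 = (\<Sum>e\<in>E. of_int (c e) *\<^sub>R e)" for k :: 'n
    using axis_int_lattice[of k] ran by (metis (no_types, lifting) imageE)
  then obtain c :: "'n \<Rightarrow> real^'n \<Rightarrow> int" where c: "axis k 1 = (\<Sum>e\<in>E. of_int (c k e) *\<^sub>R e)" for k
    by metis
  \<comment> \<open>By linearity \<open>\<alpha> e \<bullet> x\<close> is the coefficient of
    \<open>e\<close> in \<open>x\<close> for every real vector \<open>x\<close>; this is
    \<open>expand\<close> below.\<close>
  define \<alpha> where "\<alpha> e = (\<chi> k. real_of_int (c k e))" for e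
  have \<alpha>L: "\<alpha> b \<in> int_lattice" for b
    by (simp add: \<alpha>_def int_lattice_def)
  have EL: "b \<in> int_lattice" if "b \<in> E" for b
    using that int_basis_subset[OF assms] by blast
  have expand: "x = (\<Sum>e\<in>E. (\<alpha> e \<bullet> x) *\<^sub>R e)" for x :: "real^'n"
  proof -
    have "x = (\<Sum>k\<in>UNIV. x $ k *\<^sub>R axis k 1)"
      by (simp add: vec_eq_iff axis_def if_distrib cong: if_cong)
    also have "\<dots> = (\<Sum>k\<in>UNIV. \<Sum>e\<in>E. (x $ k * c k e) *\<^sub>R e)"
      by (simp add: c scaleR_sum_right)
    also have "\<dots> = (\<Sum>e\<in>E. (\<alpha> e \<bullet> x) *\<^sub>R e)"
      by (subst sum.swap) (simp add: scaleR_sum_left[symmetric] \<alpha>_def inner_vec_def mult.commute)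
    finally show ?thesis .
  qed
  have dual: "\<alpha> a \<bullet> b = (if a = b then 1 else 0)" if ab: "a \<in> E" "b \<in> E" for a b
  proof -
    \<comment> \<open>Independence is available for integer coefficients only. The pairings are
      integers, so the floor merely changes their type; the two expansions of \<open>b\<close> are
      then compared.\<close>
    define n where "n e = \<lfloor>\<alpha> e \<bullet> b\<rfloor>" for e
    have n: "real_of_int (n e) = \<alpha> e \<bullet> b" for e
      using Ints_inner_lattice[OF \<alpha>L EL[OF ab(2)]] by (simp add: n_def)
    have "(\<Sum>e\<in>E. of_int (n e - (if e = b then 1 else 0)) *\<^sub>R e) = b - b"
      using expand[of b] ab(2) fin
      by (simp add: n scaleR_left_diff_distrib sum_subtractf if_distrib[of real_of_int]
        if_distrib[of "\<lambda>r. r *\<^sub>R _"] cong: if_cong)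
    then have "n a - (if a = b then 1 else 0) = 0"
      using ind[of "\<lambda>e. n e - (if e = b then 1 else 0)"] ab(1) by simp
    then show ?thesis using n[of a] by (auto split: if_splits)
  qed
  have "independent E"
  proof (rule independent_if_scalars_zero[OF fin])
    fix f b assume 0: "(\<Sum>x\<in>E. f x *\<^sub>R x) = 0" and b: "b \<in> E"
    have "\<alpha> b \<bullet> (\<Sum>x\<in>E. f x *\<^sub>R x) = f b"
      using b fin by (simp add: inner_sum_right dual if_distrib cong: if_cong)
    then show "f b = 0" using 0 by simp
  qed
  moreover have "x \<in> span E" for x
    by (subst expand) (intro span_sum span_scale span_base)
  then have "span E = UNIV" by blast
  ultimately have "card E = dim (UNIV :: (real^'n) set)"
    using dim_eq_card[of E UNIV] by simp
  then have "card E = CARD('n)" by simp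
  with that \<alpha>L dual EL show thesis by blast
qed

lemma int_basisE:
  assumes "int_basis B L" "x \<in> L"
  obtains c :: "'a::real_vector \<Rightarrow> int" where "x = (\<Sum>b\<in>B. of_int (c b) *\<^sub>R b)"
  using assms unfolding int_basis_def by blast

lemma frame_int_basis:
  fixes e \<alpha> :: "'n \<Rightarrow> real^'n"
  assumes f: "lattice_frame e \<alpha>"
  shows "int_basis (e ` (- J)) ({x. \<forall>j\<in>J. \<alpha> j \<bullet> x = 0} \<inter> int_lattice)"
  unfolding int_basis_def
proof (intro conjI allI impI)
  note inj = inj_on_subset[OF frame_inj[OF f] subset_UNIV]
  fix c :: "real^'n \<Rightarrow> int"
  assume "(\<Sum>b\<in>e ` (- J). of_int (c b) *\<^sub>R b) = 0"
  then have "(\<Sum>k\<in>- J. of_int (c (e k)) *\<^sub>R e k) = 0"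
    by (simp add: sum.reindex[OF inj])
  then show "\<forall>b\<in>e ` (- J). c b = 0"
    using frame_inner_sum[OF f, of _ "\<lambda>k. of_int (c (e k))" "- J"]
    by (metis (mono_tags, lifting) imageE inner_zero_right of_int_eq_0_iff)
next
  note inj = inj_on_subset[OF frame_inj[OF f] subset_UNIV]
  have eL: "e k \<in> int_lattice" "\<alpha> k \<in> int_lattice" for k
    using f by (auto simp: lattice_frame_def)
  have "(\<Sum>k\<in>- J. of_int (c (e k)) *\<^sub>R e k) \<in> {x. \<forall>j\<in>J. \<alpha> j \<bullet> x = 0} \<inter> int_lattice" for c :: "real^'n \<Rightarrow> int"
    using frame_inner_sum[OF f] eL by (auto intro!: int_lattice_sum int_lattice_scaleR)
  moreover have "x \<in> range (\<lambda>c. \<Sum>k\<in>- J. of_int (c (e k)) *\<^sub>R e k)"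
    if x: "\<forall>j\<in>J. \<alpha> j \<bullet> x = 0" "x \<in> int_lattice" for x
  proof -
    have "x = (\<Sum>k\<in>UNIV. (\<alpha> k \<bullet> x) *\<^sub>R e k)" by (rule frame_expand[OF f, symmetric])
    also have "\<dots> = (\<Sum>k\<in>- J. (\<alpha> k \<bullet> x) *\<^sub>R e k)"
      using x(1) by (intro sum.mono_neutral_right) auto
    \<comment> \<open>Coefficients of \<open>int_basis\<close> are functions of the basis vector, so
      the index is recovered by \<open>inv e\<close>.\<close>
    also have "\<dots> = (\<Sum>k\<in>- J. of_int \<lfloor>\<alpha> (inv e (e k)) \<bullet> x\<rfloor> *\<^sub>R e k)"
      using Ints_inner_lattice[OF eL(2) x(2)] frame_inj[OF f] by simp
    also have "\<dots> \<in> range (\<lambda>c. \<Sum>k\<in>- J. of_int (c (e k)) *\<^sub>R e k)"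
      by (rule range_eqI[of _ _ "\<lambda>b. \<lfloor>\<alpha> (inv e b) \<bullet> x\<rfloor>"]) simp
    finally show ?thesis .
  qed
  ultimately show "range (\<lambda>c. \<Sum>b\<in>e ` (- J). of_int (c b) *\<^sub>R b) = {x. \<forall>j\<in>J. \<alpha> j \<bullet> x = 0} \<inter> int_lattice"
    by (auto simp: sum.reindex[OF inj])
qed auto

text \<open>A basis of the lattice of the face is completed to one of the whole lattice by the
  vectors \<open>e j\<close> transversal to the face. Then both measures are expressed by the Lebesgue measure
  of the same unit strip, in which the choice of the basis no longer occurs.\<close>

lemma lattice_measure_frame:
  fixes e \<alpha> :: "'n \<Rightarrow> real^'n"
  assumes f: "lattice_frame e \<alpha>" and par: "parallel_subspace g = {x. \<forall>j\<in>J. \<alpha> j \<bullet> x = 0}"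
    and v: "v \<in> affine hull g"
  shows "lattice_measure g = distr (lborel_PiM (- J)) borel (slice v e J)"
proof -
  define L where "L = parallel_subspace g \<inter> int_lattice"
  define B where "B = (SOME B. int_basis B L)"
  define p where "p = (SOME p. p \<in> affine hull g)"
  have eL: "e k \<in> int_lattice" "\<alpha> k \<in> int_lattice" for k
    using f by (auto simp: lattice_frame_def)
  have "int_basis (e ` (- J)) L"
    using frame_int_basis[OF f] by (simp add: L_def par)
  then have B: "int_basis B L" unfolding B_def by (rule someI)
  then have fin: "finite B" by (simp add: int_basis_def)
  have BL: "B \<subseteq> L" by (rule int_basis_subset[OF B])
  have \<alpha>B: "\<alpha> j \<bullet> b = 0" if "b \<in> B" "j \<in> J" for j b
    using that BL by (auto simp: L_def par)
  have "p \<in> affine hull g" unfolding p_def using v by (rule someI)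
  then have "p - v \<in> parallel_subspace g"
    using v unfolding parallel_subspace_def by blast
  then have pv: "\<alpha> j \<bullet> (p - v) = 0" if "j \<in> J" for j using that par by auto
  have disj: "B \<inter> e ` J = {}"
    using \<alpha>B frame_inner[OF f] by (fastforce split: if_splits)
  note inj = inj_on_subset[OF frame_inj[OF f] subset_UNIV]
  have split: "(\<Sum>b\<in>B \<union> e ` J. h b) = (\<Sum>b\<in>B. h b) + (\<Sum>j\<in>J. h (e j))" for h :: "real^'n \<Rightarrow> real^'n"
    using fin disj by (simp add: sum.union_disjoint sum.reindex[OF inj])
  have full: "int_basis (B \<union> e ` J) int_lattice"
    unfolding int_basis_def
  proof (intro conjI allI impI)
    fix c :: "real^'n \<Rightarrow> int"
    assume 0: "(\<Sum>b\<in>B \<union> e ` J. of_int (c b) *\<^sub>R b) = 0"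
    have j: "c (e j) = 0" if "j \<in> J" for j
    proof -
      have "\<alpha> j \<bullet> (\<Sum>b\<in>B. of_int (c b) *\<^sub>R b) = 0"
        using \<alpha>B that by (simp add: inner_sum_right)
      then have "\<alpha> j \<bullet> (\<Sum>b\<in>B \<union> e ` J. of_int (c b) *\<^sub>R b) = of_int (c (e j))"
        unfolding split inner_add_right using that by (simp add: frame_inner_sum[OF f])
      then show ?thesis using 0 by simp
    qed
    then have "(\<Sum>b\<in>B. of_int (c b) *\<^sub>R b) = 0"
      using 0 unfolding split by simp
    then have "\<forall>b\<in>B. c b = 0" using B unfolding int_basis_def by blast
    then show "\<forall>b\<in>B \<union> e ` J. c b = 0" using j by auto
  next
    have "(\<Sum>b\<in>B \<union> e ` J. of_int (c b) *\<^sub>R b) \<in> int_lattice" for c :: "real^'n \<Rightarrow> int"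
      using BL eL by (auto simp: L_def intro!: int_lattice_sum int_lattice_scaleR)
    moreover have "x \<in> range (\<lambda>c. \<Sum>b\<in>B \<union> e ` J. of_int (c b) *\<^sub>R b)" if x: "x \<in> int_lattice" for x
    proof -
      have \<alpha>x: "\<alpha> j \<bullet> x \<in> \<int>" for j by (rule Ints_inner_lattice[OF eL(2) x])
      have "x - (\<Sum>j\<in>J. (\<alpha> j \<bullet> x) *\<^sub>R e j) \<in> L"
        unfolding L_def par using \<alpha>x x eL
        by (auto simp: inner_diff_right frame_inner_sum[OF f]
          intro!: int_lattice_diff int_lattice_sum int_lattice_scaleR)
      then obtain c :: "real^'n \<Rightarrow> int"
        where c: "x - (\<Sum>j\<in>J. (\<alpha> j \<bullet> x) *\<^sub>R e j) = (\<Sum>b\<in>B. of_int (c b) *\<^sub>R b)"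
        by (rule int_basisE[OF B])
      define c' where "c' b = (if b \<in> B then c b else \<lfloor>\<alpha> (inv e b) \<bullet> x\<rfloor>)" for b
      have "(\<Sum>b\<in>B. of_int (c' b) *\<^sub>R b) = (\<Sum>b\<in>B. of_int (c b) *\<^sub>R b)"
        by (simp add: c'_def)
      moreover have "(\<Sum>j\<in>J. of_int (c' (e j)) *\<^sub>R e j) = (\<Sum>j\<in>J. (\<alpha> j \<bullet> x) *\<^sub>R e j)"
        using disj \<alpha>x frame_inj[OF f] by (intro sum.cong) (auto simp: c'_def)
      ultimately have "x = (\<Sum>b\<in>B \<union> e ` J. of_int (c' b) *\<^sub>R b)"
        unfolding split by (simp add: c[symmetric])
      then show ?thesis by blast
    qed
    ultimately show "range (\<lambda>c. \<Sum>b\<in>B \<union> e ` J. of_int (c b) *\<^sub>R b) = int_lattice"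
      by blast
  qed (use fin in auto)
  obtain \<beta> where \<beta>: "\<And>b. b \<in> B \<union> e ` J \<Longrightarrow> \<beta> b \<in> int_lattice"
    "\<And>a b. a \<in> B \<union> e ` J \<Longrightarrow> b \<in> B \<union> e ` J \<Longrightarrow> \<beta> a \<bullet> b = (if a = b then 1 else 0)"
    "B \<union> e ` J \<subseteq> int_lattice" "card (B \<union> e ` J) = CARD('n)"
    using int_basis_dual[OF full] by metis
  have "card B = card (- J)"
    using \<beta>(4) disj fin by (simp add: card_Un_disjoint card_image[OF inj] card_Diff_subset Compl_eq_Diff_UNIV)
  then obtain h where h: "bij_betw h (- J) B"
    using finite_same_card_bij[of "- J" B] fin by auto
  define e' where "e' = (\<lambda>i. if i \<in> J then e i else h i)"
  have e'B: "e' k \<in> B" if "k \<in> - J" for k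
    using that h by (auto simp: e'_def bij_betw_def)
  have e'mem: "e' k \<in> B \<union> e ` J" for k
    using e'B by (cases "k \<in> J") (auto simp: e'_def)
  have inj': "inj e'"
  proof (rule injI)
    fix a b assume eq: "e' a = e' b"
    have "k \<in> J \<longleftrightarrow> e' k \<notin> B" for k
      using e'B[of k] disj by (cases "k \<in> J") (auto simp: e'_def)
    then have "a \<in> J \<longleftrightarrow> b \<in> J" using eq by simp
    then show "a = b"
      using eq injD[OF frame_inj[OF f], of a b] inj_onD[OF bij_betw_imp_inj_on[OF h], of a b]
      by (auto simp: e'_def split: if_splits)
  qed
  have f': "lattice_frame e' (\<lambda>i. \<beta> (e' i))"
    unfolding lattice_frame_def
  proof (intro conjI allI)
    show "range e' \<subseteq> int_lattice" using e'mem \<beta>(3) by blast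
    show "range (\<lambda>i. \<beta> (e' i)) \<subseteq> int_lattice" using e'mem \<beta>(1) by blast
    show "\<beta> (e' i) \<bullet> e' j = (if i = j then 1 else 0)" for i j
      using \<beta>(2)[OF e'mem e'mem] inj' by (simp add: inj_eq)
  qed
  \<comment> \<open>The completed basis has the same dual vectors at indices in \<open>J\<close>:
    both pair in the same way with every \<open>e' k\<close>, and the \<open>e' k\<close>
    span.\<close>
  have \<alpha>eq: "\<beta> (e' j) = \<alpha> j" if j: "j \<in> J" for j
  proof -
    have e'k: "\<alpha> j \<bullet> e' k = (if j = k then 1 else 0)" for k
      using j \<alpha>B[OF e'B, of k j] frame_inner[OF f] by (cases "k \<in> J") (auto simp: e'_def)
    have "\<alpha> j \<bullet> x = \<beta> (e' j) \<bullet> x" for x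
      by (subst frame_expand[OF f', of x, symmetric])
        (simp add: inner_sum_right e'k if_distrib cong: if_cong)
    then have "\<forall>x. \<beta> (e' j) \<bullet> x = \<alpha> j \<bullet> x" by simp
    then show ?thesis by (simp only: vector_eq_rdot)
  qed
  have \<alpha>e: "\<beta> (e j) = \<alpha> j" if "j \<in> J" for j
    using \<alpha>eq[OF that] that by (simp add: e'_def)
  have lm: "lattice_measure g = distr (lborel_PiM (- J)) borel (\<lambda>c. slice p e' J c)"
  proof -
    have B': "B = e' ` (- J)" using h by (auto simp: e'_def bij_betw_def)
    have "lattice_measure g = distr (lborel_PiM B) borel (\<lambda>c. p + (\<Sum>b\<in>B. c b *\<^sub>R b))"
      unfolding lattice_measure_def B_def p_def L_def Let_def ..
    also have "\<dots> = distr (lborel_PiM (- J)) borel (\<lambda>c. slice p e' J c)"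
      unfolding B' by (rule distr_PiM_image) (use inj' in \<open>auto intro: inj_on_subset\<close>)
    finally show ?thesis .
  qed
  show ?thesis
  proof (rule measure_eqI)
    fix A assume "A \<in> sets (lattice_measure g)"
    then have A[measurable]: "A \<in> sets borel" unfolding lm by simp
    let ?G = "\<lambda>x. (\<Prod>j\<in>J. indicator {0..<1} (\<alpha> j \<bullet> x)) * indicator A (v + x - (\<Sum>j\<in>J. (\<alpha> j \<bullet> x) *\<^sub>R e j)) :: ennreal"
    have "emeasure (lattice_measure g) A
      = (\<integral>\<^sup>+x. (\<Prod>j\<in>J. indicator {0..<1} (\<alpha> j \<bullet> x)) * indicator A (p + x - (\<Sum>j\<in>J. (\<alpha> j \<bullet> x) *\<^sub>R e j)) \<partial>lborel)"
      unfolding lm emeasure_coordinate_subspace[OF f' A]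
      by (intro nn_integral_cong arg_cong2[of _ _ _ _ "(*)"] prod.cong arg_cong[of _ _ "indicator A"]
          arg_cong2[of _ _ _ _ minus] sum.cong) (auto simp: \<alpha>e e'_def)
    \<comment> \<open>The base points differ by a vector parallel to the face. Every
      \<open>\<alpha> j\<close> with \<open>j \<in> J\<close> annihilates it, so the integrand is
      only translated.\<close>
    also have "\<dots> = (\<integral>\<^sup>+x. ?G ((p - v) + x) \<partial>lborel)"
      by (intro nn_integral_cong arg_cong2[of _ _ _ _ "(*)"] prod.cong arg_cong[of _ _ "indicator A"]
          arg_cong2[of _ _ _ _ minus] sum.cong) (auto simp: inner_add_right pv)
    also have "\<dots> = (\<integral>\<^sup>+x. ?G x \<partial>distr lborel borel ((+) (p - v)))"
      by (rule nn_integral_distr[symmetric]) auto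
    also have "\<dots> = emeasure (distr (lborel_PiM (- J)) borel (slice v e J)) A"
      unfolding lborel_distr_plus emeasure_coordinate_subspace[OF f A] ..
    finally show "emeasure (lattice_measure g) A
      = emeasure (distr (lborel_PiM (- J)) borel (slice v e J)) A" .
  qed (simp add: lm)
qed

section \<open>Euler--Maclaurin expansion on the orthant\<close>

definition orthant :: "(real^'n) set" where
  "orthant = {x. \<forall>i. 0 \<le> x $ i}"

abbreviation on_orthant :: "(real^'n \<Rightarrow> real) \<Rightarrow> real^'n \<Rightarrow> real" where
  "on_orthant f x \<equiv> indicator orthant x * f x"

definition unit_cell :: "(real^'n) set" where
  "unit_cell = {x. \<forall>i. 0 \<le> x $ i \<and> x $ i < 1}"

lemma orthant_borel [measurable]: "orthant \<in> sets (borel :: (real^'n) measure)"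
proof -
  have "{x \<in> space borel. \<forall>i. 0 \<le> (x :: real^'n) $ i} \<in> sets borel" by measurable
  then show ?thesis by (simp add: orthant_def)
qed

lemma unit_cell_borel [measurable]: "unit_cell \<in> sets (borel :: (real^'n) measure)"
proof -
  have "{x \<in> space borel. \<forall>i. 0 \<le> (x :: real^'n) $ i \<and> x $ i < 1} \<in> sets borel" by measurable
  then show ?thesis by (simp add: unit_cell_def)
qed

lemma integral_affine_scale:
  fixes F :: "'a::euclidean_space \<Rightarrow> real"
  assumes [measurable]: "F \<in> borel_measurable borel" and c: "c \<noteq> 0"
  shows "(\<integral>x. F x \<partial>lborel) = \<bar>c\<bar> ^ DIM('a) * (\<integral>x. F (t + c *\<^sub>R x) \<partial>lborel)"
proof -
  have "(\<integral>x. F x \<partial>lborel) = (\<integral>x. F x \<partial>density (distr lborel borel (\<lambda>x. t + c *\<^sub>R x)) (\<lambda>_. ennreal (\<bar>c\<bar> ^ DIM('a))))"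
    using lborel_affine[OF c, of t] by (simp add: ennreal_power)
  also have "\<dots> = (\<integral>x. \<bar>c\<bar> ^ DIM('a) * F x \<partial>distr lborel borel (\<lambda>x. t + c *\<^sub>R x))"
    by (subst integral_density) auto
  also have "\<dots> = \<bar>c\<bar> ^ DIM('a) * (\<integral>x. F (t + c *\<^sub>R x) \<partial>lborel)"
    by (subst integral_distr) auto
  finally show ?thesis .
qed

lemma integrable_indicator_bounded:
  fixes F :: "'a::euclidean_space \<Rightarrow> real"
  assumes "continuous_on UNIV F" "bounded S" and S: "S \<in> sets borel"
  shows "integrable lborel (\<lambda>x. indicator S x * F x)"
proof -
  obtain a where a: "S \<subseteq> cbox (- a) a" using bounded_subset_cbox_symmetric[OF assms(2)] by blast
  have "set_integrable lborel (cbox (- a) a) F"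
    unfolding set_integrable_def
    by (rule borel_integrable_compact) (use assms in \<open>auto intro: continuous_on_subset\<close>)
  then have "set_integrable lborel S F"
    by (rule set_integrable_subset) (use a S in auto)
  then show ?thesis by (simp add: set_integrable_def)
qed

lemma bounded_unit_cell: "bounded (unit_cell :: (real^'n) set)"
proof (rule bounded_subset[OF bounded_cbox])
  show "unit_cell \<subseteq> cbox (0 :: real^'n) 1"
    by (auto simp: unit_cell_def mem_box_cart less_imp_le)
qed

section \<open>Taylor expansion averaged over a unit cell\<close>

primrec word_deriv :: "'n list \<Rightarrow> (real^'n \<Rightarrow> real) \<Rightarrow> real^'n \<Rightarrow> real" where
  "word_deriv [] f = f"
| "word_deriv (i # w) f = Dv (axis i 1) (word_deriv w f)"

definition word_monomial :: "'n list \<Rightarrow> real^'n \<Rightarrow> real" where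
  "word_monomial w s = prod_list (map (($) s) w)"

definition words :: "nat \<Rightarrow> 'n list set" where
  "words j = {w. length w = j}"

definition word_moment :: "'n::finite list \<Rightarrow> real" where
  "word_moment w = (\<integral>s. indicator unit_cell s * word_monomial w s \<partial>lborel)"

text \<open>The degree-\<open>j\<close> part of the Taylor series averaged over the unit cube: the
  mean of \<open>f\<close> over the cell of side h with lower corner x is the sum of the h^j
  \<open>taylor_op j f x\<close>. Mixed partials are indexed by lists, so the j-th power of a
  directional derivative expands without multinomial coefficients.\<close>

definition taylor_op :: "nat \<Rightarrow> (real^'n \<Rightarrow> real) \<Rightarrow> real^'n \<Rightarrow> real" where
  "taylor_op j f = (\<lambda>x. \<Sum>w\<in>words j. (word_moment w / fact j) * word_deriv w f x)"

lemma words_0: "words 0 = {[]}"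
  by (auto simp: words_def)

lemma sum_words_Suc:
  "(\<Sum>w\<in>words (Suc j). h w) = (\<Sum>w\<in>words j. \<Sum>i\<in>UNIV. h (i # w))" for h :: "'n::finite list \<Rightarrow> 'a::comm_monoid_add"
proof -
  have "words (Suc j) = (\<lambda>(w, i). i # w) ` (words j \<times> (UNIV :: 'n set))"
    by (force simp: words_def length_Suc_conv)
  moreover have "inj_on (\<lambda>(w, i). i # w) (words j \<times> (UNIV :: 'n set))"
    by (auto simp: inj_on_def)
  ultimately show ?thesis
    by (simp add: sum.reindex sum.cartesian_product split_def)
qed

lemma C_diff_word_deriv: "C_diff (j + length w) f \<Longrightarrow> C_diff j (word_deriv w f)"
  by (induction w arbitrary: j) (auto intro!: C_diff_Dv simp del: C_diff.simps)

lemma word_deriv_eq_0: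
  "open U \<Longrightarrow> (\<And>x. x \<in> U \<Longrightarrow> f x = 0) \<Longrightarrow> x \<in> U \<Longrightarrow> word_deriv w f x = 0"
  by (induction w arbitrary: x) (auto intro: Dv_eq_0)

lemma word_monomial_continuous [continuous_intros]: "continuous_on A (word_monomial w)"
  unfolding word_monomial_def[abs_def] by (induction w) (auto intro!: continuous_intros)

lemma word_monomial_measurable [measurable]: "word_monomial w \<in> borel_measurable borel"
  by (intro borel_measurable_continuous_onI continuous_intros)

lemma abs_word_monomial_le: "s \<in> unit_cell \<Longrightarrow> \<bar>word_monomial w s\<bar> \<le> 1"
proof (induction w)
  case (Cons i w)
  have "\<bar>s $ i\<bar> \<le> 1" using Cons.prems by (auto simp: unit_cell_def less_imp_le)
  then show ?case using mult_mono[of "\<bar>s $ i\<bar>" 1] Cons by (simp add: word_monomial_def abs_mult)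
qed (simp add: word_monomial_def)

lemma directional_power_words:
  assumes "C_diff j f"
  shows "(Dv s ^^ j) f x = (\<Sum>w\<in>words j. word_monomial w s * word_deriv w f x)"
  using assms
proof (induction j arbitrary: x)
  case 0
  then show ?case by (simp add: words_0 word_monomial_def)
next
  case (Suc j)
  have D: "C_diff (Suc 0) (word_deriv w f)" if "w \<in> words j" for w
    using C_diff_word_deriv[of "Suc 0" w f] that Suc.prems by (simp add: words_def del: C_diff.simps)
  then have d: "word_deriv w f differentiable at x" if "w \<in> words j" for w
    using that C_diff_has_derivative differentiable_def by blast
  have s: "s = (\<Sum>i\<in>UNIV. s $ i *\<^sub>R axis i 1)"
    by (simp add: vec_eq_iff axis_def if_distrib cong: if_cong)
  have "(Dv s ^^ j) f = (\<lambda>x. \<Sum>w\<in>words j. word_monomial w s * word_deriv w f x)"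
    using Suc.IH[OF C_diff_SucD[OF Suc.prems]] by blast
  then have "(Dv s ^^ Suc j) f x = (\<Sum>w\<in>words j. word_monomial w s * Dv s (word_deriv w f) x)"
    by (simp add: Dv_sum[OF d])
  also have "\<dots> = (\<Sum>w\<in>words j. word_monomial w s * (\<Sum>i\<in>UNIV. s $ i * Dv (axis i 1) (word_deriv w f) x))"
    by (subst (2) s) (simp add: Dv_sum_dir[OF d])
  also have "\<dots> = (\<Sum>w\<in>words (Suc j). word_monomial w s * word_deriv w f x)"
    by (simp add: sum_words_Suc sum_distrib_left word_monomial_def mult_ac)
  finally show ?case .
qed

lemma directional_power_DERIV:
  assumes "C_diff M f" "m < M"
  shows "((\<lambda>t. (Dv s ^^ m) f (x + t *\<^sub>R s)) has_real_derivative (Dv s ^^ Suc m) f (x + t *\<^sub>R s)) (at t)"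
proof -
  have "C_diff k f \<Longrightarrow> C_diff (k - j) ((Dv s ^^ j) f)" if "j \<le> k" for j k
    using that
  proof (induction j)
    case (Suc j)
    then have "C_diff (Suc (k - Suc j)) ((Dv s ^^ j) f)"
      by (simp add: Suc_diff_Suc del: C_diff.simps)
    then show ?case using C_diff_Dv by (simp del: C_diff.simps)
  qed simp
  from this[of m M] have "C_diff (Suc (M - Suc m)) ((Dv s ^^ m) f)"
    using assms by (simp add: Suc_diff_Suc del: C_diff.simps)
  then show ?thesis
    using DERIV_along_line[of "(Dv s ^^ m) f"] by simp
qed

text \<open>The one-variable Taylor formula with Lagrange remainder along the ray from
  \<open>x\<close> in direction \<open>s\<close>, the iterated directional derivatives being
  expanded into words.\<close>

lemma taylor_words:
  assumes "C_diff M f" "0 < M" "0 < h"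
  obtains \<theta> where "0 < \<theta>" "\<theta> < h"
    "f (x + h *\<^sub>R s) = (\<Sum>j<M. h ^ j / fact j * (\<Sum>w\<in>words j. word_monomial w s * word_deriv w f x))
      + h ^ M / fact M * (\<Sum>w\<in>words M. word_monomial w s * word_deriv w f (x + \<theta> *\<^sub>R s))"
proof -
  let ?diff = "\<lambda>m t. (Dv s ^^ m) f (x + t *\<^sub>R s)"
  obtain \<theta> where \<theta>: "0 < \<theta>" "\<theta> < h"
    "f (x + h *\<^sub>R s) = (\<Sum>m<M. ?diff m 0 / fact m * h ^ m) + ?diff M \<theta> / fact M * h ^ M"
    using Maclaurin[OF assms(3,2), of ?diff "\<lambda>t. f (x + t *\<^sub>R s)"] directional_power_DERIV[OF assms(1)]
    by auto
  have "(\<Sum>m<M. ?diff m 0 / fact m * h ^ m)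
      = (\<Sum>j<M. h ^ j / fact j * (\<Sum>w\<in>words j. word_monomial w s * word_deriv w f x))"
    using C_diff_mono[OF assms(1)]
    by (intro sum.cong refl) (simp add: directional_power_words)
  with \<theta> show thesis
    by (intro that[of \<theta>]) (simp_all add: directional_power_words[OF assms(1)])
qed

lemma word_monomial_prod: "word_monomial w s = (\<Prod>i\<in>UNIV. s $ i ^ count_list w i)"
proof (induction w)
  case (Cons j w)
  have "(\<Prod>i\<in>UNIV. s $ i ^ count_list (j # w) i)
      = (\<Prod>i\<in>UNIV. (if i = j then s $ i else 1) * s $ i ^ count_list w i)"
    by (intro prod.cong) auto
  also have "\<dots> = s $ j * (\<Prod>i\<in>UNIV. s $ i ^ count_list w i)"
    by (simp add: prod.distrib)
  finally show ?case using Cons by (simp add: word_monomial_def)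
qed (simp add: word_monomial_def)

lemma integral_power_Ico:
  "(\<integral>y. indicator {0..<1} y * y ^ m \<partial>lborel) = 1 / (real m + 1)"
  "integrable lborel (\<lambda>y::real. indicator {0..<1} y * y ^ m)"
proof -
  have "(\<integral>y. indicator {0..<1} y * y ^ m \<partial>lborel) = (\<integral>y. (y::real) ^ m * indicator {0..1} y \<partial>lborel)"
  proof (rule integral_cong_AE)
    show "AE y in lborel. indicator {0..<1} y * y ^ m = y ^ m * indicator {0..1::real} y"
      by (rule eventually_mono[OF AE_lborel_singleton[of "1::real"]]) (auto simp: indicator_def)
  qed auto
  then show "(\<integral>y. indicator {0..<1} y * y ^ m \<partial>lborel) = 1 / (real m + 1)"
    by (simp add: integral_power add.commute)
  show "integrable lborel (\<lambda>y::real. indicator {0..<1} y * y ^ m)"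
    by (rule integrable_indicator_bounded) (auto intro!: continuous_intros)
qed

lemma word_moment_eq: "word_moment w = (\<Prod>i\<in>UNIV. 1 / (real (count_list w i) + 1))"
proof -
  have "word_moment w = (\<integral>c. indicator unit_cell (vec_lambda c) * word_monomial w (vec_lambda c) \<partial>lborel_PiM UNIV)"
    unfolding word_moment_def by (rule integral_lborel_vec) measurable
  also have "\<dots> = (\<integral>c. (\<Prod>i\<in>UNIV. indicator {0..<1} (c i) * c i ^ count_list w i) \<partial>lborel_PiM UNIV)"
  proof (rule Bochner_Integration.integral_cong)
    fix c :: "'a \<Rightarrow> real"
    have "indicator unit_cell (vec_lambda c) = (\<Prod>i\<in>UNIV. indicator {0..<1} (c i) :: real)"
      by (auto simp: indicator_def unit_cell_def prod_zero_iff)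
    then show "indicator unit_cell (vec_lambda c) * word_monomial w (vec_lambda c)
        = (\<Prod>i\<in>UNIV. indicator {0..<1} (c i) * c i ^ count_list w i)"
      by (simp add: word_monomial_prod prod.distrib)
  qed simp
  also have "\<dots> = (\<Prod>i\<in>UNIV. 1 / (real (count_list w i) + 1))"
    by (subst lborel_prod.product_integral_prod[of UNIV "\<lambda>i y. indicator {0..<1} y * y ^ count_list w i"])
      (simp_all add: integral_power_Ico)
  finally show ?thesis .
qed

lemma word_moment_Nil: "word_moment [] = 1"
  by (simp add: word_moment_eq)

lemma word_moment_1: "word_moment [i] = 1/2"
proof -
  have "word_moment [i] = (\<Prod>k\<in>UNIV. if k = i then 1/2 else 1)"
    unfolding word_moment_eq by (intro prod.cong) auto
  then show ?thesis by simp
qed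

lemma word_moment_2: "word_moment [i, j] = (if i = j then 1/3 else 1/4)"
proof (cases "i = j")
  case True
  have "word_moment [i, j] = (\<Prod>k\<in>UNIV. if k = i then 1/3 else 1)"
    unfolding word_moment_eq True by (intro prod.cong) auto
  then show ?thesis using True by simp
next
  case False
  have "word_moment [i, j] = (\<Prod>k\<in>UNIV. (if k = i then 1/2 else 1) * (if k = j then 1/2 else 1))"
    unfolding word_moment_eq using False by (intro prod.cong) auto
  then show ?thesis using False by (simp add: prod.distrib)
qed

text \<open>A substitute for compact support. Functions will vanish on \<open>U\<close>, and only
  the part of the orthant outside \<open>U\<close> has to be bounded; outside the orthant they may
  be arbitrary. Openness of \<open>U\<close> makes all derivatives vanish there too. An integer
  \<open>R\<close> lets the grid of mesh 1/N fill the cube of side \<open>R\<close> exactly.\<close>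

locale orthant_support =
  fixes U :: "(real^'n) set" and R :: nat
  assumes open_U: "open U" and R_pos: "0 < R"
    and U: "\<And>x. x \<in> orthant \<Longrightarrow> x \<notin> U \<Longrightarrow> x $ i < real R"
begin

definition test :: "nat \<Rightarrow> (real^'n \<Rightarrow> real) \<Rightarrow> bool" where
  "test k f \<longleftrightarrow> C_diff k f \<and> (\<forall>x\<in>U. f x = 0)"

definition grid :: "nat \<Rightarrow> ('n \<Rightarrow> nat) set" where
  "grid N = (\<Pi>\<^sub>E i\<in>UNIV. {..<N * R})"

definition grid_point :: "nat \<Rightarrow> ('n \<Rightarrow> nat) \<Rightarrow> real^'n" where
  "grid_point N g = (\<chi> i. real (g i) / real N)"

definition grid_sum :: "nat \<Rightarrow> (real^'n \<Rightarrow> real) \<Rightarrow> real" where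
  "grid_sum N f = (1 / real N) ^ CARD('n) * (\<Sum>g\<in>grid N. f (grid_point N g))"

abbreviation cell_mean :: "nat \<Rightarrow> ('n \<Rightarrow> nat) \<Rightarrow> (real^'n \<Rightarrow> real) \<Rightarrow> real" where
  "cell_mean N g f \<equiv> \<integral>s. indicator unit_cell s * f (grid_point N g + (1 / real N) *\<^sub>R s) \<partial>lborel"

definition cell :: "nat \<Rightarrow> ('n \<Rightarrow> nat) \<Rightarrow> (real^'n) set" where
  "cell N g = {x. \<forall>i. real (g i) \<le> real N * x $ i \<and> real N * x $ i < real (g i) + 1}"

lemma finite_grid: "finite (grid N)"
  unfolding grid_def by (intro finite_PiE) auto

lemma card_grid: "card (grid N) = (N * R) ^ CARD('n)"
  unfolding grid_def by (simp add: card_PiE)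

lemma gridD: "g \<in> grid N \<Longrightarrow> g i < N * R"
  by (auto simp: grid_def PiE_UNIV_domain)

lemma test_continuous: "test k f \<Longrightarrow> continuous_on UNIV f"
  using C_diff_continuous unfolding test_def by blast

lemma test_word_deriv: "test (j + length w) f \<Longrightarrow> test j (word_deriv w f)"
  unfolding test_def using C_diff_word_deriv word_deriv_eq_0[OF open_U] by blast

lemma test_Dv: "test (Suc j) f \<Longrightarrow> test j (Dv v f)"
  unfolding test_def using C_diff_Dv Dv_eq_0[OF open_U] by metis

lemma test_taylor_op: "test (k + j) f \<Longrightarrow> test k (taylor_op j f)"
proof -
  assume f: "test (k + j) f"
  have "test k (word_deriv w f)" if "w \<in> words j" for w
    using that f by (intro test_word_deriv) (simp add: words_def)
  then show ?thesis
    unfolding test_def taylor_op_def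
    by (intro conjI C_diff_sum C_diff_mult C_diff_const) auto
qed

lemma test_taylor_0: "taylor_op 0 f = f"
  by (simp add: taylor_op_def words_0 word_moment_Nil)

lemma cell_measurable [measurable]: "cell N g \<in> sets borel"
proof -
  have "{x \<in> space borel. \<forall>i. real (g i) \<le> real N * x $ i \<and> real N * x $ i < real (g i) + 1} \<in> sets (borel :: (real^'n) measure)"
    by measurable
  then show ?thesis by (simp add: cell_def)
qed

text \<open>Half-open cells are disjoint: a point of the orthant lies exactly in the cell given by
  the floors of its scaled coordinates. Outside \<open>U\<close> these floors stay below
  \<open>N * R\<close>, and on \<open>U\<close> both sides vanish.\<close>

lemma cell_decomposition:
  fixes f :: "real^'n \<Rightarrow> real"
  assumes f: "\<forall>x\<in>U. f x = 0" and N: "0 < N"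
  shows "on_orthant f x = (\<Sum>g\<in>grid N. indicator (cell N g) x * f x)"
proof (cases "x \<in> orthant \<and> x \<notin> U")
  case False
  then have "f x = 0 \<or> x \<notin> orthant" using f by auto
  moreover have "x \<in> orthant" if "x \<in> cell N g" for g
  proof -
    have "0 \<le> x $ i" for i
    proof -
      have "real (g i) \<le> real N * x $ i" using that by (simp add: cell_def)
      then have "0 \<le> real N * x $ i" using of_nat_0_le_iff order_trans by blast
      then show ?thesis using N by (simp add: zero_le_mult_iff)
    qed
    then show ?thesis by (simp add: orthant_def)
  qed
  ultimately have z: "indicator (cell N g) x * f x = 0" for g by (auto simp: indicator_def)
  have "on_orthant f x = 0" using \<open>f x = 0 \<or> x \<notin> orthant\<close> by auto
  then show ?thesis by (simp only: z sum.neutral_const)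
next
  case True
  define g where "g = (\<lambda>i. nat \<lfloor>real N * x $ i\<rfloor>)"
  have x0: "0 \<le> real N * x $ i" for i using True by (simp add: orthant_def)
  have "x \<in> cell N h \<longleftrightarrow> h = g" for h
  proof -
    have "(real (h i) \<le> real N * x $ i \<and> real N * x $ i < real (h i) + 1) \<longleftrightarrow> h i = g i" for i
    proof -
      have "(real (h i) \<le> real N * x $ i \<and> real N * x $ i < real (h i) + 1) \<longleftrightarrow> \<lfloor>real N * x $ i\<rfloor> = int (h i)"
        by (simp add: floor_eq_iff)
      also have "\<dots> \<longleftrightarrow> h i = g i" using x0[of i] by (auto simp: g_def)
      finally show ?thesis .
    qed
    then show ?thesis by (auto simp: cell_def fun_eq_iff)
  qed
  then have "(\<Sum>h\<in>grid N. indicator (cell N h) x * f x) = (\<Sum>h\<in>grid N. if h = g then f x else 0)"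
    by (intro sum.cong) (auto simp: indicator_def)
  moreover have "g \<in> grid N"
  proof -
    have "g i < N * R" for i
    proof -
      have "x $ i < real R" using U True by blast
      then have "real N * x $ i < real (N * R)" using N by simp
      then show ?thesis using x0[of i] unfolding g_def by linarith
    qed
    then show ?thesis by (simp add: grid_def PiE_UNIV_domain)
  qed
  ultimately show ?thesis using True finite_grid by simp
qed

lemma bounded_cell: "0 < N \<Longrightarrow> bounded (cell N g)"
proof (rule bounded_subset[OF bounded_cbox])
  assume "0 < N"
  then show "cell N g \<subseteq> cbox (\<chi> i. real (g i) / real N) (\<chi> i. (real (g i) + 1) / real N)"
    by (auto simp: cell_def mem_box_cart field_simps less_imp_le)
qed

lemma integral_orthant_cells:
  assumes f: "test k f" and N: "0 < N"
  shows "(\<integral>x. on_orthant f x \<partial>lborel) = (1 / real N) ^ CARD('n) *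
    (\<Sum>g\<in>grid N. cell_mean N g f)"
proof -
  have c: "continuous_on UNIV f" by (rule test_continuous[OF f])
  then have [measurable]: "f \<in> borel_measurable borel" by (rule borel_measurable_continuous_onI)
  have "(\<integral>x. on_orthant f x \<partial>lborel) = (\<Sum>g\<in>grid N. \<integral>x. indicator (cell N g) x * f x \<partial>lborel)"
    using f cell_decomposition[of f N] N
    by (subst Bochner_Integration.integral_sum[symmetric])
      (auto simp: test_def intro!: integrable_indicator_bounded c bounded_cell)
  also have "\<dots> = (\<Sum>g\<in>grid N. (1 / real N) ^ CARD('n) *
      cell_mean N g f)"
  proof (rule sum.cong)
    fix g
    have "(\<integral>x. indicator (cell N g) x * f x \<partial>lborel) = \<bar>1 / real N\<bar> ^ DIM(real^'n) *
      (\<integral>s. indicator (cell N g) (grid_point N g + (1 / real N) *\<^sub>R s) * f (grid_point N g + (1 / real N) *\<^sub>R s) \<partial>lborel)"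
      using N by (intro integral_affine_scale) auto
    moreover have "indicator (cell N g) (grid_point N g + (1 / real N) *\<^sub>R s) = (indicator unit_cell s :: real)" for s
    proof -
      have "real N * (grid_point N g + (1 / real N) *\<^sub>R s) $ i = real (g i) + s $ i" for i
        using N by (simp add: grid_point_def field_simps)
      then show ?thesis by (auto simp: indicator_def cell_def unit_cell_def)
    qed
    ultimately show "(\<integral>x. indicator (cell N g) x * f x \<partial>lborel) = (1 / real N) ^ CARD('n) *
      cell_mean N g f"
      by simp
  qed simp
  finally show ?thesis by (simp add: sum_distrib_left)
qed

lemma test_bound:
  assumes "test k f"
  shows "\<exists>C\<ge>0. \<forall>x \<in> cbox 0 (\<chi> i. real R). \<bar>f x\<bar> \<le> C"
proof -
  have "compact (f ` cbox 0 (\<chi> i. real R))"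
    using test_continuous[OF assms] by (intro compact_continuous_image) (auto intro: continuous_on_subset)
  then obtain C where "\<And>y. y \<in> f ` cbox 0 (\<chi> i. real R) \<Longrightarrow> norm y \<le> C"
    using compact_imp_bounded bounded_iff by metis
  then show ?thesis by (intro exI[of _ "\<bar>C\<bar>"]) force
qed

text \<open>The point of the lemma is uniformity: one constant serves all \<open>N\<close> and all
  cells, because the remainder is evaluated in a fixed compact cube.\<close>

lemma taylor_cell:
  assumes f: "test M f" and M: "0 < M"
  shows "\<exists>C\<ge>0. \<forall>N>0. \<forall>g \<in> grid N.
    \<bar>cell_mean N g f
      - (\<Sum>j<M. (1 / real N) ^ j * taylor_op j f (grid_point N g))\<bar> \<le> C * (1 / real N) ^ M"
proof -
  have "\<exists>C. 0 \<le> C \<and> (\<forall>x \<in> cbox 0 (\<chi> i. real R). \<bar>word_deriv w f x\<bar> \<le> C)" if "w \<in> words M" for w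
  proof -
    have "test 0 (word_deriv w f)"
      using f that by (intro test_word_deriv) (simp add: words_def)
    then show ?thesis using test_bound by blast
  qed
  then obtain C where C: "\<And>w. w \<in> words M \<Longrightarrow> 0 \<le> C w"
    "\<And>w x. w \<in> words M \<Longrightarrow> x \<in> cbox 0 (\<chi> i. real R) \<Longrightarrow> \<bar>word_deriv w f x\<bar> \<le> C w"
    by metis
  define K where "K = (\<Sum>w\<in>words M. C w)"
  have K: "0 \<le> K" unfolding K_def using C by (intro sum_nonneg)
  have "\<bar>cell_mean N g f
      - (\<Sum>j<M. (1 / real N) ^ j * taylor_op j f (grid_point N g))\<bar> \<le> K * (1 / real N) ^ M"
    if N: "0 < N" and g: "g \<in> grid N" for N g
  proof -
    let ?x = "grid_point N g" and ?h = "1 / real N"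
    let ?T = "\<lambda>s. \<Sum>j<M. ?h ^ j / fact j * (\<Sum>w\<in>words j. word_monomial w s * word_deriv w f ?x)"
    have pw: "\<bar>f (?x + ?h *\<^sub>R s) - ?T s\<bar> \<le> K * ?h ^ M" if s: "s \<in> unit_cell" for s
    proof -
      obtain \<theta> where \<theta>: "0 < \<theta>" "\<theta> < ?h" and eq: "f (?x + ?h *\<^sub>R s) = ?T s
        + ?h ^ M / fact M * (\<Sum>w\<in>words M. word_monomial w s * word_deriv w f (?x + \<theta> *\<^sub>R s))"
        using taylor_words[of M f ?h ?x s] f M N unfolding test_def by auto
      \<comment> \<open>The intermediate point cannot leave the cube of side \<open>R\<close>, since
        \<open>g i + 1\<close> is at most \<open>N * R\<close>.\<close>
      have "0 \<le> (?x + \<theta> *\<^sub>R s) $ i \<and> (?x + \<theta> *\<^sub>R s) $ i \<le> real R" for i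
      proof -
        have s: "0 \<le> s $ i" "s $ i \<le> 1" using s by (auto simp: unit_cell_def less_imp_le)
        have "\<theta> * s $ i \<le> ?h * 1" using s \<theta> by (intro mult_mono) auto
        moreover have "real (g i) + 1 \<le> real (N * R)"
          using gridD[OF g, of i] by linarith
        then have "real (g i) / real N + ?h \<le> real R" using N by (simp add: field_simps)
        ultimately show ?thesis using s \<theta> by (simp add: grid_point_def)
      qed
      then have box: "?x + \<theta> *\<^sub>R s \<in> cbox 0 (\<chi> i. real R)" by (simp add: mem_box_cart)
      have "\<bar>\<Sum>w\<in>words M. word_monomial w s * word_deriv w f (?x + \<theta> *\<^sub>R s)\<bar> \<le> K"
        unfolding K_def
      proof (rule order_trans[OF sum_abs], rule sum_mono)
        fix w :: "'n list" assume w: "w \<in> words M"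
        show "\<bar>word_monomial w s * word_deriv w f (?x + \<theta> *\<^sub>R s)\<bar> \<le> C w"
          using mult_mono[OF abs_word_monomial_le[OF s] C(2)[OF w box]] by (simp add: abs_mult)
      qed
      moreover have "?h ^ M / fact M \<le> ?h ^ M" by (simp add: divide_le_eq mult_le_cancel_left1)
      ultimately have "\<bar>?h ^ M / fact M * (\<Sum>w\<in>words M. word_monomial w s * word_deriv w f (?x + \<theta> *\<^sub>R s))\<bar> \<le> ?h ^ M * K"
        unfolding abs_mult by (intro mult_mono) auto
      then show ?thesis unfolding eq by (simp add: mult.commute)
    qed
    have fc: "continuous_on UNIV f" by (rule test_continuous[OF f])
    have i1: "integrable lborel (\<lambda>s. indicator unit_cell s * f (?x + ?h *\<^sub>R s))"
      by (rule integrable_indicator_bounded)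
        (auto intro!: continuous_on_compose2[OF fc] continuous_intros bounded_unit_cell)
    have iw: "integrable lborel (\<lambda>s. indicator unit_cell s * word_monomial w s)" for w :: "'n list"
      by (rule integrable_indicator_bounded) (auto intro!: continuous_intros bounded_unit_cell)
    have T: "indicator unit_cell s * ?T s = (\<Sum>j<M. ?h ^ j / fact j * (\<Sum>w\<in>words j.
        (indicator unit_cell s * word_monomial w s) * word_deriv w f ?x))" for s
      by (simp add: sum_distrib_left mult_ac)
    have i2: "integrable lborel (\<lambda>s. indicator unit_cell s * ?T s)"
      unfolding T by (intro Bochner_Integration.integrable_sum integrable_mult_right integrable_mult_left iw)
    have "(\<integral>s. indicator unit_cell s * ?T s \<partial>lborel) = (\<Sum>j<M. ?h ^ j * taylor_op j f ?x)"
    proof -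
      have "(\<integral>s. indicator unit_cell s * ?T s \<partial>lborel) = (\<Sum>j<M. \<integral>s. ?h ^ j / fact j * (\<Sum>w\<in>words j.
        (indicator unit_cell s * word_monomial w s) * word_deriv w f ?x) \<partial>lborel)"
        unfolding T by (intro Bochner_Integration.integral_sum Bochner_Integration.integrable_sum
          integrable_mult_right integrable_mult_left iw)
      also have "\<dots> = (\<Sum>j<M. ?h ^ j / fact j * (\<Sum>w\<in>words j. word_moment w * word_deriv w f ?x))"
        using iw by (simp add: Bochner_Integration.integral_sum word_moment_def)
      also have "\<dots> = (\<Sum>j<M. ?h ^ j * taylor_op j f ?x)"
        by (simp add: taylor_op_def sum_distrib_left)
      finally show ?thesis .
    qed
    then have "(\<integral>s. indicator unit_cell s * f (?x + ?h *\<^sub>R s) \<partial>lborel) - (\<Sum>j<M. ?h ^ j * taylor_op j f ?x)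
      = (\<integral>s. indicator unit_cell s * f (?x + ?h *\<^sub>R s) - indicator unit_cell s * ?T s \<partial>lborel)"
      using i1 i2 by simp
    also have "\<bar>\<dots>\<bar> \<le> (\<integral>s. indicator (unit_cell :: (real^'n) set) s * (K * ?h ^ M) \<partial>lborel)"
    proof (rule integral_abs_bound_integral)
      show "integrable lborel (\<lambda>s. indicator unit_cell s * f (?x + ?h *\<^sub>R s) - indicator unit_cell s * ?T s)"
        using i1 i2 by (rule Bochner_Integration.integrable_diff)
      show "integrable lborel (\<lambda>s :: real^'n. indicator unit_cell s * (K * ?h ^ M))"
        by (rule integrable_indicator_bounded) (auto intro: bounded_unit_cell)
      show "\<bar>indicator unit_cell s * f (?x + ?h *\<^sub>R s) - indicator unit_cell s * ?T s\<bar>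
        \<le> indicator unit_cell s * (K * ?h ^ M)" for s
        using pw[of s] by (auto simp: indicator_def)
    qed
    also have "\<dots> = K * ?h ^ M"
      using word_moment_Nil[where 'a = 'n] by (simp add: word_moment_def word_monomial_def)
    finally show ?thesis .
  qed
  with K show ?thesis by blast
qed

text \<open>The error per cell is summed over all cells. Their number, the power of
  \<open>N * R\<close>, cancels against the cell volume, so the order in 1/N is preserved.\<close>

lemma euler_maclaurin_step:
  assumes f: "test M f" and M: "0 < M"
  shows "\<exists>C. \<forall>N>0. \<bar>(\<integral>x. on_orthant f x \<partial>lborel)
      - (\<Sum>j<M. (1 / real N) ^ j * grid_sum N (taylor_op j f))\<bar> \<le> C * (1 / real N) ^ M"
proof -
  obtain C where C: "0 \<le> C" "\<And>N g. 0 < N \<Longrightarrow> g \<in> grid N \<Longrightarrow>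
    \<bar>cell_mean N g f
      - (\<Sum>j<M. (1 / real N) ^ j * taylor_op j f (grid_point N g))\<bar> \<le> C * (1 / real N) ^ M"
    using taylor_cell[OF f M] by blast
  show ?thesis
  proof (intro exI allI impI)
    fix N :: nat assume N: "0 < N"
    let ?h = "1 / real N"
    let ?D = "\<lambda>g. (\<integral>s. indicator unit_cell s * f (grid_point N g + ?h *\<^sub>R s) \<partial>lborel)
      - (\<Sum>j<M. ?h ^ j * taylor_op j f (grid_point N g))"
    have "(\<Sum>j<M. ?h ^ j * grid_sum N (taylor_op j f))
      = ?h ^ CARD('n) * (\<Sum>g\<in>grid N. \<Sum>j<M. ?h ^ j * taylor_op j f (grid_point N g))"
      unfolding grid_sum_def sum_distrib_left by (subst sum.swap) (simp add: mult_ac)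
    then have "(\<integral>x. on_orthant f x \<partial>lborel) - (\<Sum>j<M. ?h ^ j * grid_sum N (taylor_op j f))
      = ?h ^ CARD('n) * (\<Sum>g\<in>grid N. ?D g)"
      unfolding integral_orthant_cells[OF f N] by (simp add: sum_subtractf right_diff_distrib)
    also have "\<bar>\<dots>\<bar> \<le> ?h ^ CARD('n) * (real (card (grid N)) * (C * ?h ^ M))"
      unfolding abs_mult
      by (intro mult_mono order_trans[OF sum_abs] sum_bounded_above C N) auto
    also have "\<dots> = (real R ^ CARD('n) * C) * ?h ^ M"
      using N by (simp add: card_grid power_mult_distrib field_simps power_divide)
    finally show "\<bar>(\<integral>x. on_orthant f x \<partial>lborel) - (\<Sum>j<M. ?h ^ j * grid_sum N (taylor_op j f))\<bar>
      \<le> (real R ^ CARD('n) * C) * ?h ^ M" .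
  qed
qed

text \<open>Write I for the integral, S for the grid sum and T_j for \<open>taylor_op j\<close>,
  with T_0 the identity. The cell expansion says that I(f) is the sum of the h^j S(T_j f). Solving
  for S(f) and comparing powers of h gives this recursion.\<close>

fun coeff :: "nat \<Rightarrow> (real^'n \<Rightarrow> real) \<Rightarrow> real" where
  "coeff 0 f = (\<integral>x. on_orthant f x \<partial>lborel)"
| "coeff (Suc n) f = - (\<Sum>j\<le>n. coeff (n - j) (taylor_op (Suc j) f))"

lemma coeff_sum:
  assumes "0 < M"
  shows "(\<Sum>n<M. coeff n f * h ^ n) = coeff 0 f
    - (\<Sum>j<M - 1. h ^ Suc j * (\<Sum>n<M - Suc j. coeff n (taylor_op (Suc j) f) * h ^ n))"
proof -
  obtain m where M: "M = Suc m" using assms by (cases M) auto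
  have "(\<Sum>j<m. h ^ Suc j * (\<Sum>n<m - j. coeff n (taylor_op (Suc j) f) * h ^ n))
      = (\<Sum>(j, n) \<in> (SIGMA j:{..<m}. {..<m - j}). h ^ Suc (j + n) * coeff n (taylor_op (Suc j) f))"
    by (simp add: sum.Sigma[symmetric] sum_distrib_left power_add mult_ac)
  \<comment> \<open>Terms are regrouped by the total exponent of \<open>h\<close>, which is one more
    than \<open>j + n\<close>.\<close>
  also have "\<dots> = (\<Sum>(k, j) \<in> (SIGMA k:{..<m}. {..k}). h ^ Suc k * coeff (k - j) (taylor_op (Suc j) f))"
    by (rule sum.reindex_bij_witness[of _ "\<lambda>(k, j). (j, k - j)" "\<lambda>(j, n). (j + n, j)"]) auto
  also have "\<dots> = (\<Sum>k<m. h ^ Suc k * (\<Sum>j\<le>k. coeff (k - j) (taylor_op (Suc j) f)))"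
    by (simp add: sum.Sigma[symmetric] sum_distrib_left)
  also have "\<dots> = - (\<Sum>k<m. coeff (Suc k) f * h ^ Suc k)"
    by (simp add: sum_negf mult_ac)
  finally show ?thesis
    unfolding M sum.lessThan_Suc_shift by simp
qed

text \<open>Smoothness and accuracy are lost at the same rate: \<open>taylor_op (Suc j) f\<close>
  has \<open>Suc j\<close> derivatives fewer, but it occurs with the factor h^(j+1), so its
  expansion is required only to order \<open>M - Suc j\<close>. This makes strong induction on
  \<open>M\<close> work.\<close>

theorem orthant_expansion:
  "test M f \<Longrightarrow> \<exists>C. \<forall>N>0. \<bar>grid_sum N f - (\<Sum>n<M. coeff n f * (1 / real N) ^ n)\<bar> \<le> C * (1 / real N) ^ M"
proof (induction M arbitrary: f rule: less_induct)
  case (less M)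
  show ?case
  proof (cases "M = 0")
    case True
    obtain C where C: "0 \<le> C" "\<And>x. x \<in> cbox 0 (\<chi> i. real R) \<Longrightarrow> \<bar>f x\<bar> \<le> C"
      using test_bound[OF less.prems] by blast
    have "\<bar>grid_sum N f\<bar> \<le> real R ^ CARD('n) * C" if N: "0 < N" for N
    proof -
      have "\<bar>f (grid_point N g)\<bar> \<le> C" if g: "g \<in> grid N" for g
      proof (rule C)
        have "real (g i) \<le> real R * real N" for i
          using gridD[OF g, of i] by (simp add: mult.commute flip: of_nat_mult)
        then show "grid_point N g \<in> cbox 0 (\<chi> i. real R)"
          using N by (simp add: mem_box_cart grid_point_def divide_le_eq)
      qed
      then have "\<bar>grid_sum N f\<bar> \<le> (1 / real N) ^ CARD('n) * (real (card (grid N)) * C)"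
        unfolding grid_sum_def abs_mult
        by (intro mult_mono order_trans[OF sum_abs] sum_bounded_above) auto
      also have "\<dots> = real R ^ CARD('n) * C"
        using N by (simp add: card_grid power_mult_distrib field_simps power_divide)
      finally show ?thesis .
    qed
    then show ?thesis using True by auto
  next
    case False
    then have M: "0 < M" by simp
    obtain C0 where C0: "\<And>N. 0 < N \<Longrightarrow> \<bar>coeff 0 f
      - (\<Sum>j<M. (1 / real N) ^ j * grid_sum N (taylor_op j f))\<bar> \<le> C0 * (1 / real N) ^ M"
      using euler_maclaurin_step[OF less.prems M] by auto
    define E where "E j N = grid_sum N (taylor_op (Suc j) f)
      - (\<Sum>n<M - Suc j. coeff n (taylor_op (Suc j) f) * (1 / real N) ^ n)" for j N
    have "\<exists>C. \<forall>N>0. \<bar>E j N\<bar> \<le> C * (1 / real N) ^ (M - Suc j)" if "j < M - 1" for j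
      unfolding E_def using that less.prems by (intro less.IH test_taylor_op) auto
    then obtain C where C: "\<And>j N. j < M - 1 \<Longrightarrow> 0 < N \<Longrightarrow> \<bar>E j N\<bar> \<le> C j * (1 / real N) ^ (M - Suc j)"
      by metis
    have "\<bar>grid_sum N f - (\<Sum>n<M. coeff n f * (1 / real N) ^ n)\<bar> \<le> (C0 + (\<Sum>j<M - 1. C j)) * (1 / real N) ^ M"
      if N: "0 < N" for N
    proof -
      let ?h = "1 / real N"
      define D where "D = coeff 0 f - (\<Sum>j<M. ?h ^ j * grid_sum N (taylor_op j f))"
      define F where "F = (\<Sum>j<M - 1. ?h ^ Suc j * E j N)"
      obtain m where m: "M = Suc m" using M by (cases M) auto
      have "(\<Sum>j<M. ?h ^ j * grid_sum N (taylor_op j f))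
        = grid_sum N f + (\<Sum>j<M - 1. ?h ^ Suc j * grid_sum N (taylor_op (Suc j) f))"
        unfolding m sum.lessThan_Suc_shift by (simp add: test_taylor_0)
      then have eq: "grid_sum N f - (\<Sum>n<M. coeff n f * ?h ^ n) = - D - F"
        unfolding coeff_sum[OF M] D_def F_def E_def
        by (simp add: right_diff_distrib sum_subtractf del: coeff.simps)
      have "\<bar>?h ^ Suc j * E j N\<bar> \<le> C j * ?h ^ M" if j: "j < M - 1" for j
      proof -
        have "\<bar>?h ^ Suc j * E j N\<bar> \<le> ?h ^ Suc j * (C j * ?h ^ (M - Suc j))"
          unfolding abs_mult using C[OF j N] by (intro mult_mono) auto
        also have "\<dots> = C j * (?h ^ Suc j * ?h ^ (M - Suc j))" by (simp only: mult_ac)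
        also have "?h ^ Suc j * ?h ^ (M - Suc j) = ?h ^ M"
          using j by (simp only: power_add[symmetric]) simp
        finally show ?thesis .
      qed
      then have "\<bar>F\<bar> \<le> (\<Sum>j<M - 1. C j * ?h ^ M)"
        unfolding F_def by (intro order_trans[OF sum_abs] sum_mono) auto
      then have "\<bar>F\<bar> \<le> (\<Sum>j<M - 1. C j) * ?h ^ M"
        unfolding sum_distrib_right .
      moreover have "\<bar>D\<bar> \<le> C0 * ?h ^ M" unfolding D_def by (rule C0[OF N])
      ultimately show ?thesis unfolding eq distrib_right by linarith
    qed
    then show ?thesis by blast
  qed
qed

section \<open>Integration by parts down to the coordinate faces\<close>

definition coord_embed :: "'n set \<Rightarrow> ('n \<Rightarrow> real) \<Rightarrow> real^'n" where
  "coord_embed J c = (\<Sum>k\<in>- J. c k *\<^sub>R axis k 1)"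

definition face_part :: "'n set \<Rightarrow> (real^'n \<Rightarrow> real) \<Rightarrow> real" where
  "face_part J f = (\<integral>c. on_orthant f (coord_embed J c) \<partial>lborel_PiM (- J))"

lemma coord_embed_nth: "coord_embed J c $ k = (if k \<in> J then 0 else c k)"
  by (simp add: coord_embed_def axis_def if_distrib cong: if_cong)

lemma coord_embed_measurable [measurable]: "coord_embed J \<in> lborel_PiM (- J) \<rightarrow>\<^sub>M borel"
  unfolding coord_embed_def[abs_def] by measurable

lemma test_borel: "test k f \<Longrightarrow> f \<in> borel_measurable borel"
  by (intro borel_measurable_continuous_onI test_continuous)

lemma coeff_0_face_part:
  assumes "test k f" shows "coeff 0 f = face_part {} f"
proof -
  note [measurable] = test_borel[OF assms]
  have "coord_embed {} c = vec_lambda c" for c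
    by (simp add: vec_eq_iff coord_embed_nth)
  then show ?thesis
    by (simp add: face_part_def integral_lborel_vec Compl_empty_eq)
qed

lemma integrable_orthant:
  assumes "test k f" shows "integrable lborel (on_orthant f)"
proof -
  have "on_orthant f = (\<lambda>x. indicator (orthant - U) x * f x)"
    using assms by (auto simp: fun_eq_iff indicator_def test_def)
  moreover have "bounded (orthant - U)"
  proof (rule bounded_subset[OF bounded_cbox])
    show "orthant - U \<subseteq> cbox 0 (\<chi> i. real R)"
      using U by (auto simp: mem_box_cart orthant_def less_imp_le)
  qed
  ultimately show ?thesis
    using test_continuous[OF assms] open_U by (auto intro!: integrable_indicator_bounded)
qed

text \<open>Two steps of the recursion give the integral of T_1 T_1 f - T_2 f. The first operator
  has coefficient 1/4 at every ordered pair of coordinates; the second has half the second moment,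
  namely 1/6 on the diagonal and 1/8 off it. The differences are 1/12 and 1/8.\<close>

lemma coeff_2:
  assumes f: "test 2 f"
  shows "coeff 2 f = (\<Sum>j\<in>UNIV. \<Sum>i\<in>UNIV. (if i = j then 1/12 else 1/8) *
    face_part {} (Dv (axis i 1) (Dv (axis j 1) f)))"
proof -
  let ?D = "\<lambda>i. Dv (axis i 1 :: real^'n)"
  have t1: "test 1 (?D j f)" for j using f by (auto intro: test_Dv simp: numeral_2_eq_2)
  have t2: "test 0 (?D i (?D j f))" for i j using t1 by (auto intro: test_Dv)
  have d: "?D j f differentiable at x" for j x
    using t1[of j] unfolding test_def by simp
  have w1: "taylor_op (Suc 0) g x = (\<Sum>j\<in>UNIV. (1/2) * ?D j g x)" for g x
    unfolding taylor_op_def by (simp add: sum_words_Suc words_0 word_moment_1)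
  then have w1': "taylor_op (Suc 0) g = (\<lambda>x. \<Sum>j\<in>UNIV. (1/2) * ?D j g x)" for g by blast
  have w11: "taylor_op (Suc 0) (taylor_op (Suc 0) f) x = (\<Sum>j\<in>UNIV. \<Sum>i\<in>UNIV. (1/4) * ?D i (?D j f) x)" for x
    unfolding w1[of "taylor_op (Suc 0) f"] unfolding w1' Dv_sum[OF d]
    by (subst sum.swap) (simp add: sum_distrib_left)
  have w2: "taylor_op (Suc (Suc 0)) f x = (\<Sum>j\<in>UNIV. \<Sum>i\<in>UNIV. (word_moment [i, j] / 2) * ?D i (?D j f) x)" for x
    unfolding taylor_op_def by (simp add: sum_words_Suc words_0)
  have "coeff 2 f = coeff 0 (taylor_op (Suc 0) (taylor_op (Suc 0) f)) - coeff 0 (taylor_op (Suc (Suc 0)) f)"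
    by (simp add: numeral_2_eq_2)
  also have "\<dots> = (\<integral>x. indicator orthant x * taylor_op (Suc 0) (taylor_op (Suc 0) f) x
      - indicator orthant x * taylor_op (Suc (Suc 0)) f x \<partial>lborel)"
    using integrable_orthant[OF test_taylor_op[of 0 "Suc 0" "taylor_op (Suc 0) f"]]
      integrable_orthant[OF test_taylor_op[of 0 "Suc (Suc 0)" f]]
      test_taylor_op[of "Suc 0" "Suc 0" f] f
    by (simp add: numeral_2_eq_2)
  also have "\<dots> = (\<integral>x. (\<Sum>j\<in>UNIV. \<Sum>i\<in>UNIV. (if i = j then 1/12 else 1/8) *
      (indicator orthant x * ?D i (?D j f) x)) \<partial>lborel)"
    unfolding w11 w2 word_moment_2 sum_distrib_left sum_subtractf[symmetric]
    by (intro Bochner_Integration.integral_cong refl sum.cong) (auto simp: field_simps)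
  also have "\<dots> = (\<Sum>j\<in>UNIV. \<Sum>i\<in>UNIV. (if i = j then 1/12 else 1/8) * coeff 0 (?D i (?D j f)))"
    by (simp add: Bochner_Integration.integral_sum Bochner_Integration.integrable_sum
      integrable_mult_right integrable_orthant[OF t2])
  finally show ?thesis using coeff_0_face_part[OF t2] by simp
qed

lemma integrable_face_part:
  assumes "test k f"
  shows "integrable (lborel_PiM (- J)) (\<lambda>c. on_orthant f (coord_embed J c))"
proof -
  note [measurable] = test_borel[OF assms]
  obtain C where C: "0 \<le> C" "\<And>x. x \<in> cbox 0 (\<chi> i. real R) \<Longrightarrow> \<bar>f x\<bar> \<le> C"
    using test_bound[OF assms] by blast
  have "integrable (lborel_PiM (- J)) (\<lambda>c. C * (\<Prod>k\<in>- J. indicator {0..real R} (c k)))"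
    by (intro integrable_mult_right lborel_prod.product_integrable_prod) auto
  then show ?thesis
  proof (rule Bochner_Integration.integrable_bound)
    show "AE c in lborel_PiM (- J). norm (on_orthant f (coord_embed J c))
      \<le> norm (C * (\<Prod>k\<in>- J. indicator {0..real R} (c k)))"
    proof (rule AE_I2)
      fix c :: "'n \<Rightarrow> real"
      show "norm (on_orthant f (coord_embed J c))
        \<le> norm (C * (\<Prod>k\<in>- J. indicator {0..real R} (c k)))"
      proof (cases "coord_embed J c \<in> orthant - U")
        case False
        then show ?thesis using assms by (auto simp: indicator_def test_def)
      next
        case True
        then have r: "0 \<le> coord_embed J c $ k" "coord_embed J c $ k \<le> real R" for k
          using U[of "coord_embed J c" k] by (auto simp: orthant_def)
        then have "c k \<in> {0..real R}" if "k \<in> - J" for k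
          using that r[of k] by (simp add: coord_embed_nth)
        then have "(\<Prod>k\<in>- J. indicator {0..real R} (c k)) = (1::real)"
          by (intro prod.neutral) (auto simp: indicator_def)
        moreover have "\<bar>f (coord_embed J c)\<bar> \<le> C"
          using r by (intro C) (simp add: mem_box_cart)
        ultimately show ?thesis using True C(1) by simp
      qed
    qed
  qed measurable
qed

text \<open>Integrate first in the coordinate \<open>i\<close>. The upper boundary term vanishes
  because the ray ends in \<open>U\<close>, and the lower one is the value on the smaller
  face.\<close>

lemma face_part_Dv:
  assumes h: "test (Suc k) h" and i: "i \<notin> J"
  shows "face_part J (Dv (axis i 1) h) = - face_part (insert i J) h"
proof -
  let ?a = "axis i 1 :: real^'n" and ?J = "insert i J"
  have J: "- J = insert i (- ?J)" "i \<notin> - ?J" using i by auto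
  have Dh: "test k (Dv ?a h)" by (rule test_Dv[OF h])
  have emb: "coord_embed J (c(i := y)) = coord_embed ?J c + y *\<^sub>R ?a" for c y
    using i by (auto simp: vec_eq_iff coord_embed_nth axis_def)
  have inner: "(\<integral>y. indicator orthant (p + y *\<^sub>R ?a) * Dv ?a h (p + y *\<^sub>R ?a) \<partial>lborel) = - (on_orthant h p)"
    if p: "p $ i = 0" for p
  proof (cases "p \<in> orthant")
    case False
    then obtain k where k: "p $ k < 0" by (auto simp: orthant_def not_le)
    then have "k \<noteq> i" using p by auto
    then have "(p + y *\<^sub>R ?a) $ k < 0" for y using k by (simp add: axis_def)
    then have "p + y *\<^sub>R ?a \<notin> orthant" for y by (auto simp: orthant_def not_le)
    then show ?thesis using False by simp
  next
    case True
    have o: "p + y *\<^sub>R ?a \<in> orthant \<longleftrightarrow> 0 \<le> y" for y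
      using True p by (force simp: orthant_def axis_def)
    \<comment> \<open>From \<open>R\<close> on the ray runs inside \<open>U\<close>, so the integral
      over the half line is one over a compact interval and the fundamental theorem applies.\<close>
    have far: "p + y *\<^sub>R ?a \<in> U" if "real R \<le> y" for y
      using U[of "p + y *\<^sub>R ?a" i] o[of y] that p by (force simp: axis_def)
    have z: "indicator orthant (p + y *\<^sub>R ?a) * Dv ?a h (p + y *\<^sub>R ?a)
        = Dv ?a h (p + y *\<^sub>R ?a) * indicator {0..real R} y" for y
      using far[of y] Dh o[of y] by (auto simp: indicator_def test_def)
    have c: "continuous_on UNIV (Dv ?a h)" by (rule test_continuous[OF Dh])
    have "(\<integral>y. Dv ?a h (p + y *\<^sub>R ?a) * indicator {0..real R} y \<partial>lborel)
        = h (p + real R *\<^sub>R ?a) - h (p + 0 *\<^sub>R ?a)"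
    proof (rule integral_FTC_Icc_real)
      show "((\<lambda>y. h (p + y *\<^sub>R ?a)) has_real_derivative Dv ?a h (p + y *\<^sub>R ?a)) (at y)" for y
        using h by (intro DERIV_along_line) (simp add: test_def)
      have "continuous_on UNIV (\<lambda>y. Dv ?a h (p + y *\<^sub>R ?a))"
        by (rule continuous_on_compose2[OF c]) (auto intro!: continuous_intros)
      then show "isCont (\<lambda>y. Dv ?a h (p + y *\<^sub>R ?a)) y" for y
        by (simp add: continuous_on_eq_continuous_at)
    qed simp
    then show ?thesis using True far[of "real R"] h unfolding z by (simp add: test_def)
  qed
  have "face_part J (Dv ?a h) = (\<integral>c. (\<integral>y. indicator orthant (coord_embed J (c(i := y)))
      * Dv ?a h (coord_embed J (c(i := y))) \<partial>lborel) \<partial>lborel_PiM (- ?J))"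
    unfolding face_part_def J(1)
    by (rule lborel_prod.product_integral_insert) (use integrable_face_part[OF Dh, of J] J in auto)
  also have "\<dots> = (\<integral>c. - (on_orthant h (coord_embed ?J c)) \<partial>lborel_PiM (- ?J))"
    unfolding emb by (intro Bochner_Integration.integral_cong refl inner) (simp add: coord_embed_nth)
  finally show ?thesis by (simp add: face_part_def)
qed

text \<open>A diagonal term can be integrated only once, since the remaining derivative is
  transversal to the face it lives on. An off-diagonal term is integrated twice and the two signs
  cancel.\<close>

lemma coeff_2_faces:
  assumes f: "test 2 f"
  shows "coeff 2 f = - (1/12) * (\<Sum>i\<in>UNIV. face_part {i} (Dv (axis i 1) f))
    + (1/8) * (\<Sum>j\<in>UNIV. \<Sum>i\<in>- {j}. face_part {i, j} f)"
proof -
  let ?D = "\<lambda>i. Dv (axis i 1 :: real^'n)"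
  have f': "test (Suc (Suc 0)) f" using f by (simp add: numeral_2_eq_2)
  have t1: "test (Suc 0) (?D j f)" for j by (rule test_Dv[OF f'])
  have p1: "face_part {} (?D i (?D j f)) = - face_part {i} (?D j f)" for i j
    using face_part_Dv[OF t1] by simp
  have p2: "face_part {i} (?D j f) = - face_part {i, j} f" if "i \<noteq> j" for i j
    using face_part_Dv[OF f', of j "{i}"] that by (simp add: insert_commute)
  have "(\<Sum>i\<in>UNIV. (if i = j then 1/12 else 1/8) * face_part {} (?D i (?D j f)))
    = - (1/12) * face_part {j} (?D j f) + (\<Sum>i\<in>- {j}. (1/8) * face_part {i, j} f)" for j
    by (subst sum.remove[of _ j]) (auto simp: p1 p2 Compl_eq_Diff_UNIV intro!: sum.cong)
  then show ?thesis
    unfolding coeff_2[OF f] by (simp add: sum.distrib sum_distrib_left sum_negf sum_subtractf)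
qed

end

section \<open>The edge cone at a vertex of a polytope\<close>

lemma face_supporting_hyperplane:
  fixes P :: "'a::euclidean_space set"
  assumes "polyhedron P" "F face_of P" "F \<noteq> {}"
  obtains a b where "\<And>x. x \<in> P \<Longrightarrow> a \<bullet> x \<le> b" "F = P \<inter> {x. a \<bullet> x = b}"
proof (cases "F = P")
  case True
  \<comment> \<open>The polytope itself is cut out by the trivial functional.\<close>
  then show thesis using that[of 0 0] by simp
next
  case False
  have "F exposed_face_of P" using assms by (simp add: exposed_face_of_polyhedron)
  then obtain a b where "P \<subseteq> {x. a \<bullet> x \<le> b}" "F = P \<inter> {x. a \<bullet> x = b}"
    using False assms(3) unfolding exposed_face_of by metis
  then show thesis using that[of a b] by blast
qed

text \<open>Let \<open>F\<close> be the smallest face containing \<open>q\<close>, so that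
  \<open>q\<close> is in its relative interior. As \<open>q\<close> is extreme in the slice, the
  hyperplane meets \<open>F\<close> in \<open>q\<close> alone, hence \<open>F\<close> has dimension
  at most 1. It is not a point, because no vertex lies at level \<open>\<delta>\<close>; and it
  contains \<open>v\<close>, because all other vertices lie strictly below that level.\<close>

lemma extreme_point_of_slice_on_edge:
  fixes P :: "'a::euclidean_space set"
  assumes P: "polytope P" and v: "v extreme_point_of P"
    and \<delta>: "\<And>w. w extreme_point_of P \<Longrightarrow> w \<noteq> v \<Longrightarrow> a \<bullet> w < \<delta>" "\<delta> < a \<bullet> v"
    and q: "q extreme_point_of (P \<inter> {x. a \<bullet> x = \<delta>})"
  shows "\<exists>s. s edge_of P \<and> v \<in> s \<and> q \<in> s"
proof -
  have qP: "q \<in> P" and qa: "a \<bullet> q = \<delta>" using q by (auto simp: extreme_point_of_def)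
  have cP: "convex P" by (rule polytope_imp_convex[OF P])
  define F where "F = \<Inter>{G. G face_of P \<and> q \<in> G}"
  have F: "F face_of P" unfolding F_def
    using qP cP by (intro face_of_Inter) (auto intro: face_of_refl)
  have qF: "q \<in> F" by (auto simp: F_def)
  have polyF: "polytope F" by (rule face_of_polytope_polytope[OF P F])
  have FP: "F \<subseteq> P" by (rule face_of_imp_subset[OF F])
  have "q \<notin> rel_frontier F"
  proof
    assume "q \<in> rel_frontier F"
    then obtain G where G: "G facet_of F" "q \<in> G"
      using rel_frontier_of_polyhedron[OF polytope_imp_polyhedron[OF polyF]] by auto
    then have "G face_of P" using F face_of_trans facet_of_imp_face_of by blast
    then have "F \<subseteq> G" using G(2) by (auto simp: F_def)
    then have "G = F" using facet_of_imp_subset[OF G(1)] by blast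
    then show False using G(1) by simp
  qed
  then have "q \<in> rel_interior F"
    using qF by (simp add: rel_frontier_def closure_closed polytope_imp_closed polyF)
  then have qi: "q \<in> rel_interior F \<inter> {x. a \<bullet> x = \<delta>}" using qa by simp
  have "q extreme_point_of (F \<inter> {x. a \<bullet> x = \<delta>})"
    using q qF FP unfolding extreme_point_of_def by blast
  moreover have "q \<in> rel_interior (F \<inter> {x. a \<bullet> x = \<delta>})"
    using convex_affine_rel_interior_Int[OF face_of_imp_convex[OF F] affine_hyperplane, of a \<delta>] qi by blast
  ultimately have slice: "F \<inter> {x. a \<bullet> x = \<delta>} = {q}"
    using extreme_point_not_in_REL_INTERIOR by blast
  obtain \<epsilon> where \<epsilon>: "\<epsilon> > 0" "cball q \<epsilon> \<inter> affine hull F \<subseteq> F"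
    using qi by (auto simp: mem_rel_interior_cball)
  let ?A = "affine hull F \<inter> {x. a \<bullet> x = \<delta>}"
  \<comment> \<open>A second point of the affine slice could be moved along the slice towards
    \<open>q\<close> until it lies in \<open>F\<close>.\<close>
  have A: "?A = {q}"
  proof (rule ccontr)
    assume "?A \<noteq> {q}"
    moreover have "q \<in> ?A" using qF qa by (simp add: hull_inc)
    ultimately obtain y where y: "y \<in> ?A" "y \<noteq> q" by blast
    define c where "c = \<epsilon> / norm (y - q)"
    have "q + c *\<^sub>R (y - q) = (1 - c) *\<^sub>R q + c *\<^sub>R y" by (simp add: algebra_simps)
    then have "q + c *\<^sub>R (y - q) \<in> affine hull F"
      using y qF mem_affine[OF affine_affine_hull, of q F y "1 - c" c] by (simp add: hull_inc)
    moreover have "q + c *\<^sub>R (y - q) \<in> cball q \<epsilon>"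
      using \<epsilon>(1) y(2) by (simp add: dist_norm c_def)
    ultimately have "q + c *\<^sub>R (y - q) \<in> F \<inter> {x. a \<bullet> x = \<delta>}"
      using \<epsilon>(2) y(1) qa by (auto simp: inner_add_right inner_diff_right)
    then show False unfolding slice using \<epsilon>(1) y(2) by (simp add: c_def)
  qed
  have "aff_dim ?A = 0" unfolding A by simp
  then have "aff_dim F \<le> 1"
    using aff_dim_affine_Int_hyperplane[OF affine_affine_hull[of F], of a \<delta>] A
    by (auto split: if_splits)
  moreover have "aff_dim F \<noteq> 0"
  proof
    assume "aff_dim F = 0"
    then obtain p where "F = {p}" unfolding aff_dim_eq_0 by blast
    then have "F = {q}" using qF by simp
    then have "q extreme_point_of P" using F by (simp add: face_of_singleton)
    then show False using \<delta> qa by (cases "q = v") force+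
  qed
  moreover have "\<not> aff_dim F < 0" unfolding aff_dim_negative_iff using qF by blast
  ultimately have "aff_dim F = 1" by linarith
  moreover have "v \<in> F"
  proof (rule ccontr)
    assume "v \<notin> F"
    then have "{x. x extreme_point_of F} \<subseteq> {x. a \<bullet> x < \<delta>}"
      using extreme_point_of_face[OF F] \<delta>(1) by auto
    then have "convex hull {x. x extreme_point_of F} \<subseteq> {x. a \<bullet> x < \<delta>}"
      by (rule hull_minimal) (rule convex_halfspace_lt)
    moreover have "F = convex hull {x. x extreme_point_of F}"
      by (rule Krein_Milman_Minkowski) (use polyF in \<open>auto simp: polytope_imp_compact polytope_imp_convex\<close>)
    ultimately have "a \<bullet> q < \<delta>" using qF by blast
    then show False using qa by simp
  qed
  ultimately show ?thesis using F qF by (auto simp: edge_of_def)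
qed

text \<open>A hyperplane just below \<open>v\<close> separates it from the other vertices. The
  extreme points of the slice lie on edges at \<open>v\<close>, so the slice lies in the translated
  cone. The segment from \<open>v\<close> to any other vertex crosses the slice, and rescaling from
  there puts that vertex into the cone.\<close>

lemma polytope_subset_edge_cone:
  fixes P :: "'a::euclidean_space set"
  assumes P: "polytope P" and v: "v extreme_point_of P" and C: "convex C" "conic C" "0 \<in> C"
    and edges: "\<And>s y. s edge_of P \<Longrightarrow> v \<in> s \<Longrightarrow> y \<in> s \<Longrightarrow> y - v \<in> C"
    and x: "x \<in> P"
  shows "x - v \<in> C"
proof -
  have poly: "polyhedron P" by (rule polytope_imp_polyhedron[OF P])
  let ?V = "{w. w extreme_point_of P}"
  have fin: "finite ?V" by (rule finite_polyhedron_extreme_points[OF poly])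
  have "{v} face_of P" using v by (simp add: face_of_singleton)
  from face_supporting_hyperplane[OF poly this] obtain a b
    where ab: "\<And>x. x \<in> P \<Longrightarrow> a \<bullet> x \<le> b" "{v} = P \<inter> {x. a \<bullet> x = b}" by blast
  have av: "a \<bullet> v = b" using ab(2) by blast
  have lt: "a \<bullet> w < b" if "w \<in> ?V" "w \<noteq> v" for w
    using ab(1)[of w] ab(2) that by (force simp: extreme_point_of_def order.order_iff_strict)
  \<comment> \<open>The extra element \<open>b - 1\<close> keeps the maximum defined when
    \<open>v\<close> is the only vertex.\<close>
  define \<delta>0 where "\<delta>0 = Max (insert (b - 1) ((\<bullet>) a ` (?V - {v})))"
  have \<delta>0: "\<delta>0 < b" unfolding \<delta>0_def using fin lt by (subst Max_less_iff) auto
  have \<delta>0': "a \<bullet> w \<le> \<delta>0" if "w \<in> ?V" "w \<noteq> v" for w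
    unfolding \<delta>0_def using fin that by (intro Max_ge) auto
  define \<delta> where "\<delta> = (\<delta>0 + b) / 2"
  have \<delta>: "\<delta>0 < \<delta>" "\<delta> < b" using \<delta>0 by (auto simp: \<delta>_def)
  let ?Q = "P \<inter> {x. a \<bullet> x = \<delta>}"
  have Qp: "polytope ?Q" by (rule polytope_Int_polyhedron[OF P polyhedron_hyperplane])
  have cvC: "convex {x. x - v \<in> C}"
  proof -
    have "{x. x - v \<in> C} = (+) v ` C"
      by (auto simp: image_iff) (metis add.commute diff_add_cancel)
    then show ?thesis using convex_translation[OF C(1), of v] by simp
  qed
  have QC: "q - v \<in> C" if "q \<in> ?Q" for q
  proof -
    have "{q. q extreme_point_of ?Q} \<subseteq> {x. x - v \<in> C}"
    proof
      fix q assume "q \<in> {q. q extreme_point_of ?Q}"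
      then have "\<exists>s. s edge_of P \<and> v \<in> s \<and> q \<in> s"
        using \<delta> \<delta>0' av by (intro extreme_point_of_slice_on_edge[OF P v, of a \<delta>]) force+
      then show "q \<in> {x. x - v \<in> C}" using edges by blast
    qed
    then have "convex hull {q. q extreme_point_of ?Q} \<subseteq> {x. x - v \<in> C}"
      by (rule hull_minimal) (rule cvC)
    moreover have "?Q = convex hull {q. q extreme_point_of ?Q}"
      by (rule Krein_Milman_Minkowski) (use Qp in \<open>auto simp: polytope_imp_compact polytope_imp_convex\<close>)
    ultimately show ?thesis using that by blast
  qed
  have "?V \<subseteq> {x. x - v \<in> C}"
  proof
    fix w assume w: "w \<in> ?V"
    show "w \<in> {x. x - v \<in> C}"
    proof (cases "w = v")
      case False
      define t where "t = (b - \<delta>) / (b - a \<bullet> w)"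
      have bw: "0 < b - a \<bullet> w" using lt[OF w False] by simp
      have t: "0 < t" "t \<le> 1" using \<delta> \<delta>0'[OF w False] bw by (auto simp: t_def)
      define q where "q = (1 - t) *\<^sub>R v + t *\<^sub>R w"
      have "q \<in> P" unfolding q_def
        using t v w polytope_imp_convex[OF P] by (intro convexD) (auto simp: extreme_point_of_def)
      moreover have "a \<bullet> q = \<delta>"
      proof -
        have "t * (b - a \<bullet> w) = b - \<delta>" using bw by (simp add: t_def)
        then show ?thesis by (simp add: q_def inner_add_right av algebra_simps)
      qed
      ultimately have "q - v \<in> C" using QC by blast
      then have "(1 / t) *\<^sub>R (q - v) \<in> C" using C(2) t unfolding conic_def by auto
      moreover have "(1 / t) *\<^sub>R (q - v) = w - v" using t by (simp add: q_def algebra_simps)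
      ultimately show ?thesis by simp
    qed (use C(3) in simp)
  qed
  then have "convex hull ?V \<subseteq> {x. x - v \<in> C}" by (rule hull_minimal) (rule cvC)
  moreover have "P = convex hull ?V"
    by (rule Krein_Milman_Minkowski) (use P in \<open>auto simp: polytope_imp_compact polytope_imp_convex\<close>)
  ultimately show ?thesis using x by blast
qed

lemma convex_ray_point:
  assumes "convex S" "v \<in> S" "v + c *\<^sub>R e \<in> S" "0 \<le> u" "u \<le> c" "0 < c"
  shows "v + u *\<^sub>R e \<in> S"
proof -
  have "v + u *\<^sub>R e = (1 - u / c) *\<^sub>R v + (u / c) *\<^sub>R (v + c *\<^sub>R e)"
    using assms(6) by (simp add: algebra_simps)
  then show ?thesis using assms convexD[OF assms(1-3), of "1 - u / c" "u / c"] by simp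
qed

lemma edge_ray_point:
  fixes r :: "'a::euclidean_space set"
  assumes r: "r edge_of P" "v \<in> r" "r \<subseteq> {v + t *\<^sub>R e |t. 0 \<le> t}"
  shows "\<exists>t>0. v + t *\<^sub>R e \<in> r"
proof -
  have "r \<noteq> {v}" using r(1) by (auto simp: edge_of_def)
  then obtain y where "y \<in> r" "y \<noteq> v" using r(2) by blast
  moreover then obtain t where "y = v + t *\<^sub>R e" "0 \<le> t" using r(3) by auto
  ultimately show ?thesis by (intro exI[of _ t]) (auto simp: less_le)
qed

text \<open>The intersection is a face of both edges and contains a nondegenerate segment, so it has
  dimension 1 and equals each of them.\<close>

lemma edges_on_common_ray_eq:
  fixes P :: "'a::euclidean_space set"
  assumes P: "polytope P" and s: "s edge_of P" "v \<in> s" "s \<subseteq> {v + t *\<^sub>R e |t. 0 \<le> t}"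
    and s': "s' edge_of P" "v \<in> s'" "s' \<subseteq> {v + t *\<^sub>R e |t. 0 \<le> t}"
  shows "s = s'"
proof -
  have f: "s face_of P" "s' face_of P" using s s' by (auto simp: edge_of_def)
  then have cv: "convex s" "convex s'" by (auto intro: face_of_imp_convex)
  obtain t t' where t: "t > 0" "v + t *\<^sub>R e \<in> s" and t': "t' > 0" "v + t' *\<^sub>R e \<in> s'"
    using edge_ray_point[OF s] edge_ray_point[OF s'] by blast
  have e0: "e \<noteq> 0"
  proof
    assume "e = 0"
    then have "s = {v}" using s by auto
    then show False using s(1) by (auto simp: edge_of_def)
  qed
  define u where "u = min t t'"
  have u: "v + u *\<^sub>R e \<in> s \<inter> s'" "0 < u"
    using convex_ray_point[OF cv(1) s(2) t(2), of u] convex_ray_point[OF cv(2) s'(2) t'(2), of u] t t' by (auto simp: u_def)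
  have face: "s \<inter> s' face_of s" "s \<inter> s' face_of s'"
    using face_of_Int[OF f] f by (auto simp: face_of_face)
  have "{v, v + u *\<^sub>R e} \<subseteq> s \<inter> s'" using u s(2) s'(2) by auto
  then have "aff_dim {v, v + u *\<^sub>R e} \<le> aff_dim (s \<inter> s')" by (rule aff_dim_subset)
  then have "1 \<le> aff_dim (s \<inter> s')" using u(2) e0 by (simp add: aff_dim_2)
  then have "s \<inter> s' = s" "s \<inter> s' = s'"
    using face_of_aff_dim_lt[OF cv(1) face(1)] face_of_aff_dim_lt[OF cv(2) face(2)] s(1) s'(1)
    by (force simp: edge_of_def)+
  then show ?thesis by simp
qed

text \<open>Sending an edge at \<open>v\<close> to the basis vector of its ray is injective, and
  there are as many edges as basis vectors, so every basis vector carries an edge. The dual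
  coordinates are nonnegative on all edges at \<open>v\<close>, hence on the whole polytope by the
  edge cone.\<close>

lemma delzant_vertex_frame:
  fixes P :: "(real^'n) set"
  assumes P: "polytope P" and del: "delzant P" and v: "v extreme_point_of P"
  obtains e \<alpha> \<epsilon> where "lattice_frame e \<alpha>" "\<And>x i. x \<in> P \<Longrightarrow> 0 \<le> \<alpha> i \<bullet> (x - v)"
    "\<epsilon> > 0" "\<And>i. v + \<epsilon> *\<^sub>R e i \<in> P"
proof -
  let ?S = "{s. s edge_of P \<and> v \<in> s}"
  have D: "card ?S = CARD('n) \<and> (\<exists>E. int_basis E int_lattice \<and>
      (\<forall>s. s edge_of P \<and> v \<in> s \<longrightarrow> (\<exists>e\<in>E. s \<subseteq> {v + t *\<^sub>R e |t. 0 \<le> t})))"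
    using del[unfolded delzant_def, rule_format, OF v] .
  then have cS: "card ?S = CARD('n)" by (rule conjunct1)
  from D obtain E where E: "int_basis E int_lattice"
    and "\<forall>s. s edge_of P \<and> v \<in> s \<longrightarrow> (\<exists>e\<in>E. s \<subseteq> {v + t *\<^sub>R e |t. 0 \<le> t})"
    by (elim conjE exE)
  then have sE: "\<exists>e\<in>E. s \<subseteq> {v + t *\<^sub>R e |t. 0 \<le> t}" if "s \<in> ?S" for s
    using that by simp
  obtain \<beta> where \<beta>: "\<And>b. b \<in> E \<Longrightarrow> \<beta> b \<in> int_lattice"
    "\<And>a b. a \<in> E \<Longrightarrow> b \<in> E \<Longrightarrow> \<beta> a \<bullet> b = (if a = b then 1 else 0)"
    "E \<subseteq> int_lattice" "card E = CARD('n)"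
    using int_basis_dual[OF E] by metis
  have finE: "finite E" using E by (simp add: int_basis_def)
  define ray where "ray s = (SOME e. e \<in> E \<and> s \<subseteq> {v + t *\<^sub>R e |t. 0 \<le> t})" for s
  have ray: "ray s \<in> E" "s \<subseteq> {v + t *\<^sub>R ray s |t. 0 \<le> t}" if "s \<in> ?S" for s
    using someI_ex[of "\<lambda>e. e \<in> E \<and> s \<subseteq> {v + t *\<^sub>R e |t. 0 \<le> t}"] sE[OF that]
    unfolding ray_def by blast+
  have "inj_on ray ?S"
  proof (rule inj_onI)
    fix s s' assume s: "s \<in> ?S" "s' \<in> ?S" "ray s = ray s'"
    have "s \<subseteq> {v + t *\<^sub>R ray s |t. 0 \<le> t}" "s' \<subseteq> {v + t *\<^sub>R ray s |t. 0 \<le> t}"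
      using ray(2)[OF s(1)] ray(2)[OF s(2)] s(3) by auto
    then show "s = s'" using s edges_on_common_ray_eq[OF P] by blast
  qed
  then have "card (ray ` ?S) = card E" using cS \<beta>(4) by (simp add: card_image)
  then have rayS: "ray ` ?S = E" using ray(1) finE by (intro card_subset_eq) auto
  obtain e where e: "bij_betw e (UNIV :: 'n set) E"
    using finite_same_card_bij[of "UNIV :: 'n set" E] finE \<beta>(4) by auto
  have eE: "e i \<in> E" for i using e by (auto simp: bij_betw_def)
  have inj: "e i = e j \<longleftrightarrow> i = j" for i j using e by (auto simp: bij_betw_def inj_eq)
  define \<alpha> where "\<alpha> i = \<beta> (e i)" for i
  have f: "lattice_frame e \<alpha>"
    unfolding lattice_frame_def \<alpha>_def using \<beta> eE inj by auto
  have edge_pt: "\<exists>t>0. v + t *\<^sub>R e i \<in> P" for i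
  proof -
    obtain s where s: "s \<in> ?S" "ray s = e i" using rayS eE[of i] by auto
    have "s \<subseteq> {v + t *\<^sub>R e i |t. 0 \<le> t}" using ray(2)[OF s(1)] unfolding s(2) .
    then show ?thesis using s(1) edge_ray_point[of s P v "e i"] edge_of_imp_subset[of s P] by blast
  qed
  then obtain t where t: "\<And>i. 0 < t i" "\<And>i. v + t i *\<^sub>R e i \<in> P" by metis
  define \<epsilon> where "\<epsilon> = Min (range t)"
  have \<epsilon>: "\<epsilon> > 0" "\<epsilon> \<le> t i" for i unfolding \<epsilon>_def using t(1) by auto
  have vP: "v \<in> P" using v by (simp add: extreme_point_of_def)
  have "v + \<epsilon> *\<^sub>R e i \<in> P" for i
    using \<epsilon>(1) \<epsilon>(2)[of i] t(1)[of i] by (intro convex_ray_point[OF polytope_imp_convex[OF P] vP t(2)]) auto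
  moreover have "0 \<le> \<alpha> i \<bullet> (x - v)" if x: "x \<in> P" for x i
  proof -
    let ?C = "{y. 0 \<le> \<alpha> i \<bullet> y}"
    have "x - v \<in> ?C"
    proof (rule polytope_subset_edge_cone[OF P v _ _ _ _ x])
      show "convex ?C" using convex_halfspace_ge[of 0 "\<alpha> i"] by simp
      show "conic ?C" by (simp add: conic_def)
      fix s y assume s: "s edge_of P" "v \<in> s" "y \<in> s"
      then obtain c where "y = v + c *\<^sub>R ray s" "0 \<le> c" using ray(2)[of s] by auto
      moreover obtain j where "ray s = e j" using ray(1)[of s] s e by (auto simp: bij_betw_def)
      ultimately show "y - v \<in> ?C" by (simp add: frame_inner[OF f])
    qed simp
    then show ?thesis by simp
  qed
  ultimately show thesis using that[OF f _ \<epsilon>(1)] by blast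
qed

section \<open>Faces at a Delzant vertex and partitions of unity\<close>

text \<open>What is retained of the Delzant condition: the polytope lies in the cone spanned by the
  frame at \<open>v\<close>, and it contains a point on each ray of that cone. The faces at
  \<open>v\<close> are determined by these two facts.\<close>

locale simple_vertex =
  fixes P :: "(real^'n) set" and v :: "real^'n" and e \<alpha> :: "'n \<Rightarrow> real^'n" and \<epsilon> :: real
  assumes frame: "lattice_frame e \<alpha>" and polytope_P: "polytope P" and v_ext: "v extreme_point_of P"
    and inner_nonneg: "\<And>x i. x \<in> P \<Longrightarrow> 0 \<le> \<alpha> i \<bullet> (x - v)"
    and \<epsilon>_pos: "\<epsilon> > 0" and edge_point: "\<And>i. v + \<epsilon> *\<^sub>R e i \<in> P"
begin

definition coordinate_face :: "'n set \<Rightarrow> (real^'n) set" where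
  "coordinate_face J = P \<inter> {x. \<forall>j\<in>J. \<alpha> j \<bullet> (x - v) = 0}"

lemma convex_P: "convex P" by (rule polytope_imp_convex[OF polytope_P])

lemma v_in_P: "v \<in> P" using v_ext by (simp add: extreme_point_of_def)

lemma v_in_coordinate_face: "v \<in> coordinate_face J"
  by (simp add: coordinate_face_def v_in_P)

lemma inner_e: "\<alpha> i \<bullet> e j = (if i = j then 1 else 0)"
  by (rule frame_inner[OF frame])

lemma edge_point_in_coordinate_face: "v + \<epsilon> *\<^sub>R e k \<in> coordinate_face J \<longleftrightarrow> k \<notin> J"
  using \<epsilon>_pos edge_point by (auto simp: coordinate_face_def inner_e split: if_splits)

lemma coordinate_face_inject: "coordinate_face J = coordinate_face K \<longleftrightarrow> J = K"
  using edge_point_in_coordinate_face by blast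

lemma coordinate_face_Int: "coordinate_face J \<inter> coordinate_face K = coordinate_face (J \<union> K)"
  by (auto simp: coordinate_face_def)

lemma coordinate_face_face_of: "coordinate_face J face_of P"
proof -
  let ?a = "\<Sum>j\<in>J. \<alpha> j"
  have le: "?a \<bullet> v \<le> ?a \<bullet> x" if "x \<in> P" for x
  proof -
    have "0 \<le> (\<Sum>j\<in>J. \<alpha> j \<bullet> (x - v))" using inner_nonneg[OF that] by (intro sum_nonneg) auto
    then show ?thesis by (simp add: inner_sum_left inner_diff_right sum_subtractf)
  qed
  have "coordinate_face J = P \<inter> {x. ?a \<bullet> x = ?a \<bullet> v}"
  proof (intro set_eqI iffI)
    fix x assume "x \<in> P \<inter> {x. ?a \<bullet> x = ?a \<bullet> v}"
    then have x: "x \<in> P" and "(\<Sum>j\<in>J. \<alpha> j \<bullet> (x - v)) = 0"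
      by (auto simp: inner_sum_left inner_diff_right sum_subtractf)
    then show "x \<in> coordinate_face J"
      using sum_nonneg_eq_0_iff[of J "\<lambda>j. \<alpha> j \<bullet> (x - v)"] inner_nonneg[OF x]
      by (auto simp: coordinate_face_def)
  next
    fix x assume "x \<in> coordinate_face J"
    then show "x \<in> P \<inter> {x. ?a \<bullet> x = ?a \<bullet> v}"
      by (auto simp: coordinate_face_def inner_sum_left inner_diff_right)
  qed
  then show ?thesis using face_of_Int_supporting_hyperplane_ge[OF convex_P le] by simp
qed

text \<open>In the frame expansion of \<open>a \<bullet> (x - v)\<close> the coordinates are
  nonnegative and the values \<open>a \<bullet> e j\<close> are at most 0, as the edge points show.
  The sum vanishes only if every term does.\<close>

lemma supporting_face_coordinate:
  assumes ab: "\<And>x. x \<in> P \<Longrightarrow> a \<bullet> x \<le> b" and b: "b = a \<bullet> v"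
  shows "P \<inter> {x. a \<bullet> x = b} = coordinate_face {j. a \<bullet> e j < 0}"
proof -
  have ae: "a \<bullet> e j \<le> 0" for j
  proof -
    have "\<epsilon> * (a \<bullet> e j) \<le> 0" using ab[OF edge_point[of j]] by (simp add: b inner_add_right)
    then show ?thesis using \<epsilon>_pos by (simp add: mult_le_0_iff)
  qed
  have exp: "a \<bullet> (x - v) = (\<Sum>j\<in>UNIV. (\<alpha> j \<bullet> (x - v)) * (a \<bullet> e j))" for x
    by (subst frame_expand[OF frame, of "x - v", symmetric]) (simp add: inner_sum_right)
  have "a \<bullet> x = b \<longleftrightarrow> (\<forall>j\<in>{j. a \<bullet> e j < 0}. \<alpha> j \<bullet> (x - v) = 0)" if x: "x \<in> P" for x
  proof -
    have "a \<bullet> x = b \<longleftrightarrow> a \<bullet> (x - v) = 0" by (simp add: b inner_diff_right)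
    also have "\<dots> \<longleftrightarrow> (\<Sum>j\<in>UNIV. (\<alpha> j \<bullet> (x - v)) * - (a \<bullet> e j)) = 0"
      unfolding exp by (simp add: sum_negf)
    also have "\<dots> \<longleftrightarrow> (\<forall>j\<in>UNIV. (\<alpha> j \<bullet> (x - v)) * - (a \<bullet> e j) = 0)"
      using inner_nonneg[OF x] ae
      by (intro sum_nonneg_eq_0_iff finite mult_nonneg_nonneg) auto
    also have "\<dots> \<longleftrightarrow> (\<forall>j\<in>{j. a \<bullet> e j < 0}. \<alpha> j \<bullet> (x - v) = 0)"
      using ae by (auto simp: order.order_iff_strict)
    finally show ?thesis .
  qed
  then show ?thesis unfolding coordinate_face_def by blast
qed

lemma face_is_coordinate_face:
  assumes G: "G face_of P" and v: "v \<in> G"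
  shows "\<exists>J. G = coordinate_face J"
proof (rule face_supporting_hyperplane[OF polytope_imp_polyhedron[OF polytope_P] G])
  show "G \<noteq> {}" using v by blast
  fix a b assume ab: "\<And>x. x \<in> P \<Longrightarrow> a \<bullet> x \<le> b" "G = P \<inter> {x. a \<bullet> x = b}"
  have "b = a \<bullet> v" using v ab(2) by simp
  with ab(1) have "P \<inter> {x. a \<bullet> x = b} = coordinate_face {j. a \<bullet> e j < 0}"
    by (rule supporting_face_coordinate)
  then show "\<exists>J. G = coordinate_face J" using ab(2) by blast
qed

text \<open>The edge points with index outside \<open>J\<close> already span the subspace, which is
  why one point per edge suffices.\<close>

lemma affine_hull_coordinate_face:
  "affine hull coordinate_face J = {x. \<forall>j\<in>J. \<alpha> j \<bullet> (x - v) = 0}"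
proof
  have "{x. \<forall>j\<in>J. \<alpha> j \<bullet> (x - v) = 0} = \<Inter> ((\<lambda>j. {x. \<alpha> j \<bullet> x = \<alpha> j \<bullet> v}) ` J)"
    by (auto simp: inner_diff_right)
  moreover have "affine (\<Inter> ((\<lambda>j. {x. \<alpha> j \<bullet> x = \<alpha> j \<bullet> v}) ` J))"
    by (intro affine_Inter) (auto intro: affine_hyperplane)
  ultimately show "affine hull coordinate_face J \<subseteq> {x. \<forall>j\<in>J. \<alpha> j \<bullet> (x - v) = 0}"
    by (intro hull_minimal) (auto simp: coordinate_face_def)
next
  show "{x. \<forall>j\<in>J. \<alpha> j \<bullet> (x - v) = 0} \<subseteq> affine hull coordinate_face J"
  proof
    fix x assume "x \<in> {x. \<forall>j\<in>J. \<alpha> j \<bullet> (x - v) = 0}"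
    then have x: "\<alpha> j \<bullet> (x - v) = 0" if "j \<in> J" for j using that by blast
    let ?L = "(\<lambda>x. - v + x) ` (affine hull coordinate_face J)"
    have L: "subspace ?L"
      by (intro affine_diffs_subspace affine_affine_hull hull_inc v_in_coordinate_face)
    have eL: "e k \<in> ?L" if "k \<notin> J" for k
    proof -
      have "v + \<epsilon> *\<^sub>R e k \<in> affine hull coordinate_face J"
        using that by (intro hull_inc) (simp add: edge_point_in_coordinate_face)
      then have "\<epsilon> *\<^sub>R e k \<in> ?L" by (force simp: image_iff)
      then have "(1 / \<epsilon>) *\<^sub>R (\<epsilon> *\<^sub>R e k) \<in> ?L" by (rule subspace_scale[OF L])
      then show ?thesis using \<epsilon>_pos by simp
    qed
    have "x - v = (\<Sum>k\<in>UNIV. (\<alpha> k \<bullet> (x - v)) *\<^sub>R e k)"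
      by (rule frame_expand[OF frame, symmetric])
    also have "\<dots> = (\<Sum>k\<in>- J. (\<alpha> k \<bullet> (x - v)) *\<^sub>R e k)"
      using x by (intro sum.mono_neutral_right) auto
    also have "\<dots> \<in> ?L" using eL by (intro subspace_sum[OF L] subspace_scale[OF L]) auto
    finally show "x \<in> affine hull coordinate_face J" by (auto simp: algebra_simps)
  qed
qed

lemma parallel_subspace_coordinate_face:
  "parallel_subspace (coordinate_face J) = {x. \<forall>j\<in>J. \<alpha> j \<bullet> x = 0}"
proof (intro set_eqI iffI)
  fix y assume "y \<in> {x. \<forall>j\<in>J. \<alpha> j \<bullet> x = 0}"
  then have "v + y \<in> affine hull coordinate_face J" "v \<in> affine hull coordinate_face J"
    by (auto simp: affine_hull_coordinate_face)
  moreover have "y = (v + y) - v" by simp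
  ultimately show "y \<in> parallel_subspace (coordinate_face J)"
    unfolding parallel_subspace_def by blast
qed (auto simp: parallel_subspace_def affine_hull_coordinate_face inner_diff_right)

lemma aff_dim_coordinate_face: "aff_dim (coordinate_face J) = int CARD('n) - int (card J)"
proof -
  let ?L = "{x. \<forall>j\<in>J. \<alpha> j \<bullet> x = 0}" and ?B = "e ` (- J)"
  have inj: "inj_on e (- J)" using frame_inj[OF frame] inj_on_subset by blast
  have "affine hull coordinate_face J = (+) v ` ?L"
    unfolding affine_hull_coordinate_face
    by (auto simp: image_iff) (metis add.commute diff_add_cancel)
  then have "aff_dim (coordinate_face J) = aff_dim ((+) v ` ?L)"
    using aff_dim_affine_hull[of "coordinate_face J"] by simp
  then have "aff_dim (coordinate_face J) = aff_dim ?L"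
    unfolding aff_dim_translation_eq .
  moreover have L: "subspace ?L"
    unfolding subspace_def by (auto simp: inner_add_right)
  moreover have "dim ?L = card ?B"
  proof (rule dim_unique)
    show "?B \<subseteq> ?L" by (auto simp: inner_e)
    show "?L \<subseteq> span ?B"
    proof
      fix x assume "x \<in> ?L"
      then have "(\<Sum>k\<in>UNIV. (\<alpha> k \<bullet> x) *\<^sub>R e k) = (\<Sum>k\<in>- J. (\<alpha> k \<bullet> x) *\<^sub>R e k)"
        by (intro sum.mono_neutral_right) auto
      moreover have "\<dots> \<in> span ?B" by (intro span_sum span_scale span_base) auto
      ultimately show "x \<in> span ?B" by (simp add: frame_expand[OF frame])
    qed
    show "independent ?B"
    proof (rule independent_if_scalars_zero)
      fix f b assume 0: "(\<Sum>x\<in>?B. f x *\<^sub>R x) = 0" and "b \<in> ?B"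
      then obtain k where k: "b = e k" "k \<in> - J" by blast
      have "(\<Sum>k\<in>- J. f (e k) *\<^sub>R e k) = 0" using 0 by (simp add: sum.reindex[OF inj])
      then show "f b = 0" using frame_inner_sum[OF frame, of k "\<lambda>k. f (e k)" "- J"] k by simp
    qed simp
  qed simp
  moreover have "card ?B = CARD('n) - card J"
    unfolding card_image[OF inj] by (simp add: card_Diff_subset Compl_eq_Diff_UNIV)
  moreover have "card J \<le> CARD('n)" by (intro card_mono) auto
  ultimately show ?thesis by (simp add: aff_dim_subspace)
qed

lemma faces_of_dim_coordinate:
  "{G \<in> faces_of_dim P (int CARD('n) - int k). v \<in> G} = coordinate_face ` {J. card J = k}"
  using face_is_coordinate_face coordinate_face_face_of v_in_coordinate_face aff_dim_coordinate_face
  unfolding faces_of_dim_def by fastforce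

text \<open>A normal \<open>\<beta>\<close> annihilates every \<open>e k\<close> with
  \<open>k \<noteq> i\<close>, so it is the multiple \<open>\<beta> \<bullet> e i\<close> of
  \<open>\<alpha> i\<close>. This factor is an integer; primitivity makes it 1 or -1, and pointing
  inward excludes -1.\<close>

lemma normal_coordinate_face:
  "inward_primitive_normal P (coordinate_face {i}) = \<alpha> i"
  unfolding inward_primitive_normal_def
proof (rule the_equality)
  have eL: "e k \<in> int_lattice" "\<alpha> k \<in> int_lattice" for k
    using frame by (auto simp: lattice_frame_def)
  have "primitive_vector (\<alpha> i)"
    unfolding primitive_vector_def
  proof (intro conjI allI impI)
    show "\<alpha> i \<in> int_lattice" by (rule eL)
    show "\<alpha> i \<noteq> 0" using inner_e[of i i] by auto
    fix k :: int and \<beta> assume k: "\<beta> \<in> int_lattice \<and> \<alpha> i = of_int k *\<^sub>R \<beta>"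
    then obtain m where "\<beta> \<bullet> e i = of_int m"
      using Ints_inner_lattice[of \<beta> "e i"] eL by (auto elim: Ints_cases)
    then have "real_of_int (k * m) = 1" using k inner_e[of i i] by simp
    then have "k * m = 1" by linarith
    then show "\<bar>k\<bar> = 1" by (auto simp: zmult_eq_1_iff)
  qed
  then show "primitive_vector (\<alpha> i) \<and> (\<forall>x\<in>coordinate_face {i}. \<forall>y\<in>coordinate_face {i}. \<alpha> i \<bullet> (y - x) = 0) \<and>
      (\<forall>x\<in>coordinate_face {i}. \<forall>y\<in>P. 0 \<le> \<alpha> i \<bullet> (y - x))"
    using inner_nonneg by (force simp: coordinate_face_def inner_diff_right)
  fix \<beta> assume \<beta>: "primitive_vector \<beta> \<and> (\<forall>x\<in>coordinate_face {i}. \<forall>y\<in>coordinate_face {i}. \<beta> \<bullet> (y - x) = 0) \<and>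
      (\<forall>x\<in>coordinate_face {i}. \<forall>y\<in>P. 0 \<le> \<beta> \<bullet> (y - x))"
  have 0: "\<beta> \<bullet> e k = 0" if "k \<noteq> i" for k
  proof -
    have "\<beta> \<bullet> (v + \<epsilon> *\<^sub>R e k - v) = 0"
      using \<beta> that v_in_coordinate_face edge_point_in_coordinate_face[of k "{i}"] by blast
    then show ?thesis using \<epsilon>_pos by simp
  qed
  have "0 \<le> \<beta> \<bullet> (v + \<epsilon> *\<^sub>R e i - v)" using \<beta> v_in_coordinate_face edge_point by blast
  then have c0: "0 \<le> \<beta> \<bullet> e i" using \<epsilon>_pos by (simp add: zero_le_mult_iff)
  have "\<beta> \<bullet> x = ((\<beta> \<bullet> e i) *\<^sub>R \<alpha> i) \<bullet> x" for x
  proof -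
    have "\<beta> \<bullet> x = (\<Sum>k\<in>UNIV. (\<alpha> k \<bullet> x) * (\<beta> \<bullet> e k))"
      by (subst frame_expand[OF frame, of x, symmetric]) (simp add: inner_sum_right)
    also have "\<dots> = (\<Sum>k\<in>{i}. (\<alpha> k \<bullet> x) * (\<beta> \<bullet> e k))"
      using 0 by (intro sum.mono_neutral_right) auto
    finally show ?thesis by simp
  qed
  then have eq: "\<beta> = (\<beta> \<bullet> e i) *\<^sub>R \<alpha> i" using vector_eq_rdot by blast
  obtain m :: int where m: "\<beta> \<bullet> e i = of_int m"
    using Ints_inner_lattice[of \<beta> "e i"] eL \<beta> unfolding primitive_vector_def by (auto elim: Ints_cases)
  then have "\<bar>m\<bar> = 1" using \<beta> eL eq unfolding primitive_vector_def by metis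
  then have "m = 1" using c0 m by linarith
  then show "\<beta> = \<alpha> i" using eq m by simp
qed

text \<open>Whatever facets are chosen, they contain the ridge and hence \<open>v\<close>, so they
  are coordinate faces. Their index sets have union \<open>{i, j}\<close>, which leaves only the
  order open, and the coefficient is symmetric.\<close>

lemma ridge_coeff_coordinate_face:
  assumes ij: "i \<noteq> j"
  shows "ridge_coeff P (coordinate_face {i, j}) =
    1/4 - 1/12 * ((\<alpha> i \<bullet> \<alpha> j) / (\<alpha> i \<bullet> \<alpha> i) + (\<alpha> i \<bullet> \<alpha> j) / (\<alpha> j \<bullet> \<alpha> j))"
proof -
  let ?g = "coordinate_face {i, j}"
  let ?Q = "\<lambda>(g1, g2). g1 \<in> faces_of_dim P (int CARD('n) - 1) \<and> g2 \<in> faces_of_dim P (int CARD('n) - 1) \<and> ?g = g1 \<inter> g2"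
  have facet: "coordinate_face {k} \<in> faces_of_dim P (int CARD('n) - 1)" for k
    using faces_of_dim_coordinate[of 1] by fastforce
  have "?g = coordinate_face {i} \<inter> coordinate_face {j}" by (simp add: coordinate_face_Int insert_commute)
  then have "?Q (coordinate_face {i}, coordinate_face {j})" using facet by blast
  then have Q: "?Q (ridge_facets P ?g)" unfolding ridge_facets_def by (rule someI)
  obtain g1 g2 where g: "ridge_facets P ?g = (g1, g2)" by force
  have fac: "\<exists>k. h = coordinate_face {k}" if "h \<in> faces_of_dim P (int CARD('n) - 1)" "v \<in> h" for h
  proof -
    have "h \<in> coordinate_face ` {J. card J = 1}"
      using that faces_of_dim_coordinate[of 1] by auto
    then show ?thesis by (auto simp: card_1_singleton_iff)
  qed
  have "v \<in> g1" "v \<in> g2" using Q g v_in_coordinate_face[of "{i, j}"] by auto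
  then obtain a b where ab: "g1 = coordinate_face {a}" "g2 = coordinate_face {b}"
    using fac Q g by (metis (no_types, lifting) case_prod_conv)
  have "coordinate_face {i, j} = coordinate_face {a, b}"
    using Q g ab by (simp add: coordinate_face_Int insert_commute)
  then have "{i, j} = {a, b}" by (simp add: coordinate_face_inject)
  then have "(a = i \<and> b = j) \<or> (a = j \<and> b = i)" using ij by (auto simp: doubleton_eq_iff)
  then show ?thesis
    unfolding ridge_coeff_def g Let_def ab normal_coordinate_face split
    by (auto simp: inner_commute add.commute)
qed

lemma borel_coordinate_face: "coordinate_face J \<in> sets borel"
  using face_of_imp_closed[OF convex_P polytope_imp_closed[OF polytope_P] coordinate_face_face_of] by simp

lemma face_integral_coordinate_face:
  assumes [measurable]: "F \<in> borel_measurable borel"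
  shows "face_integral (coordinate_face J) F = (\<integral>c. indicator (coordinate_face J) (slice v e J c)
    * F (slice v e J c) \<partial>lborel_PiM (- J))"
proof -
  note [measurable] = borel_coordinate_face
  have "v \<in> affine hull coordinate_face J" by (intro hull_inc v_in_coordinate_face)
  from lattice_measure_frame[OF frame parallel_subspace_coordinate_face this]
  show ?thesis
    unfolding face_integral_def set_lebesgue_integral_def by (simp add: integral_distr)
qed

end

section \<open>Half-space descriptions and partitions of unity indexed by the vertices\<close>

lemma C_diff_partition:
  assumes "finite V" "\<And>v. v \<in> V \<Longrightarrow> C_diff k (u v)"
  shows "\<exists>\<omega>. (\<forall>v\<in>V. C_diff k (\<omega> v) \<and> (\<forall>x. u v x = 0 \<longrightarrow> \<omega> v x = 0)) \<and>
    (\<forall>x. (\<Sum>v\<in>V. \<omega> v x) = 1 - (\<Prod>v\<in>V. 1 - u v x))"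
  using assms
proof (induction V rule: finite_induct)
  case (insert w V)
  then obtain \<omega> where \<omega>: "\<And>v. v \<in> V \<Longrightarrow> C_diff k (\<omega> v)" "\<And>v x. v \<in> V \<Longrightarrow> u v x = 0 \<Longrightarrow> \<omega> v x = 0"
    "\<And>x. (\<Sum>v\<in>V. \<omega> v x) = 1 - (\<Prod>v\<in>V. 1 - u v x)"
    by auto
  \<comment> \<open>The new function takes the share \<open>u w\<close> of the remainder left by the
    others, so the sum telescopes. Only products occur, so smoothness and zeros are inherited from
    \<open>u\<close>.\<close>
  define \<omega>' where "\<omega>' v = (if v = w then \<lambda>x. u w x * (\<Prod>v\<in>V. 1 - u v x) else \<omega> v)" for v
  have w: "\<omega>' w = (\<lambda>x. u w x * (\<Prod>v\<in>V. 1 - u v x))" by (simp add: \<omega>'_def)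
  have V: "\<omega>' v = \<omega> v" if "v \<in> V" for v using that insert.hyps by (auto simp: \<omega>'_def)
  have "C_diff k (\<omega>' v) \<and> (\<forall>x. u v x = 0 \<longrightarrow> \<omega>' v x = 0)" if v: "v \<in> insert w V" for v
  proof (cases "v = w")
    case True
    have "C_diff k (\<omega>' w)" unfolding w
      by (intro C_diff_mult C_diff_prod C_diff_diff C_diff_const insert.prems) auto
    then show ?thesis using True by (simp add: w)
  next
    case False
    then show ?thesis using v \<omega> V by simp
  qed
  moreover have "(\<Sum>v\<in>insert w V. \<omega>' v x) = 1 - (\<Prod>v\<in>insert w V. 1 - u v x)" for x
    using insert.hyps by (simp add: w V \<omega>(3) algebra_simps)
  ultimately show ?case by blast
qed simp

definition slack :: "'a::real_inner \<times> real \<Rightarrow> 'a \<Rightarrow> real" where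
  "slack h x = snd h - fst h \<bullet> x"

text \<open>The number \<open>\<delta>\<close> plays the part of a Lebesgue number: each point of
  \<open>P\<close> has a vertex such that every constraint that is loose at the vertex is loose at
  the point, by a margin uniform in the point.\<close>

locale halfspace_polytope =
  fixes P :: "'a::euclidean_space set" and H :: "('a \<times> real) set" and \<delta> :: real
  assumes finite_H: "finite H" and poly: "polytope P" and P_eq: "P = {x. \<forall>h\<in>H. 0 \<le> slack h x}"
    and \<delta>_pos: "0 < \<delta>"
    and margin: "\<And>x. x \<in> P \<Longrightarrow> \<exists>v. v extreme_point_of P \<and> (\<forall>h\<in>H. 0 < slack h v \<longrightarrow> \<delta> < slack h x)"
begin

text \<open>The bound is half the margin so that a cutoff can vanish here and still reach 1 where
  all slacks in question exceed \<open>\<delta>\<close>. The set extends beyond \<open>P\<close> on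
  purpose, since charts also meet cone points outside \<open>P\<close>.\<close>

definition away :: "'a \<Rightarrow> 'a set" where
  "away v = {x. \<exists>h\<in>H. 0 < slack h v \<and> slack h x < \<delta> / 2}"

lemma open_away: "open (away v)"
proof -
  have "away v = (\<Union>h\<in>{h\<in>H. 0 < slack h v}. {x. slack h x < \<delta> / 2})"
    by (auto simp: away_def)
  then show ?thesis
    unfolding slack_def by (auto intro!: open_Collect_less continuous_intros)
qed

text \<open>Constraints tight at \<open>v\<close> hold on the whole cone at \<open>v\<close>; the
  others hold with slack at least \<open>\<delta> / 2\<close> off \<open>away v\<close>.\<close>

lemma cone_minus_away_subset:
  assumes v: "v \<in> P" and y: "\<And>i. i \<in> I \<Longrightarrow> y i \<in> P" and t: "\<And>i. i \<in> I \<Longrightarrow> 0 \<le> t i"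
    and x: "x = v + (\<Sum>i\<in>I. t i *\<^sub>R (y i - v))" "x \<notin> away v"
  shows "x \<in> P"
  unfolding P_eq
proof (intro CollectI ballI)
  fix h assume h: "h \<in> H"
  have sv: "0 \<le> slack h v" using v h P_eq by auto
  show "0 \<le> slack h x"
  proof (cases "slack h v = 0")
    case True
    have "slack h x = slack h v + (\<Sum>i\<in>I. t i * (slack h (y i) - slack h v))"
      by (simp add: x(1) slack_def inner_add_right inner_sum_right inner_diff_right algebra_simps
        flip: sum_negf)
    also have "\<dots> = (\<Sum>i\<in>I. t i * slack h (y i))" using True by simp
    also have "0 \<le> \<dots>" using y t h P_eq by (intro sum_nonneg mult_nonneg_nonneg) auto
    finally show ?thesis .
  next
    case False
    then have "\<not> slack h x < \<delta> / 2" using sv h x(2) by (auto simp: away_def)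
    then show ?thesis using \<delta>_pos by linarith
  qed
qed

text \<open>Some constraint is tight at a relative interior point \<open>x0\<close> of
  \<open>G\<close> but loose at \<open>v\<close>. Otherwise the segment from \<open>v\<close> to
  \<open>x0\<close> could be prolonged inside \<open>P\<close>, and the face property would put
  \<open>v\<close> into \<open>G\<close>. That constraint is then tight on all of
  \<open>G\<close>.\<close>

lemma face_subset_away:
  assumes G: "G face_of P" and v: "v \<in> P" "v \<notin> G"
  shows "G \<subseteq> away v"
proof (cases "G = {}")
  case False
  have cG: "convex G" by (rule face_of_imp_convex[OF G])
  then obtain x0 where x0: "x0 \<in> rel_interior G" using rel_interior_eq_empty False by blast
  then have x0G: "x0 \<in> G" using rel_interior_subset by blast
  have GP: "G \<subseteq> P" by (rule face_of_imp_subset[OF G])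
  have "\<exists>h\<in>H. slack h x0 = 0 \<and> 0 < slack h v"
  proof (rule ccontr)
    assume "\<not> ?thesis"
    then have no: "slack h v \<le> 0" if "h \<in> H" "slack h x0 = 0" for h using that by force
    \<comment> \<open>Points beyond \<open>x0\<close> on the line from \<open>v\<close>, which
      remain in \<open>P\<close> for small positive \<open>c\<close>.\<close>
    define y where "y c = x0 + c *\<^sub>R (x0 - v)" for c
    have sy: "slack h (y c) = slack h x0 + c * (slack h x0 - slack h v)" for h c
      by (simp add: y_def slack_def inner_add_right inner_diff_right algebra_simps)
    have "\<forall>\<^sub>F c in at_right 0. 0 \<le> slack h (y c)" if h: "h \<in> H" for h
    proof (cases "slack h x0 = 0")
      case True
      show ?thesis
        using eventually_at_right_less[of 0]
        by (rule eventually_mono) (use no[OF h True] in \<open>simp add: sy True mult_le_0_iff\<close>)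
    next
      case False
      then have s: "0 < slack h x0" using x0G GP P_eq h by force
      have "((\<lambda>c. slack h (y c)) \<longlongrightarrow> slack h x0 + 0 * (slack h x0 - slack h v)) (at_right 0)"
        unfolding sy by (intro tendsto_intros)
      then have "\<forall>\<^sub>F c in at_right 0. 0 < slack h (y c)" by (rule order_tendstoD) (simp add: s)
      then show ?thesis by (rule eventually_mono) simp
    qed
    then have "\<forall>\<^sub>F c in at_right 0. 0 < c \<and> (\<forall>h\<in>H. 0 \<le> slack h (y c))"
      by (intro eventually_conj eventually_at_right_less eventually_ball_finite finite_H) blast
    from eventually_happens'[OF trivial_limit_at_right_real this]
    obtain m where m: "0 < m" "\<forall>h\<in>H. 0 \<le> slack h (y m)" by blast
    then have yP: "y m \<in> P" unfolding P_eq by blast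
    have "x0 \<in> open_segment v (y m)"
    proof -
      have "v \<noteq> y m"
      proof
        assume "v = y m"
        then have "(1 + m) *\<^sub>R (x0 - v) = 0" by (simp add: y_def algebra_simps)
        then show False using m(1) v(2) x0G by simp
      qed
      moreover have "x0 = (1 - 1 / (1 + m)) *\<^sub>R v + (1 / (1 + m)) *\<^sub>R y m"
      proof -
        have "(1 / (1 + m)) *\<^sub>R y m = (1 / (1 + m)) *\<^sub>R ((1 + m) *\<^sub>R x0 - m *\<^sub>R v)"
          by (simp add: y_def algebra_simps)
        also have "\<dots> = x0 - (m / (1 + m)) *\<^sub>R v" using m(1) by (simp add: scaleR_diff_right)
        also have "m / (1 + m) = 1 - 1 / (1 + m)" using m(1) by (simp add: field_simps)
        finally show ?thesis by simp
      qed
      ultimately show ?thesis unfolding in_segment using m(1) by (intro conjI exI[of _ "1 / (1 + m)"]) auto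
    qed
    then have "v \<in> G" using face_ofD[OF G _ v(1) yP x0G] by blast
    then show False using v(2) by blast
  qed
  then obtain h where h: "h \<in> H" "slack h x0 = 0" "0 < slack h v" by blast
  let ?F = "P \<inter> {y. fst h \<bullet> y = snd h}"
  have "?F face_of P"
    using h(1) by (intro face_of_Int_supporting_hyperplane_le polytope_imp_convex[OF poly])
      (auto simp: P_eq slack_def)
  moreover have "?F \<inter> rel_interior G \<noteq> {}"
    using h(2) x0 x0G GP by (auto simp: slack_def)
  ultimately have "G \<subseteq> ?F" by (rule subset_of_face_of[OF _ GP])
  then have "slack h y = 0" if "y \<in> G" for y using that by (auto simp: slack_def)
  then show ?thesis using h \<delta>_pos by (auto simp: away_def)
qed simp

text \<open>The cutoff at \<open>v\<close> is a product of steps in the slacks of the constraints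
  loose at \<open>v\<close>. By the margin, at each point of \<open>P\<close> some cutoff equals 1,
  so the product of the complements vanishes and the functions add up to 1.\<close>

lemma partition_of_unity:
  "\<exists>\<omega>. (\<forall>v\<in>{v. v extreme_point_of P}. C_diff k (\<omega> v) \<and> (\<forall>x\<in>away v. \<omega> v x = 0)) \<and>
    (\<forall>x\<in>P. (\<Sum>v\<in>{v. v extreme_point_of P}. \<omega> v x) = 1)"
proof -
  let ?V = "{v. v extreme_point_of P}"
  have fin: "finite ?V" by (rule finite_polyhedron_extreme_points[OF polytope_imp_polyhedron[OF poly]])
  define u where "u v x = (\<Prod>h\<in>{h\<in>H. 0 < slack h v}. plateau k (2 * slack h x / \<delta>))" for v x
  have "C_diff k (\<lambda>x. plateau k (2 * slack h x / \<delta>))" for h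
  proof -
    have "C_diff k (\<lambda>x. (2 * snd h / \<delta>) + (- (2 / \<delta>) *\<^sub>R fst h) \<bullet> x)"
      by (intro C_diff_add C_diff_const C_diff_inner)
    moreover have "(2 * snd h / \<delta>) + (- (2 / \<delta>) *\<^sub>R fst h) \<bullet> x = 2 * slack h x / \<delta>" for x
      by (simp add: slack_def diff_divide_distrib right_diff_distrib)
    ultimately have "C_diff k (\<lambda>x. 2 * slack h x / \<delta>)" by simp
    then show ?thesis by (rule C_diff_compose_real[OF C_diff_plateau])
  qed
  then have "C_diff k (u v)" for v
    unfolding u_def[abs_def] by (rule C_diff_prod)
  then obtain \<omega> where \<omega>: "\<forall>v\<in>?V. C_diff k (\<omega> v) \<and> (\<forall>x. u v x = 0 \<longrightarrow> \<omega> v x = 0)"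
    "\<forall>x. (\<Sum>v\<in>?V. \<omega> v x) = 1 - (\<Prod>v\<in>?V. 1 - u v x)"
    using C_diff_partition[OF fin, of k u] by blast
  have "u v x = 0" if x: "x \<in> away v" for v x
  proof -
    obtain h where h: "h \<in> H" "0 < slack h v" "slack h x < \<delta> / 2"
      using x by (auto simp: away_def)
    then have "plateau k (2 * slack h x / \<delta>) = 0"
      using \<delta>_pos by (intro plateau_eq_0) (simp add: field_simps)
    then show ?thesis unfolding u_def using h finite_H by (intro prod_zero bexI[of _ h]) auto
  qed
  moreover have "(\<Prod>v\<in>?V. 1 - u v x) = 0" if x: "x \<in> P" for x
  proof -
    obtain v where v: "v \<in> ?V" "\<And>h. h \<in> H \<Longrightarrow> 0 < slack h v \<Longrightarrow> \<delta> < slack h x"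
      using margin[OF x] by blast
    have "u v x = 1"
      unfolding u_def
    proof (rule prod.neutral, rule ballI)
      fix h assume "h \<in> {h \<in> H. 0 < slack h v}"
      then have "\<delta> < slack h x" using v(2) by blast
      then show "plateau k (2 * slack h x / \<delta>) = 1"
        using \<delta>_pos by (intro plateau_eq_1) (simp add: field_simps)
    qed
    then show ?thesis using v(1) fin by (intro prod_zero bexI[of _ v]) auto
  qed
  ultimately show ?thesis using \<omega> by (intro exI[of _ \<omega>]) auto
qed

end

text \<open>The margin comes from compactness. The open sets are indexed by a vertex and a number n
  standing for the margin 1/(n+1), and the largest n of a finite subcover serves all points.\<close>

lemma polytope_halfspaces:
  fixes P :: "'a::euclidean_space set"
  assumes P: "polytope P"
  obtains H \<delta> where "halfspace_polytope P H \<delta>"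
proof -
  obtain F where F: "finite F" "P = \<Inter>F" "\<forall>h\<in>F. \<exists>a b. a \<noteq> 0 \<and> h = {x. a \<bullet> x \<le> b}"
    using polytope_imp_polyhedron[OF P] unfolding polyhedron_def by blast
  then obtain a b where ab: "\<And>h. h \<in> F \<Longrightarrow> h = {x. a h \<bullet> x \<le> b h}" by metis
  define H where "H = (\<lambda>h. (a h, b h)) ` F"
  have fin: "finite H" using F(1) by (simp add: H_def)
  have PH: "P = {x. \<forall>h\<in>H. 0 \<le> slack h x}"
  proof -
    have "x \<in> h \<longleftrightarrow> 0 \<le> slack (a h, b h) x" if "h \<in> F" for x h
      using ab[OF that] by (auto simp: slack_def)
    then show ?thesis unfolding F(2) H_def by auto
  qed
  let ?V = "{v. v extreme_point_of P}"
  let ?O = "\<lambda>p. {x. \<forall>h\<in>H. 0 < slack h (fst p) \<longrightarrow> 1 / (real (snd p) + 1) < slack h x}"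
  have opn: "open (?O p)" for p :: "'a \<times> nat"
  proof -
    have "?O p = (\<Inter>h\<in>{h\<in>H. 0 < slack h (fst p)}. {x. 1 / (real (snd p) + 1) < slack h x})"
      by auto
    moreover have "open \<dots>"
      using fin unfolding slack_def
      by (intro open_INT) (auto intro!: open_Collect_less continuous_intros)
    ultimately show ?thesis by simp
  qed
  have cover: "P \<subseteq> (\<Union>p\<in>?V \<times> UNIV. ?O p)"
  proof
    fix x assume x: "x \<in> P"
    \<comment> \<open>The face on which all constraints tight at \<open>x\<close> are tight. At any
      vertex of it they remain tight, so a constraint that is loose at the vertex is loose at
      \<open>x\<close>.\<close>
    let ?G = "P \<inter> {y. \<forall>h\<in>{h\<in>H. slack h x = 0}. slack h y = 0}"
    have G: "?G face_of P"
    proof (cases "{h\<in>H. slack h x = 0} = {}")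
      case True
      then have "?G = P" by auto
      then show ?thesis using polytope_imp_convex[OF P] by (simp add: face_of_refl)
    next
      case False
      have faces: "P \<inter> {y. fst h \<bullet> y = snd h} face_of P" if "h \<in> H" for h
        using that by (intro face_of_Int_supporting_hyperplane_le polytope_imp_convex[OF P])
          (auto simp: PH slack_def)
      have G: "?G = \<Inter> ((\<lambda>h. P \<inter> {y. fst h \<bullet> y = snd h}) ` {h\<in>H. slack h x = 0})"
        using False by (auto simp: slack_def)
      show ?thesis unfolding G using False faces by (intro face_of_Inter) blast+
    qed
    have "x \<in> ?G" using x by auto
    moreover have "compact ?G" "convex ?G"
      using face_of_polytope_polytope[OF P G] polytope_imp_compact polytope_imp_convex by blast+
    ultimately obtain v where "v extreme_point_of ?G" using extreme_point_exists_convex by blast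
    then have v: "v \<in> ?V" "v \<in> ?G" using extreme_point_of_face[OF G] by auto
    have sx: "0 < slack h x" if "h \<in> H" "0 < slack h v" for h
    proof -
      have "slack h x = 0 \<Longrightarrow> slack h v = 0" using that(1) v(2) by blast
      then have "slack h x \<noteq> 0" using that(2) by force
      moreover have "0 \<le> slack h x" using x PH that by auto
      ultimately show ?thesis by simp
    qed
    define m where "m = Min (insert 1 ((\<lambda>h. slack h x) ` {h\<in>H. 0 < slack h v}))"
    have m: "0 < m" "\<And>h. h \<in> H \<Longrightarrow> 0 < slack h v \<Longrightarrow> m \<le> slack h x"
      unfolding m_def using fin sx by auto
    obtain n where "1 / (real n + 1) < m" using reals_Archimedean[OF m(1)] by (auto simp: inverse_eq_divide add.commute)
    then have "x \<in> ?O (v, n)" using m(2) by force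
    then show "x \<in> (\<Union>p\<in>?V \<times> UNIV. ?O p)" using v(1) by blast
  qed
  obtain D where D: "D \<subseteq> ?V \<times> UNIV" "finite D" "P \<subseteq> (\<Union>p\<in>D. ?O p)"
    using compactE_image[OF polytope_imp_compact[OF P], of "?V \<times> UNIV" ?O] opn cover by blast
  define n where "n = Max (insert 0 (snd ` D))"
  have n: "snd p \<le> n" if "p \<in> D" for p unfolding n_def using D(2) that by (intro Max_ge) auto
  have "halfspace_polytope P H (1 / (real n + 1))"
  proof
    fix x assume "x \<in> P"
    then obtain p where p: "p \<in> D" "x \<in> ?O p" using D(3) by blast
    have "1 / (real n + 1) \<le> 1 / (real (snd p) + 1)"
      using n[OF p(1)] by (intro divide_left_mono) auto
    then show "\<exists>v. v extreme_point_of P \<and> (\<forall>h\<in>H. 0 < slack h v \<longrightarrow> 1 / (real n + 1) < slack h x)"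
      using p D(1) by (intro exI[of _ "fst p"]) force
  qed (use fin P PH in auto)
  then show thesis by (rule that)
qed

section \<open>The expansion on a polytope\<close>

definition lattice_sum :: "(real^'n) set \<Rightarrow> (real^'n \<Rightarrow> real) \<Rightarrow> nat \<Rightarrow> real" where
  "lattice_sum P G N = (1 / real N) ^ CARD('n) * (\<Sum>\<gamma>\<in>(\<lambda>x. real N *\<^sub>R x) ` P \<inter> int_lattice. G (\<gamma> /\<^sub>R real N))"

locale vertex_chart = simple_vertex P v e \<alpha> \<epsilon> + halfspace_polytope P H \<delta>
  for P :: "(real^'n) set" and v e \<alpha> \<epsilon> H \<delta> +
  assumes v_lattice: "v \<in> int_lattice"
begin

definition chart :: "real^'n \<Rightarrow> real^'n" where
  "chart x = v + (frame_map e x)"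

definition chart_away :: "(real^'n) set" where
  "chart_away = {x. chart x \<in> away v}"

text \<open>A closed term is required as the parameter of the sublocale
  \<open>orthant_support\<close>; any bound on the frame coordinates of \<open>P\<close> will
  do.\<close>

definition chart_bound :: nat where
  "chart_bound = (SOME R. 0 < R \<and> (\<forall>x\<in>P. \<forall>i. \<alpha> i \<bullet> (x - v) < real R))"

lemma bounded_linear_chart: "bounded_linear (frame_map e)"
  using linear_frame[of e] by (simp add: linear_linear)

lemma continuous_chart: "continuous_on UNIV chart"
  unfolding chart_def[abs_def]
  by (intro continuous_on_add continuous_on_const linear_continuous_on bounded_linear_chart)

lemma inner_chart: "\<alpha> i \<bullet> (chart x - v) = x $ i"
  by (simp add: chart_def frame_inner_sum[OF frame])

lemma chart_inner: "chart (\<chi> i. \<alpha> i \<bullet> (x - v)) = x"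
  by (simp add: chart_def frame_expand[OF frame])

lemma chart_coord_embed: "chart (\<Sum>k\<in>- J. c k *\<^sub>R axis k 1) = slice v e J c"
proof -
  have "(\<Sum>i\<in>UNIV. (\<Sum>k\<in>- J. c k *\<^sub>R axis k 1) $ i *\<^sub>R e i) = (\<Sum>i\<in>UNIV. if i \<in> - J then c i *\<^sub>R e i else 0)"
    by (intro sum.cong) (auto simp: axis_def if_distrib cong: if_cong)
  also have "\<dots> = (\<Sum>k\<in>- J. c k *\<^sub>R e k)" by (simp add: sum.If_cases Compl_eq)
  finally show ?thesis by (simp add: chart_def)
qed

text \<open>The cone lemma applied to the edge points, with weights
  \<open>x $ i / \<epsilon>\<close>.\<close>

lemma chart_in_P:
  assumes "x \<in> orthant" "x \<notin> chart_away" shows "chart x \<in> P"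
proof (rule cone_minus_away_subset[of v UNIV "\<lambda>i. v + \<epsilon> *\<^sub>R e i" "\<lambda>i. x $ i / \<epsilon>"])
  show "chart x = v + (\<Sum>i\<in>UNIV. (x $ i / \<epsilon>) *\<^sub>R (v + \<epsilon> *\<^sub>R e i - v))"
    using \<epsilon>_pos by (simp add: chart_def)
qed (use assms \<epsilon>_pos v_in_P edge_point in \<open>auto simp: orthant_def chart_away_def\<close>)

lemma chart_bound: "0 < chart_bound" "x \<in> P \<Longrightarrow> \<alpha> i \<bullet> (x - v) < real chart_bound"
proof -
  obtain B where B: "\<And>x. x \<in> P \<Longrightarrow> norm x \<le> B"
    using polytope_imp_bounded[OF polytope_P] by (auto simp: bounded_iff)
  define R where "R = Suc (nat \<lceil>(\<Sum>i\<in>UNIV. norm (\<alpha> i)) * (B + norm v)\<rceil>)"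
  have "\<alpha> i \<bullet> (x - v) < real R" if x: "x \<in> P" for x i
  proof -
    have "\<alpha> i \<bullet> (x - v) \<le> norm (\<alpha> i) * norm (x - v)" by (rule norm_cauchy_schwarz)
    also have "\<dots> \<le> (\<Sum>i\<in>UNIV. norm (\<alpha> i)) * (B + norm v)"
    proof (intro mult_mono)
      show "norm (x - v) \<le> B + norm v" using norm_triangle_ineq4[of x v] B[OF x] by linarith
    qed (auto intro: member_le_sum sum_nonneg)
    also have "\<dots> < real R" unfolding R_def by linarith
    finally show ?thesis .
  qed
  then have "0 < R \<and> (\<forall>x\<in>P. \<forall>i. \<alpha> i \<bullet> (x - v) < real R)" by (simp add: R_def)
  then have *: "0 < chart_bound \<and> (\<forall>x\<in>P. \<forall>i. \<alpha> i \<bullet> (x - v) < real chart_bound)"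
    unfolding chart_bound_def by (rule someI)
  then show "0 < chart_bound" "x \<in> P \<Longrightarrow> \<alpha> i \<bullet> (x - v) < real chart_bound" by auto
qed

sublocale orthant_support chart_away chart_bound
proof
  show "open chart_away"
    using open_vimage[OF open_away continuous_chart, of v] by (simp add: chart_away_def vimage_def)
  show "x $ i < real chart_bound" if "x \<in> orthant" "x \<notin> chart_away" for x i
    using chart_bound(2)[OF chart_in_P[OF that], of i] by (simp add: inner_chart)
qed (rule chart_bound)

definition local_fun :: "nat \<Rightarrow> (real^'n \<Rightarrow> real) \<Rightarrow> bool" where
  "local_fun k G \<longleftrightarrow> C_diff k G \<and> (\<forall>x\<in>away v. G x = 0)"

lemma test_chart:
  assumes "local_fun k G" shows "test k (\<lambda>x. G (chart x))"
proof -
  have "C_diff k (\<lambda>x. G (chart x))"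
    unfolding chart_def using assms
    by (intro C_diff_compose_affine bounded_linear_chart) (simp add: local_fun_def)
  then show ?thesis using assms unfolding test_def local_fun_def by (simp add: chart_away_def)
qed

lemma local_fun_Dv: "local_fun (Suc k) G \<Longrightarrow> local_fun k (Dv w G)"
  unfolding local_fun_def using C_diff_Dv Dv_eq_0[OF open_away] by metis

lemma local_fun_measurable: "local_fun k G \<Longrightarrow> G \<in> borel_measurable borel"
  unfolding local_fun_def by (intro borel_measurable_continuous_onI C_diff_continuous) auto

lemma Dv_chart:
  assumes "local_fun (Suc k) G"
  shows "Dv (axis i 1) (\<lambda>x. G (chart x)) x = Dv (e i) G (chart x)"
proof -
  have "G differentiable at (v + (frame_map e x))"
    using assms unfolding local_fun_def by simp
  from Dv_compose_affine[OF bounded_linear_chart this, of "axis i 1"]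
  show ?thesis by (simp add: chart_def axis_def if_distrib[of "\<lambda>c. c *\<^sub>R _"] cong: if_cong)
qed

text \<open>Since \<open>v\<close>, \<open>e\<close> and \<open>\<alpha>\<close> are integral, the
  scaled chart carries natural coordinates to lattice points and pairing with
  \<open>\<alpha>\<close> inverts it. On the scaled polytope these pairings are nonnegative
  integers, so \<open>nat\<close> and the floor lose nothing.\<close>

lemma lattice_points_bij:
  assumes N: "0 < N"
  shows "(\<Sum>g\<in>{g\<in>grid N. chart (grid_point N g) \<in> P}. G (chart (grid_point N g)))
    = (\<Sum>\<gamma>\<in>(\<lambda>x. real N *\<^sub>R x) ` P \<inter> int_lattice. G (\<gamma> /\<^sub>R real N))"
proof (rule sum.reindex_bij_witness[of _ "\<lambda>\<gamma> i. nat \<lfloor>\<alpha> i \<bullet> (\<gamma> - real N *\<^sub>R v)\<rfloor>" "\<lambda>g. real N *\<^sub>R chart (grid_point N g)"])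
  have eL: "e k \<in> int_lattice" "\<alpha> k \<in> int_lattice" for k
    using frame by (auto simp: lattice_frame_def)
  fix g assume g: "g \<in> {g\<in>grid N. chart (grid_point N g) \<in> P}"
  have Nc: "real N *\<^sub>R chart (grid_point N g) = real N *\<^sub>R v + (\<Sum>i\<in>UNIV. real (g i) *\<^sub>R e i)"
    using N by (simp add: chart_def grid_point_def scaleR_right_distrib scaleR_sum_right)
  show "(\<lambda>i. nat \<lfloor>\<alpha> i \<bullet> (real N *\<^sub>R chart (grid_point N g) - real N *\<^sub>R v)\<rfloor>) = g"
    unfolding Nc by (simp add: frame_inner_sum[OF frame])
  show "real N *\<^sub>R chart (grid_point N g) \<in> (\<lambda>x. real N *\<^sub>R x) ` P \<inter> int_lattice"
  proof
    show "real N *\<^sub>R chart (grid_point N g) \<in> int_lattice"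
      unfolding Nc by (intro int_lattice_add int_lattice_sum int_lattice_scaleR eL v_lattice) auto
  qed (use g in auto)
  show "G (real N *\<^sub>R chart (grid_point N g) /\<^sub>R real N) = G (chart (grid_point N g))" using N by simp
next
  have eL: "e k \<in> int_lattice" "\<alpha> k \<in> int_lattice" for k
    using frame by (auto simp: lattice_frame_def)
  fix \<gamma> assume "\<gamma> \<in> (\<lambda>x. real N *\<^sub>R x) ` P \<inter> int_lattice"
  then obtain x where x: "x \<in> P" "\<gamma> = real N *\<^sub>R x" and L: "\<gamma> \<in> int_lattice" by blast
  have \<gamma>: "\<alpha> i \<bullet> (\<gamma> - real N *\<^sub>R v) = real N * (\<alpha> i \<bullet> (x - v))" for i
    by (simp add: x(2) inner_diff_right algebra_simps)
  have I: "\<alpha> i \<bullet> (\<gamma> - real N *\<^sub>R v) \<in> \<int>" for i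
    by (intro Ints_inner_lattice eL int_lattice_diff L int_lattice_scaleR v_lattice) auto
  have nn: "0 \<le> \<alpha> i \<bullet> (\<gamma> - real N *\<^sub>R v)" for i
    unfolding \<gamma> using inner_nonneg[OF x(1)] by simp
  let ?g = "\<lambda>i. nat \<lfloor>\<alpha> i \<bullet> (\<gamma> - real N *\<^sub>R v)\<rfloor>"
  have rg: "real (?g i) = real N * (\<alpha> i \<bullet> (x - v))" for i
    using I[of i] nn[of i] by (simp add: \<gamma>)
  have "grid_point N ?g = (\<chi> i. \<alpha> i \<bullet> (x - v))"
    using N unfolding grid_point_def rg by simp
  then have c: "chart (grid_point N ?g) = x" by (simp add: chart_inner)
  show "real N *\<^sub>R chart (grid_point N ?g) = \<gamma>" by (subst c) (rule x(2)[symmetric])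
  have "real (?g i) < real (N * chart_bound)" for i
    unfolding rg using N chart_bound(2)[OF x(1), of i] by simp
  then have "?g \<in> grid N" unfolding grid_def by (simp add: PiE_UNIV_domain del: of_nat_mult)
  then show "?g \<in> {g\<in>grid N. chart (grid_point N g) \<in> P}" using c x(1) by simp
qed

text \<open>Grid points mapped outside \<open>P\<close> fall into \<open>away v\<close>, where
  \<open>G\<close> vanishes.\<close>

lemma grid_sum_chart:
  assumes G: "local_fun k G" and N: "0 < N"
  shows "grid_sum N (\<lambda>x. G (chart x)) =
    lattice_sum P G N"
proof -
  have "G (chart (grid_point N g)) = 0" if "chart (grid_point N g) \<notin> P" for g
  proof -
    have "grid_point N g \<in> orthant" by (simp add: orthant_def grid_point_def)
    then have "chart (grid_point N g) \<in> away v" using chart_in_P that by (auto simp: chart_away_def)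
    then show ?thesis using G by (simp add: local_fun_def)
  qed
  then have "(\<Sum>g\<in>grid N. G (chart (grid_point N g)))
      = (\<Sum>g\<in>{g\<in>grid N. chart (grid_point N g) \<in> P}. G (chart (grid_point N g)))"
    using finite_grid by (intro sum.mono_neutral_right) auto
  then show ?thesis unfolding grid_sum_def lattice_sum_def lattice_points_bij[OF N] by simp
qed

text \<open>The two indicators may differ only at points of \<open>away v\<close>, and there
  \<open>F\<close> is 0.\<close>

lemma indicator_chart:
  assumes "local_fun k F"
  shows "indicator orthant (coord_embed J c) * F (chart (coord_embed J c))
    = indicator (coordinate_face J) (slice v e J c) * F (slice v e J c)"
proof -
  let ?x = "coord_embed J c"
  have x: "chart ?x = slice v e J c"
    unfolding coord_embed_def chart_coord_embed ..
  have "?x \<in> orthant \<longleftrightarrow> chart ?x \<in> coordinate_face J" if "F (chart ?x) \<noteq> 0"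
  proof
    have "?x \<notin> chart_away" using that assms by (auto simp: local_fun_def chart_away_def)
    then show "?x \<in> orthant \<Longrightarrow> chart ?x \<in> coordinate_face J"
      using chart_in_P by (simp add: coordinate_face_def inner_chart coord_embed_nth)
    assume "chart ?x \<in> coordinate_face J"
    then show "?x \<in> orthant"
      using inner_nonneg[of "chart ?x"] by (simp add: coordinate_face_def orthant_def inner_chart)
  qed
  then show ?thesis unfolding x[symmetric] by (auto simp: indicator_def)
qed

lemma face_part_chart:
  assumes "local_fun k F"
  shows "face_part J (\<lambda>x. F (chart x)) = face_integral (coordinate_face J) F"
  unfolding face_part_def indicator_chart[OF assms]
  by (rule face_integral_coordinate_face[OF local_fun_measurable[OF assms], symmetric])

lemma integrable_coordinate_face:
  assumes "local_fun k F"
  shows "set_integrable (lattice_measure (coordinate_face J)) (coordinate_face J) F"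
proof -
  note [measurable] = borel_coordinate_face local_fun_measurable[OF assms]
  have "v \<in> affine hull coordinate_face J" by (intro hull_inc v_in_coordinate_face)
  note lm = lattice_measure_frame[OF frame parallel_subspace_coordinate_face this]
  have "integrable (lborel_PiM (- J)) (\<lambda>c. indicator orthant (coord_embed J c) * F (chart (coord_embed J c)))"
    by (rule integrable_face_part[OF test_chart[OF assms]])
  then have "integrable (lborel_PiM (- J)) (\<lambda>c. indicator (coordinate_face J) (slice v e J c) * F (slice v e J c))"
    unfolding indicator_chart[OF assms] .
  then show ?thesis
    unfolding set_integrable_def lm by (subst integrable_distr_eq) auto
qed

text \<open>The vector \<open>e i - \<alpha> i / (\<alpha> i \<bullet> \<alpha> i)\<close> is tangent to the facet, and the integral of a
  tangential derivative reduces to the ridges.\<close>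

lemma face_part_transversal:
  assumes G: "local_fun 2 G"
  shows "face_part {i} (Dv (axis i 1) (\<lambda>x. G (chart x)))
    = 1 / (\<alpha> i \<bullet> \<alpha> i) * face_integral (coordinate_face {i}) (Dv (\<alpha> i) G)
      + (\<Sum>j\<in>- {i}. (\<alpha> i \<bullet> \<alpha> j) / (\<alpha> i \<bullet> \<alpha> i) * face_integral (coordinate_face {i, j}) G)"
proof -
  have G2: "local_fun (Suc 1) G" using G by (simp add: numeral_2_eq_2)
  have G1: "local_fun 1 (Dv w G)" for w by (rule local_fun_Dv[OF G2])
  have d: "G differentiable at x" for x using G2 unfolding local_fun_def by simp
  let ?q = "\<alpha> i \<bullet> \<alpha> i"
  have q: "?q \<noteq> 0" using inner_e[of i i] by auto
  have "e i - (1 / ?q) *\<^sub>R \<alpha> i = (\<Sum>j\<in>UNIV. (\<alpha> j \<bullet> (e i - (1 / ?q) *\<^sub>R \<alpha> i)) *\<^sub>R e j)"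
    by (rule frame_expand[OF frame, symmetric])
  \<comment> \<open>The coefficient at \<open>i\<close> is 1 - 1 = 0, which is the tangency.\<close>
  also have "\<dots> = (\<Sum>j\<in>- {i}. (\<alpha> j \<bullet> (e i - (1 / ?q) *\<^sub>R \<alpha> i)) *\<^sub>R e j)"
    using q by (intro sum.mono_neutral_right) (auto simp: inner_diff_right inner_e)
  also have "\<dots> = (\<Sum>j\<in>- {i}. (- ((\<alpha> i \<bullet> \<alpha> j) / ?q)) *\<^sub>R e j)"
    by (intro sum.cong) (auto simp: inner_diff_right inner_e inner_commute)
  finally have ei: "e i = (1 / ?q) *\<^sub>R \<alpha> i + (\<Sum>j\<in>- {i}. (- ((\<alpha> i \<bullet> \<alpha> j) / ?q)) *\<^sub>R e j)"
    by (simp add: algebra_simps)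
  have De: "Dv (e i) G y = (1 / ?q) * Dv (\<alpha> i) G y + (\<Sum>j\<in>- {i}. (- ((\<alpha> i \<bullet> \<alpha> j) / ?q)) * Dv (e j) G y)" for y
    by (subst ei) (simp only: Dv_add_dir[OF d] Dv_scaleR_dir[OF d] Dv_sum_dir[OF d])
  have int: "integrable (lborel_PiM (- {i})) (\<lambda>c. indicator orthant (coord_embed {i} c) * Dv w G (chart (coord_embed {i} c)))" for w
    by (rule integrable_face_part[OF test_chart[OF G1]])
  have eq: "(\<lambda>x. Dv (axis i 1) (\<lambda>x. G (chart x)) x) = (\<lambda>x. Dv (e i) G (chart x))" for i
    using Dv_chart[OF G2] by blast
  have "face_part {i} (Dv (axis i 1) (\<lambda>x. G (chart x))) = (\<integral>c. (1 / ?q) *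
      (indicator orthant (coord_embed {i} c) * Dv (\<alpha> i) G (chart (coord_embed {i} c)))
      + (\<Sum>j\<in>- {i}. (- ((\<alpha> i \<bullet> \<alpha> j) / ?q)) * (indicator orthant (coord_embed {i} c)
        * Dv (e j) G (chart (coord_embed {i} c)))) \<partial>lborel_PiM (- {i}))"
    unfolding face_part_def eq De
    by (intro Bochner_Integration.integral_cong refl) (simp add: distrib_left sum_distrib_left mult_ac)
  also have "\<dots> = (1 / ?q) * face_part {i} (\<lambda>x. Dv (\<alpha> i) G (chart x))
      + (\<Sum>j\<in>- {i}. (- ((\<alpha> i \<bullet> \<alpha> j) / ?q)) * face_part {i} (\<lambda>x. Dv (e j) G (chart x)))"
    unfolding face_part_def
    by (subst Bochner_Integration.integral_add Bochner_Integration.integral_sum integral_mult_right_zero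
        | intro Bochner_Integration.integrable_sum integrable_mult_right int)+
      (simp only: integral_mult_right_zero)
  also have "(\<Sum>j\<in>- {i}. (- ((\<alpha> i \<bullet> \<alpha> j) / ?q)) * face_part {i} (\<lambda>x. Dv (e j) G (chart x)))
    = (\<Sum>j\<in>- {i}. (\<alpha> i \<bullet> \<alpha> j) / ?q * face_integral (coordinate_face {i, j}) G)"
  proof (intro sum.cong refl)
    fix j assume j: "j \<in> - {i}"
    have "face_part {i} (\<lambda>x. Dv (e j) G (chart x)) = - face_part (insert j {i}) (\<lambda>x. G (chart x))"
      unfolding eq[symmetric] by (rule face_part_Dv[OF test_chart[OF G2]]) (use j in auto)
    then show "(- ((\<alpha> i \<bullet> \<alpha> j) / ?q)) * face_part {i} (\<lambda>x. Dv (e j) G (chart x))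
      = (\<alpha> i \<bullet> \<alpha> j) / ?q * face_integral (coordinate_face {i, j}) G"
      by (simp add: face_part_chart[OF G] insert_commute)
  qed
  finally show ?thesis unfolding face_part_chart[OF G1] .
qed

end

text \<open>The transversal correction divides by the norm of one normal only, so its summand
  depends on the order of the pair. Adding the two orders produces a function of the ridge.\<close>

lemma sum_ordered_pairs:
  fixes h :: "'i::finite \<Rightarrow> 'i \<Rightarrow> real"
  assumes "\<And>i j. i \<noteq> j \<Longrightarrow> h i j + h j i = K {i, j}"
  shows "(\<Sum>i\<in>UNIV. \<Sum>j\<in>- {i}. h i j) = (\<Sum>J\<in>{J. card J = 2}. K J)"
proof -
  let ?S = "SIGMA i:(UNIV :: 'i set). - {i}" and ?f = "\<lambda>(i, j). {i, j}"
  have "(\<Sum>i\<in>UNIV. \<Sum>j\<in>- {i}. h i j) = (\<Sum>(i, j)\<in>?S. h i j)"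
    by (simp add: sum.Sigma)
  also have "\<dots> = (\<Sum>J\<in>?f ` ?S. \<Sum>(i, j)\<in>{p\<in>?S. ?f p = J}. h i j)"
    by (rule sum.image_gen) simp
  also have "?f ` ?S = {J. card J = 2}"
    by (force simp: card_2_iff)
  also have "(\<Sum>J\<in>{J. card J = 2}. \<Sum>(i, j)\<in>{p\<in>?S. ?f p = J}. h i j) = (\<Sum>J\<in>{J. card J = 2}. K J)"
  proof (intro sum.cong refl)
    fix J :: "'i set" assume "J \<in> {J. card J = 2}"
    then obtain a b where J: "J = {a, b}" "a \<noteq> b" by (auto simp: card_2_iff)
    then have "{p\<in>?S. ?f p = J} = {(a, b), (b, a)}" by (auto simp: doubleton_eq_iff)
    then show "(\<Sum>(i, j)\<in>{p\<in>?S. ?f p = J}. h i j) = K J" using J assms[of a b] by simp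
  qed
  finally show ?thesis .
qed

abbreviation facet_term :: "(real^'n) set \<Rightarrow> (real^'n \<Rightarrow> real) \<Rightarrow> (real^'n) set \<Rightarrow> real" where
  "facet_term P G g \<equiv> 1 / (inward_primitive_normal P g \<bullet> inward_primitive_normal P g)
          * face_integral g (Dv (inward_primitive_normal P g) G)"

context vertex_chart
begin

lemma coeff_2_local:
  assumes G: "local_fun 2 G"
  shows "coeff 2 (\<lambda>x. G (chart x)) =
    - (1/12) * (\<Sum>g\<in>{g \<in> faces_of_dim P (int CARD('n) - 1). v \<in> g}. facet_term P G g)
    + (\<Sum>g\<in>{g \<in> faces_of_dim P (int CARD('n) - 2). v \<in> g}. ridge_coeff P g * face_integral g G)"
proof -
  let ?I = "\<lambda>J. face_integral (coordinate_face J)"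
  let ?r = "\<lambda>i j. (\<alpha> i \<bullet> \<alpha> j) / (\<alpha> i \<bullet> \<alpha> i)"
  have inj: "inj_on coordinate_face A" for A by (simp add: inj_on_def coordinate_face_inject)
  have facets: "{g \<in> faces_of_dim P (int CARD('n) - 1). v \<in> g} = (\<lambda>i. coordinate_face {i}) ` UNIV"
    using faces_of_dim_coordinate[of 1] by (auto simp: card_1_singleton_iff)
  have "(\<Sum>g\<in>{g \<in> faces_of_dim P (int CARD('n) - 1). v \<in> g}. facet_term P G g)
    = (\<Sum>i\<in>UNIV. 1 / (\<alpha> i \<bullet> \<alpha> i) * ?I {i} (Dv (\<alpha> i) G))"
    unfolding facets
    by (subst sum.reindex) (auto simp: inj_on_def coordinate_face_inject normal_coordinate_face)
  moreover have "(\<Sum>g\<in>{g \<in> faces_of_dim P (int CARD('n) - 2). v \<in> g}. ridge_coeff P g * face_integral g G)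
    = (\<Sum>i\<in>UNIV. \<Sum>j\<in>- {i}. (1/8 - 1/12 * ?r i j) * ?I {i, j} G)"
  proof -
    have "(\<Sum>i\<in>UNIV. \<Sum>j\<in>- {i}. (1/8 - 1/12 * ?r i j) * ?I {i, j} G)
      = (\<Sum>J\<in>{J. card J = 2}. ridge_coeff P (coordinate_face J) * ?I J G)"
    proof (rule sum_ordered_pairs)
      fix i j :: 'n assume "i \<noteq> j"
      \<comment> \<open>The two copies of 1/8 make the 1/4 of \<open>ridge_coeff\<close>, and the
        two ratios are its symmetric sum.\<close>
      then show "(1/8 - 1/12 * ?r i j) * ?I {i, j} G + (1/8 - 1/12 * ?r j i) * ?I {j, i} G
        = ridge_coeff P (coordinate_face {i, j}) * ?I {i, j} G"
        by (simp add: ridge_coeff_coordinate_face insert_commute[of j i] inner_commute[of "\<alpha> j" "\<alpha> i"] algebra_simps)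
    qed
    also have "\<dots> = (\<Sum>g\<in>{g \<in> faces_of_dim P (int CARD('n) - 2). v \<in> g}. ridge_coeff P g * face_integral g G)"
      using faces_of_dim_coordinate[of 2] by (simp add: sum.reindex[OF inj])
    finally show ?thesis ..
  qed
  moreover have "coeff 2 (\<lambda>x. G (chart x)) = - (1/12) * (\<Sum>i\<in>UNIV. 1 / (\<alpha> i \<bullet> \<alpha> i) * ?I {i} (Dv (\<alpha> i) G))
      + (\<Sum>i\<in>UNIV. \<Sum>j\<in>- {i}. (1/8 - 1/12 * ?r i j) * ?I {i, j} G)"
  proof -
    have swap: "(\<Sum>j\<in>UNIV. \<Sum>i\<in>- {j}. ?I {i, j} G) = (\<Sum>j\<in>UNIV. \<Sum>i\<in>- {j}. ?I {j, i} G)"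
      by (simp add: insert_commute)
    have split: "(\<Sum>i\<in>UNIV. \<Sum>j\<in>- {i}. (1/8 - 1/12 * ?r i j) * ?I {i, j} G)
      = 1/8 * (\<Sum>i\<in>UNIV. \<Sum>j\<in>- {i}. ?I {i, j} G) - 1/12 * (\<Sum>i\<in>UNIV. \<Sum>j\<in>- {i}. ?r i j * ?I {i, j} G)"
      by (simp only: left_diff_distrib sum_subtractf sum_distrib_left mult.assoc)
    have arith: "- (1/12) * (a + b) + 1/8 * c = - (1/12) * a + (1/8 * c - 1/12 * b)" for a b c :: real
      by (simp add: algebra_simps)
    show ?thesis
      unfolding coeff_2_faces[OF test_chart[OF G]] face_part_transversal[OF G] face_part_chart[OF G]
        sum.distrib swap split
      by (rule arith)
  qed
  ultimately show ?thesis by simp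
qed

lemma local_expansion:
  assumes G: "local_fun M G"
  shows "\<exists>C. \<forall>N>0. \<bar>lattice_sum P G N
    - (\<Sum>n<M. coeff n (\<lambda>x. G (chart x)) * (1 / real N) ^ n)\<bar> \<le> C * (1 / real N) ^ M"
  using orthant_expansion[OF test_chart[OF G]] grid_sum_chart[OF G] by simp

end

section \<open>Derivatives within a convex set with interior\<close>

lemma derivative_within_convex_unique:
  fixes f :: "'a::euclidean_space \<Rightarrow> real"
  assumes S: "convex S" "interior S \<noteq> {}" "x \<in> S"
    and D: "(f has_derivative D) (at x within S)" "(f has_derivative D') (at x within S)"
  shows "D = D'"
proof -
  \<comment> \<open>At a boundary point only directions into \<open>S\<close> are visible, and
    restriction to a segment determines the derivative there.\<close>
  have seg: "D (y - x) = D' (y - x)" if y: "y \<in> S" for y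
  proof -
    let ?p = "\<lambda>t::real. x + t *\<^sub>R (y - x)"
    have p: "?p t \<in> S" if "t \<in> {0..1}" for t
      using convex_ray_point[OF S(1,3), of 1 "y - x" t] y that by simp
    have p': "(?p has_derivative (\<lambda>t. t *\<^sub>R (y - x))) (at 0 within {0..1})"
      by (auto intro!: derivative_eq_intros)
    have "(f has_derivative E) (at (?p 0) within ?p ` {0..1})" if "(f has_derivative E) (at x within S)" for E
    proof -
      have "?p ` {0..1} \<subseteq> S" using p by blast
      from has_derivative_subset[OF that this] show ?thesis by simp
    qed
    from has_derivative_in_compose[OF p' this[OF D(1)]] has_derivative_in_compose[OF p' this[OF D(2)]]
    have "(\<lambda>t. D (t *\<^sub>R (y - x))) = (\<lambda>t. D' (t *\<^sub>R (y - x)))"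
    proof (rule frechet_derivative_unique_within)
      fix i r :: real assume "i \<in> Basis" "0 < r"
      then show "\<exists>d. 0 < \<bar>d\<bar> \<and> \<bar>d\<bar> < r \<and> 0 + d *\<^sub>R i \<in> {0..1}"
        by (intro exI[of _ "min (r / 2) 1"]) (auto simp: min_def)
    qed
    from fun_cong[OF this, of 1] show ?thesis by simp
  qed
  obtain c where c: "c \<in> interior S" using S(2) by blast
  show ?thesis
  proof
    fix w :: 'a
    have "((\<lambda>s. c + s *\<^sub>R w) \<longlongrightarrow> c + 0 *\<^sub>R w) (at_right 0)" by (intro tendsto_intros)
    then have "\<forall>\<^sub>F s in at_right 0. c + s *\<^sub>R w \<in> interior S"
      by (rule topological_tendstoD) (use c in auto)
    from eventually_happens'[OF trivial_limit_at_right_real eventually_conj[OF eventually_at_right_less[of 0] this]]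
    obtain s :: real where s: "0 < s" "c + s *\<^sub>R w \<in> interior S" by blast
    then have "c + s *\<^sub>R w \<in> S" "c \<in> S" using c interior_subset by blast+
    \<comment> \<open>An arbitrary direction is a multiple of the difference of two points of
      \<open>S\<close> near the interior point \<open>c\<close>.\<close>
    then have eq: "D (c + s *\<^sub>R w - x) - D (c - x) = D' (c + s *\<^sub>R w - x) - D' (c - x)"
      using seg by simp
    have "E (c + s *\<^sub>R w - x) - E (c - x) = s * E w" if "linear E" for E :: "'a \<Rightarrow> real"
      using that by (simp add: linear_diff[symmetric] linear_scale[OF that])
    then show "D w = D' w"
      using eq s D[THEN has_derivative_linear] by simp
  qed
qed

lemma dir_deriv_eq_Dv:
  fixes f :: "'a::euclidean_space \<Rightarrow> real"
  assumes S: "convex S" "interior S \<noteq> {}" "x \<in> S" and F: "F differentiable at x"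
    and eq: "\<And>y. y \<in> S \<Longrightarrow> f y = F y"
  shows "dir_deriv S w f x = Dv w F x"
proof -
  have "(F has_derivative (\<lambda>v. Dv v F x)) (at x within S)"
    by (rule has_derivative_at_withinI[OF has_derivative_Dv[OF F]])
  then have f: "(f has_derivative (\<lambda>v. Dv v F x)) (at x within S)"
    using S(3) eq by (intro has_derivative_transform[where f = F and g = f]) auto
  then have "(f has_derivative frechet_derivative f (at x within S)) (at x within S)"
    unfolding frechet_derivative_works[symmetric] differentiable_def by blast
  from derivative_within_convex_unique[OF S this f] show ?thesis
    by (simp add: dir_deriv_def)
qed

section \<open>Truncated asymptotic expansions and their uniqueness\<close>

definition expansion_upto :: "(nat \<Rightarrow> real) \<Rightarrow> (nat \<Rightarrow> real) \<Rightarrow> nat \<Rightarrow> bool" where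
  "expansion_upto R a M \<longleftrightarrow>
    (\<lambda>N. R N - (\<Sum>n<M. a n * real N powi (- int n))) \<in> O(\<lambda>N. real N powi (- int M))"

lemma powi_Suc_bigo: "(\<lambda>N. real N powi (- int (Suc M))) \<in> O(\<lambda>N. real N powi (- int M))"
proof (rule bigoI[of _ 1])
  show "\<forall>\<^sub>F N in sequentially. norm (real N powi (- int (Suc M))) \<le> 1 * norm (real N powi (- int M))"
  proof (rule eventually_sequentiallyI[of 1])
    fix N :: nat assume "1 \<le> N"
    then show "norm (real N powi (- int (Suc M))) \<le> 1 * norm (real N powi (- int M))"
      using power_int_increasing[of "- int (Suc M)" "- int M" "real N"] by (simp add: abs_of_nonneg del: of_nat_Suc)
  qed
qed

lemma expansion_upto_SucD:
  assumes "expansion_upto R a (Suc M)" shows "expansion_upto R a M"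
proof -
  have "(\<lambda>N. R N - (\<Sum>n<Suc M. a n * real N powi (- int n))) \<in> O(\<lambda>N. real N powi (- int M))"
    using assms powi_Suc_bigo unfolding expansion_upto_def by (rule landau_o.big_trans)
  moreover have "(\<lambda>N. a M * real N powi (- int M)) \<in> O(\<lambda>N. real N powi (- int M))"
    by (rule bigoI[of _ "\<bar>a M\<bar>"]) (simp add: abs_mult)
  ultimately have "(\<lambda>N. (R N - (\<Sum>n<Suc M. a n * real N powi (- int n))) + a M * real N powi (- int M))
      \<in> O(\<lambda>N. real N powi (- int M))"
    by (rule sum_in_bigo)
  then show ?thesis by (simp add: expansion_upto_def)
qed

lemma expansion_upto_mono: "expansion_upto R a M \<Longrightarrow> M' \<le> M \<Longrightarrow> expansion_upto R a M'"
  by (induction M rule: nat.induct) (auto simp: le_Suc_eq dest: expansion_upto_SucD)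

text \<open>Once the lower coefficients agree, the difference of the two truncations is a single
  term of order N^(-M) that is also O(N^(-M-1)). Its coefficient is then bounded by a multiple of
  1/N and vanishes.\<close>

lemma expansion_upto_unique:
  "expansion_upto R a M \<Longrightarrow> expansion_upto R b M \<Longrightarrow> n < M \<Longrightarrow> a n = b n"
proof (induction M arbitrary: n)
  case (Suc M)
  have IH: "a k = b k" if "k < M" for k
    using Suc.IH[OF expansion_upto_SucD[OF Suc.prems(1)] expansion_upto_SucD[OF Suc.prems(2)] that] .
  have "a M = b M"
  proof -
    have "(\<lambda>N. (R N - (\<Sum>n<Suc M. b n * real N powi (- int n))) - (R N - (\<Sum>n<Suc M. a n * real N powi (- int n))))
        \<in> O(\<lambda>N. real N powi (- int (Suc M)))"
      using Suc.prems(2,1) unfolding expansion_upto_def by (rule sum_in_bigo)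
    moreover have "(\<lambda>N. (R N - (\<Sum>n<Suc M. b n * real N powi (- int n))) - (R N - (\<Sum>n<Suc M. a n * real N powi (- int n))))
        = (\<lambda>N. (a M - b M) * real N powi (- int M))"
      using IH by (simp add: algebra_simps)
    ultimately have "(\<lambda>N. (a M - b M) * real N powi (- int M)) \<in> O(\<lambda>N. real N powi (- int (Suc M)))"
      by (simp only:)
    then obtain C where C: "eventually (\<lambda>N. norm ((a M - b M) * real N powi (- int M))
        \<le> C * norm (real N powi (- int (Suc M)))) sequentially"
      by (elim landau_o.bigE)
    then have "eventually (\<lambda>N. norm (a M - b M) \<le> C * (1 / real N)) sequentially"
      using eventually_gt_at_top[of 0]
    proof eventually_elim
      case (elim N)
      have p: "real N powi (- int k) = inverse (real N ^ k)" for k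
        by (simp add: power_int_minus)
      have "\<bar>a M - b M\<bar> * inverse (real N ^ M) \<le> (C * (1 / real N)) * inverse (real N ^ M)"
        using elim(1) unfolding p by (simp add: abs_mult inverse_eq_divide mult_ac)
      moreover have "0 < inverse (real N ^ M)" using elim(2) by simp
      ultimately have "\<bar>a M - b M\<bar> \<le> C * (1 / real N)" by (rule mult_right_le_imp_le)
      then show ?case by simp
    qed
    moreover have "(\<lambda>N. C * (1 / real N)) \<longlonglongrightarrow> C * 0"
      by (intro tendsto_intros lim_1_over_n)
    ultimately have "norm (a M - b M) \<le> C * 0"
      by (intro tendsto_le[OF _ _ tendsto_const]) auto
    then show ?thesis by simp
  qed
  with IH Suc.prems(3) show ?case by (cases "n = M") auto
qed simp

lemma expansion_uptoI:
  assumes "\<forall>N>0. \<bar>R N - (\<Sum>n<M. a n * (1 / real N) ^ n)\<bar> \<le> C * (1 / real N) ^ M"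
  shows "expansion_upto R a M"
proof -
  have p: "real N powi (- int n) = (1 / real N) ^ n" for N n
    by (simp add: power_int_minus power_divide inverse_eq_divide)
  show ?thesis
    unfolding expansion_upto_def p
    by (rule bigoI[of _ C], rule eventually_sequentiallyI[of 1]) (use assms in auto)
qed

lemma has_asymptotic_expansion_iff:
  "has_asymptotic_expansion R a \<longleftrightarrow> (\<forall>M\<ge>1. expansion_upto R a M)"
  by (simp add: has_asymptotic_expansion_def expansion_upto_def)

lemma has_asymptotic_expansion_unique:
  assumes "has_asymptotic_expansion R a" "has_asymptotic_expansion R b"
  shows "a = b"
proof
  fix n
  show "a n = b n"
    using expansion_upto_unique[of R a "Suc n" b n] assms unfolding has_asymptotic_expansion_iff by simp
qed

text \<open>Each order may come with its own coefficient sequence. Uniqueness makes the sequences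
  agree where they overlap, and a diagonal choice joins them; orders from 3 on all involve the
  coefficient 2.\<close>

lemma expansion_from_truncations:
  assumes "\<And>M. 3 \<le> M \<Longrightarrow> \<exists>a. expansion_upto R a M \<and> a 2 = A"
  shows "\<exists>a. has_asymptotic_expansion R a \<and> a 2 = A"
proof -
  obtain b where b: "\<And>M. 3 \<le> M \<Longrightarrow> expansion_upto R (b M) M" "\<And>M. 3 \<le> M \<Longrightarrow> b M 2 = A"
    using assms by metis
  \<comment> \<open>The order \<open>n + 3\<close> is both admissible and large enough to determine
    coefficient \<open>n\<close>.\<close>
  define a where "a n = b (n + 3) n" for n
  have "expansion_upto R a M" for M
  proof -
    have e: "expansion_upto R (b (M + 3)) (M + 3)" using b(1) by simp
    have "a n = b (M + 3) n" if "n < M" for n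
      unfolding a_def
    proof (rule expansion_upto_unique[of R "b (n + 3)" "n + 3" "b (M + 3)" n])
      show "expansion_upto R (b (n + 3)) (n + 3)" using b(1) by simp
      show "expansion_upto R (b (M + 3)) (n + 3)"
        using that by (intro expansion_upto_mono[OF e]) simp
    qed simp
    moreover have "expansion_upto R (b (M + 3)) M" by (rule expansion_upto_mono[OF e]) simp
    ultimately show ?thesis by (simp add: expansion_upto_def)
  qed
  moreover have "a 2 = A" unfolding a_def by (rule b(2)) simp
  ultimately show ?thesis unfolding has_asymptotic_expansion_iff by blast
qed

section \<open>Gluing the expansions at the vertices\<close>

lemma face_integral_cong: "(\<And>x. x \<in> g \<Longrightarrow> f x = h x) \<Longrightarrow> face_integral g f = face_integral g h"
  unfolding face_integral_def set_lebesgue_integral_def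
  by (intro Bochner_Integration.integral_cong) (auto simp: indicator_def)

lemma face_integral_eq_0: "(\<And>x. x \<in> g \<Longrightarrow> f x = 0) \<Longrightarrow> face_integral g f = 0"
  using face_integral_cong[of g f "\<lambda>x. 0"] by (simp add: face_integral_def set_lebesgue_integral_def)

lemma face_integral_sum:
  assumes "\<And>i. i \<in> I \<Longrightarrow> set_integrable (lattice_measure g) g (f i)"
  shows "face_integral g (\<lambda>x. \<Sum>i\<in>I. f i x) = (\<Sum>i\<in>I. face_integral g (f i))"
  using assms unfolding face_integral_def set_lebesgue_integral_def set_integrable_def scaleR_sum_right
  by (intro Bochner_Integration.integral_sum)

locale delzant_polytope = halfspace_polytope P H \<delta>
  for P :: "(real^'n) set" and H \<delta> +
  assumes lattice_P: "lattice_polytope P" and delzant_P: "delzant P" and nonempty: "P \<noteq> {}"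
begin

lemma vertex_chart_exists:
  assumes v: "v extreme_point_of P"
  obtains e \<alpha> \<epsilon> where "vertex_chart P v e \<alpha> \<epsilon> H \<delta>"
proof -
  obtain e \<alpha> \<epsilon> where f: "lattice_frame e \<alpha>" "\<And>x i. x \<in> P \<Longrightarrow> 0 \<le> \<alpha> i \<bullet> (x - v)"
    "\<epsilon> > 0" "\<And>i. v + \<epsilon> *\<^sub>R e i \<in> P"
    using delzant_vertex_frame[OF poly delzant_P v] by metis
  have "vertex_chart P v e \<alpha> \<epsilon> H \<delta>"
    by unfold_locales (use f v poly lattice_P in \<open>auto simp: lattice_polytope_def\<close>)
  then show thesis by (rule that)
qed

text \<open>The sums run over all faces, whatever the vertex at which \<open>G\<close> is supported;
  only in this form is the expression additive over the pieces of a partition.\<close>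

definition second_coeff :: "(real^'n \<Rightarrow> real) \<Rightarrow> real" where
  "second_coeff G = - (1/12) * (\<Sum>g\<in>faces_of_dim P (int CARD('n) - 1). facet_term P G g)
    + (\<Sum>g\<in>faces_of_dim P (int CARD('n) - 2). ridge_coeff P g * face_integral g G)"

lemma finite_faces_of_dim: "finite (faces_of_dim P k)"
  by (rule finite_subset[OF _ finite_polytope_faces[OF poly]]) (auto simp: faces_of_dim_def)

text \<open>The faces missing \<open>v\<close> lie in \<open>away v\<close> and contribute
  nothing.\<close>

lemma sum_faces_at_vertex:
  assumes v: "v extreme_point_of P"
    and z: "\<And>g. g \<in> faces_of_dim P k \<Longrightarrow> (\<And>x. x \<in> g \<Longrightarrow> x \<in> away v) \<Longrightarrow> h g = (0::real)"
  shows "(\<Sum>g\<in>{g \<in> faces_of_dim P k. v \<in> g}. h g) = (\<Sum>g\<in>faces_of_dim P k. h g)"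
proof (rule sum.mono_neutral_left[OF finite_faces_of_dim])
  show "\<forall>g\<in>faces_of_dim P k - {g \<in> faces_of_dim P k. v \<in> g}. h g = 0"
  proof
    fix g assume g: "g \<in> faces_of_dim P k - {g \<in> faces_of_dim P k. v \<in> g}"
    have "g \<subseteq> away v"
      using g v by (intro face_subset_away) (auto simp: faces_of_dim_def extreme_point_of_def)
    then show "h g = 0" using z g by blast
  qed
qed auto

lemma vertex_expansion:
  assumes v: "v extreme_point_of P" and M: "2 \<le> M"
    and G: "C_diff M G" "\<And>x. x \<in> away v \<Longrightarrow> G x = 0"
  shows "\<exists>a C. (\<forall>N>0. \<bar>lattice_sum P G N
    - (\<Sum>n<M. a n * (1 / real N) ^ n)\<bar> \<le> C * (1 / real N) ^ M) \<and> a 2 = second_coeff G"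
proof -
  obtain e \<alpha> \<epsilon> where "vertex_chart P v e \<alpha> \<epsilon> H \<delta>" by (rule vertex_chart_exists[OF v])
  then interpret vertex_chart P v e \<alpha> \<epsilon> H \<delta> .
  have GM: "local_fun M G" using G by (simp add: local_fun_def)
  have G2: "local_fun 2 G" using G C_diff_mono[OF G(1) M] by (simp add: local_fun_def)
  have "coeff 2 (\<lambda>x. G (chart x)) = second_coeff G"
    unfolding coeff_2_local[OF G2] second_coeff_def
    by (intro arg_cong2[of _ _ _ _ "(+)"] arg_cong[of _ _ "(*) (- (1 / 12))"] sum_faces_at_vertex[OF v])
      (auto intro!: face_integral_eq_0 Dv_eq_0[OF open_away] G(2))
  then show ?thesis using local_expansion[OF GM] by (elim exE) (intro exI conjI; assumption)
qed

text \<open>Needed to add the face integrals of the pieces. A face through \<open>v\<close> is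
  treated in the chart; on any other face the piece is identically 0.\<close>

lemma face_integrable:
  assumes v: "v extreme_point_of P" and G: "C_diff 0 G" "\<And>x. x \<in> away v \<Longrightarrow> G x = 0"
    and g: "g face_of P"
  shows "set_integrable (lattice_measure g) g G"
proof (cases "v \<in> g")
  case True
  obtain e \<alpha> \<epsilon> where "vertex_chart P v e \<alpha> \<epsilon> H \<delta>" by (rule vertex_chart_exists[OF v])
  then interpret vertex_chart P v e \<alpha> \<epsilon> H \<delta> .
  obtain J where J: "g = coordinate_face J" using face_is_coordinate_face[OF g True] by blast
  show ?thesis
    unfolding J by (rule integrable_coordinate_face[of 0]) (use G in \<open>auto simp: local_fun_def\<close>)
next
  case False
  then have "g \<subseteq> away v"
    using v g by (intro face_subset_away) (auto simp: extreme_point_of_def)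
  then have "indicator g x *\<^sub>R G x = 0" for x
    using G(2)[of x] by (cases "x \<in> g") auto
  then have "(\<lambda>x. indicator g x *\<^sub>R G x) = (\<lambda>x. 0)" by (rule ext)
  then show ?thesis by (simp only: set_integrable_def integrable_zero)
qed

lemma vertex_exists: obtains v where "v extreme_point_of P"
  using extreme_point_exists_convex[OF polytope_imp_compact[OF poly] polytope_imp_convex[OF poly] nonempty] .

text \<open>The polytope is the coordinate face of the empty index set. Hence the normalizing
  exponent in the Riemann sum is the dimension of the space, and derivatives within \<open>P\<close>
  are unique.\<close>

lemma full_dimensional: "aff_dim P = int CARD('n)" "interior P \<noteq> {}"
proof -
  obtain v where v: "v extreme_point_of P" by (rule vertex_exists)
  obtain e \<alpha> \<epsilon> where "vertex_chart P v e \<alpha> \<epsilon> H \<delta>" by (rule vertex_chart_exists[OF v])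
  then interpret vertex_chart P v e \<alpha> \<epsilon> H \<delta> .
  have P: "coordinate_face {} = P" by (simp add: coordinate_face_def)
  show "aff_dim P = int CARD('n)" using aff_dim_coordinate_face[of "{}"] by (simp add: P)
  have "affine hull P = UNIV" using affine_hull_coordinate_face[of "{}"] by (simp add: P)
  then have "rel_interior P = interior P" by (rule rel_interior_interior)
  then show "interior P \<noteq> {}" using rel_interior_eq_empty[OF convex_P] nonempty by simp
qed

text \<open>The partition, and with it the sequence \<open>a\<close>, depends on \<open>M\<close>.
  The value at 2 does not, because the cutoffs sum to 1 on \<open>P\<close> and so drop out of the
  face integrals.\<close>

lemma truncated_expansion:
  assumes \<psi>: "smooth \<psi>" "\<And>x. x \<in> P \<Longrightarrow> \<phi> x = \<psi> x" and M: "3 \<le> M"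
  shows "\<exists>a. expansion_upto (riemann_sum P \<phi>) a M \<and> a 2 =
      - (1/12) * (\<Sum>g \<in> faces_of_dim P (int CARD('n) - 1).
          1 / (inward_primitive_normal P g \<bullet> inward_primitive_normal P g)
            * face_integral g (dir_deriv P (inward_primitive_normal P g) \<phi>))
      + (\<Sum>g \<in> faces_of_dim P (int CARD('n) - 2). ridge_coeff P g * face_integral g \<phi>)"
    (is "\<exists>a. _ \<and> a 2 = ?A")
proof -
  let ?V = "{v. v extreme_point_of P}"
  have fin: "finite ?V" by (rule finite_polyhedron_extreme_points[OF polytope_imp_polyhedron[OF poly]])
  obtain \<omega> where \<omega>: "\<And>v. v \<in> ?V \<Longrightarrow> C_diff M (\<omega> v)" "\<And>v x. v \<in> ?V \<Longrightarrow> x \<in> away v \<Longrightarrow> \<omega> v x = 0"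
    "\<And>x. x \<in> P \<Longrightarrow> (\<Sum>v\<in>?V. \<omega> v x) = 1"
    using partition_of_unity[of M] by blast
  define G where "G v x = \<omega> v x * \<psi> x" for v x
  have GM: "C_diff M (G v)" if "v \<in> ?V" for v
    unfolding G_def[abs_def] using \<omega>(1)[OF that] \<psi>(1) by (intro C_diff_mult) (auto simp: smooth_def)
  have G0: "G v x = 0" if "v \<in> ?V" "x \<in> away v" for v x
    using \<omega>(2)[OF that] by (simp add: G_def)
  have Gsum: "(\<Sum>v\<in>?V. G v x) = \<phi> x" if "x \<in> P" for x
    using \<omega>(3)[OF that] \<psi>(2)[OF that] by (simp add: G_def sum_distrib_right[symmetric])
  have G1: "C_diff (Suc 0) (G v)" if "v \<in> ?V" for v
    using C_diff_mono[OF GM[OF that], of "Suc 0"] M by (simp del: C_diff.simps)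
  have Gd: "G v differentiable at x" if "v \<in> ?V" for v x
    using G1[OF that] C_diff_has_derivative differentiable_def by blast
  define S where "S v N = lattice_sum P (G v) N" for v N
  \<comment> \<open>Coefficients and error constant are packed into one pair so that both are chosen
    together for each vertex.\<close>
  define Q where "Q v p \<longleftrightarrow> (\<forall>N>0. \<bar>S v N - (\<Sum>n<M. fst p n * (1 / real N) ^ n)\<bar> \<le> snd p * (1 / real N) ^ M)
      \<and> fst p 2 = second_coeff (G v)" for v p
  have "\<exists>p. Q v p" if "v \<in> ?V" for v
    unfolding Q_def S_def split_paired_Ex fst_conv snd_conv using that M GM G0 by (intro vertex_expansion) auto
  then obtain p where p: "\<And>v. v \<in> ?V \<Longrightarrow> Q v (p v)" by metis
  define a where "a v = fst (p v)" for v
  define C where "C v = snd (p v)" for v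
  have a: "\<And>v N. v \<in> ?V \<Longrightarrow> N > 0 \<Longrightarrow>
      \<bar>S v N - (\<Sum>n<M. a v n * (1 / real N) ^ n)\<bar> \<le> C v * (1 / real N) ^ M"
    and a2: "\<And>v. v \<in> ?V \<Longrightarrow> a v 2 = second_coeff (G v)"
    using p unfolding Q_def a_def C_def by blast+
  have "expansion_upto (riemann_sum P \<phi>) (\<lambda>n. \<Sum>v\<in>?V. a v n) M"
  proof (rule expansion_uptoI, intro allI impI)
    fix N :: nat assume N: "0 < N"
    have "(\<Sum>\<gamma>\<in>(\<lambda>x. real N *\<^sub>R x) ` P \<inter> int_lattice. \<phi> (\<gamma> /\<^sub>R real N))
        = (\<Sum>\<gamma>\<in>(\<lambda>x. real N *\<^sub>R x) ` P \<inter> int_lattice. \<Sum>v\<in>?V. G v (\<gamma> /\<^sub>R real N))"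
      using N by (intro sum.cong refl Gsum[symmetric]) auto
    then have "riemann_sum P \<phi> N = (\<Sum>v\<in>?V. S v N)"
      by (subst (asm) sum.swap)
        (simp add: S_def lattice_sum_def riemann_sum_def full_dimensional power_int_minus power_divide inverse_eq_divide sum_distrib_left)
    then have "riemann_sum P \<phi> N - (\<Sum>n<M. (\<Sum>v\<in>?V. a v n) * (1 / real N) ^ n)
        = (\<Sum>v\<in>?V. S v N - (\<Sum>n<M. a v n * (1 / real N) ^ n))"
      unfolding sum_distrib_right sum_subtractf by (subst (2) sum.swap) simp
    also have "\<bar>\<dots>\<bar> \<le> (\<Sum>v\<in>?V. C v * (1 / real N) ^ M)"
      using a N by (intro order_trans[OF sum_abs] sum_mono) auto
    finally show "\<bar>riemann_sum P \<phi> N - (\<Sum>n<M. (\<Sum>v\<in>?V. a v n) * (1 / real N) ^ n)\<bar>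
        \<le> (\<Sum>v\<in>?V. C v) * (1 / real N) ^ M"
      by (simp only: sum_distrib_right)
  qed
  moreover have "(\<Sum>v\<in>?V. a v 2) = ?A"
  proof -
    have faceP: "g face_of P" "g \<subseteq> P" if "g \<in> faces_of_dim P k" for g k
      using that by (auto simp: faces_of_dim_def dest: face_of_imp_subset)
    have 1: "(\<Sum>v\<in>?V. face_integral g (Dv w (G v))) = face_integral g (dir_deriv P w \<phi>)"
      if g: "g \<in> faces_of_dim P k" for g k w
    proof -
      have "(\<Sum>v\<in>?V. face_integral g (Dv w (G v))) = face_integral g (\<lambda>x. \<Sum>v\<in>?V. Dv w (G v) x)"
        by (intro face_integral_sum[symmetric] face_integrable[OF _ C_diff_Dv[OF G1]])
          (auto intro: faceP[OF g] Dv_eq_0[OF open_away] G0)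
      also have "\<dots> = face_integral g (dir_deriv P w \<phi>)"
      proof (rule face_integral_cong)
        fix x assume "x \<in> g"
        then have x: "x \<in> P" using faceP[OF g] by blast
        \<comment> \<open>The sum of the pieces agrees with \<open>\<phi>\<close> only on
          \<open>P\<close>; uniqueness of the derivative within \<open>P\<close> carries the
          identity to derivatives, including at the boundary.\<close>
        have "dir_deriv P w \<phi> x = Dv w (\<lambda>x. \<Sum>v\<in>?V. 1 * G v x) x"
          using Gsum Gd
          by (intro dir_deriv_eq_Dv polytope_imp_convex poly full_dimensional x) (auto intro!: differentiable_sum fin)
        then show "(\<Sum>v\<in>?V. Dv w (G v) x) = dir_deriv P w \<phi> x"
          using Dv_sum[of ?V G x w "\<lambda>_. 1"] Gd by simp
      qed
      finally show ?thesis .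
    qed
    have 2: "(\<Sum>v\<in>?V. face_integral g (G v)) = face_integral g \<phi>" if g: "g \<in> faces_of_dim P k" for g k
    proof -
      have "(\<Sum>v\<in>?V. face_integral g (G v)) = face_integral g (\<lambda>x. \<Sum>v\<in>?V. G v x)"
        by (intro face_integral_sum[symmetric] face_integrable[OF _ C_diff_SucD[OF G1]])
          (auto intro: faceP[OF g] G0)
      also have "\<dots> = face_integral g \<phi>"
        using Gsum faceP[OF g] by (intro face_integral_cong) auto
      finally show ?thesis .
    qed
    have "(\<Sum>v\<in>?V. a v 2) = (\<Sum>v\<in>?V. second_coeff (G v))" using a2 by simp
    also have "\<dots> = - (1/12) * (\<Sum>g \<in> faces_of_dim P (int CARD('n) - 1).
          1 / (inward_primitive_normal P g \<bullet> inward_primitive_normal P g)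
            * (\<Sum>v\<in>?V. face_integral g (Dv (inward_primitive_normal P g) (G v))))
      + (\<Sum>g \<in> faces_of_dim P (int CARD('n) - 2). ridge_coeff P g * (\<Sum>v\<in>?V. face_integral g (G v)))"
      unfolding second_coeff_def sum.distrib sum_distrib_left
      by (intro arg_cong2[of _ _ _ _ "(+)"]; subst sum.swap) (simp_all add: mult.assoc)
    finally show ?thesis using 1 2 by simp
  qed
  ultimately show ?thesis by (intro exI[of _ "\<lambda>n. \<Sum>v\<in>?V. a v n"]) simp
qed

end

theorem corollary5p6:
  fixes P :: "(real ^ 'n) set" and \<phi> :: "real ^ 'n \<Rightarrow> real"
  assumes "lattice_polytope P" and "delzant P" and "\<phi> \<in> C_infinity P"
  shows "has_asymptotic_expansion (riemann_sum P \<phi>) (riemann_coeff P \<phi>) \<and>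
    riemann_coeff P \<phi> 2 =
      - (1/12) * (\<Sum>g \<in> faces_of_dim P (int CARD('n) - 1).
          1 / (inward_primitive_normal P g \<bullet> inward_primitive_normal P g)
            * face_integral g (dir_deriv P (inward_primitive_normal P g) \<phi>))
      + (\<Sum>g \<in> faces_of_dim P (int CARD('n) - 2). ridge_coeff P g * face_integral g \<phi>)"
    (is "_ \<and> _ = ?A")
proof -
  have "\<exists>a. has_asymptotic_expansion (riemann_sum P \<phi>) a \<and> a 2 = ?A"
  proof (cases "P = {}")
    case True
    \<comment> \<open>The empty polytope has no vertex to supply a chart, but all sums involved are
      empty.\<close>
    have "has_asymptotic_expansion (riemann_sum P \<phi>) (\<lambda>n. 0)"
      by (simp add: True riemann_sum_def has_asymptotic_expansion_def)
    moreover have "faces_of_dim P k = {}" for k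
      by (auto simp: True faces_of_dim_def)
    ultimately show ?thesis by (intro exI[of _ "\<lambda>n. 0"]) simp
  next
    case False
    have poly: "polytope P" using assms(1) by (simp add: lattice_polytope_def)
    obtain H \<delta> where "halfspace_polytope P H \<delta>" by (rule polytope_halfspaces[OF poly])
    then interpret delzant_polytope P H \<delta>
      using assms False by (simp add: delzant_polytope_def delzant_polytope_axioms_def)
    obtain \<psi> where "smooth \<psi>" "\<And>x. x \<in> P \<Longrightarrow> \<phi> x = \<psi> x"
      using assms(3) by (auto simp: C_infinity_def)
    from truncated_expansion[OF this] show ?thesis
      by (rule expansion_from_truncations)
  qed
  then obtain a where a: "has_asymptotic_expansion (riemann_sum P \<phi>) a" "a 2 = ?A" by blast
  have "riemann_coeff P \<phi> = a"
    unfolding riemann_coeff_def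
    using a(1) has_asymptotic_expansion_unique by (intro the_equality) blast+
  with a show ?thesis by simp
qed

end
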